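(* Let $n\ge2$ and let $R:\mathfrak Z_n\to\mathfrak Z_n$ be a bounded upper triangular operator. Then for every $1\le k<n$, the operator $R_k-R^k$ is strictly singular on $\mathfrak Z_k$.
   Context: Let $\mathbb S=\{z\in\mathbb C:0<\mathrm{Re}\,z<1\}$ and let $\mathcal C$ be the Calderón space of the pair $(\ell_\infty,\ell_1)$: bounded continuous functions $f:\overline{\mathbb S}\to\ell_\infty$, holomorphic on $\mathbb S$, with $f(1+it)\in\ell_1$ for all real $t$ and $\|f\|_{\mathcal C}=\max(\sup_t\|f(it)\|_\infty,\sup_t\|f(1+it)\|_1)<\infty$. For $m\ge1$ the Rochberg space $\mathfrak Z_m$ is the space of arrays $(x_{m-1},\dots,x_0)\in\ell_\infty^m$ for which there is $f\in\mathcal C$ with $x_j=f^{(j)}(1/2)/j!$ for $0\le j\le m-1$, normed by the infimum of $\|f\|_{\mathcal C}$ over such $f$. For $k<m$, $\imath_{k,m}:\mathfrak Z_k\to\mathfrak Z_m$, $(x_{k-1},\dots,x_0)\mapsto(x_{k-1},\dots,x_0,0,\dots,0)$ is an isomorphic embedding and $\pi_{m,k}:\mathfrak Z_m\to\mathfrak Z_k$, $(x_{m-1},\dots,x_0)\mapsto(x_{k-1},\dots,x_0)$ is a quotient map with kernel $\imath_{m-k,m}[\mathfrak Z_{m-k}]$. A bounded operator $R$ on $\mathfrak Z_n$ is upper triangular if $R[\imath_{k,n}[\mathfrak Z_k]]\subseteq\imath_{k,n}[\mathfrak Z_k]$ for every $1\le k<n$ (equivalently, $R$ is given by an upper triangular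 matrix $(a_{ij})$ acting on arrays). For such $R$ and $1\le k<n$: $R_k\in\mathfrak L(\mathfrak Z_k)$ is the restriction $R_k=\imath_{k,n}^{-1}R\,\imath_{k,n}$ (the upper-left $k\times k$ block), and $R^k\in\mathfrak L(\mathfrak Z_k)$ is the operator induced on the quotient, determined by $R^k\pi_{n,k}=\pi_{n,k}R$ (the lower-right $k\times k$ block). An operator is strictly singular if its restriction to no infinite-dimensional closed subspace is an isomorphism. *)

theory Defs
  imports "HOL-Analysis.Analysis"
begin

type_synonym seq = "nat \<Rightarrow> complex"
(* Arrays (x_{m-1},...,x_0) of sequences: x j is the j-th entry; entries j >= m are 0. *)
type_synonym arr = "nat \<Rightarrow> nat \<Rightarrow> complex"

definition linf_bdd :: "seq \<Rightarrow> bool" where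
  "linf_bdd x \<longleftrightarrow> bdd_above (range (\<lambda>i. cmod (x i)))"

definition linf_norm :: "seq \<Rightarrow> real" where
  "linf_norm x = (SUP i. cmod (x i))"

definition l1_norm :: "seq \<Rightarrow> real" where
  "l1_norm x = (\<Sum>i. cmod (x i))"

definition closed_strip :: "complex set" where
  "closed_strip = {z. 0 \<le> Re z \<and> Re z \<le> 1}"

definition open_strip :: "complex set" where
  "open_strip = {z. 0 < Re z \<and> Re z < 1}"

definition linf_holomorphic_on :: "(complex \<Rightarrow> seq) \<Rightarrow> complex set \<Rightarrow> bool" where
  "linf_holomorphic_on f S \<longleftrightarrow>
     (\<forall>z\<in>S. \<exists>D. linf_bdd D \<and>
        ((\<lambda>w. linf_norm (\<lambda>i. (f w i - f z i) / (w - z) - D i)) \<longlongrightarrow> 0) (at z))"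

definition calderon :: "(complex \<Rightarrow> seq) set" where
  "calderon = {f.
     (\<forall>z\<in>closed_strip. linf_bdd (f z)) \<and>
     bdd_above (linf_norm ` f ` closed_strip) \<and>
     (\<forall>z\<in>closed_strip. \<forall>e>0. \<exists>d>0. \<forall>w\<in>closed_strip.
         cmod (w - z) < d \<longrightarrow> linf_norm (\<lambda>i. f w i - f z i) < e) \<and>
     linf_holomorphic_on f open_strip \<and>
     (\<forall>t::real. summable (\<lambda>i. cmod (f (1 + complex_of_real t * \<i>) i))) \<and>
     bdd_above (range (\<lambda>t::real. l1_norm (f (1 + complex_of_real t * \<i>))))}"

definition calderon_norm :: "(complex \<Rightarrow> seq) \<Rightarrow> real" where
  "calderon_norm f = max (SUP t::real. linf_norm (f (complex_of_real t * \<i>)))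
                         (SUP t::real. l1_norm (f (1 + complex_of_real t * \<i>)))"

(* j-th Taylor coefficient at 1/2, computed coordinatewise (coordinate evaluation is a
   bounded linear functional on l_infinity, so this is the i-th coordinate of f^(j)(1/2)/j!) *)
definition taylor_coeff :: "(complex \<Rightarrow> seq) \<Rightarrow> nat \<Rightarrow> seq" where
  "taylor_coeff f j = (\<lambda>i. (deriv ^^ j) (\<lambda>z. f z i) (1/2) / of_nat (fact j))"

definition represents :: "nat \<Rightarrow> (complex \<Rightarrow> seq) \<Rightarrow> arr \<Rightarrow> bool" where
  "represents m f x \<longleftrightarrow> f \<in> calderon \<and> (\<forall>j<m. x j = taylor_coeff f j)"

definition Zsp :: "nat \<Rightarrow> arr set" where
  "Zsp m = {x. (\<exists>f. represents m f x) \<and> (\<forall>j\<ge>m. x j = (\<lambda>i. 0))}"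

definition Znorm :: "nat \<Rightarrow> arr \<Rightarrow> real" where
  "Znorm m x = Inf {calderon_norm f | f. represents m f x}"

definition arr_diff :: "arr \<Rightarrow> arr \<Rightarrow> arr" where
  "arr_diff x y = (\<lambda>j i. x j i - y j i)"

definition arr_add :: "arr \<Rightarrow> arr \<Rightarrow> arr" where
  "arr_add x y = (\<lambda>j i. x j i + y j i)"

definition arr_scale :: "complex \<Rightarrow> arr \<Rightarrow> arr" where
  "arr_scale c x = (\<lambda>j i. c * x j i)"

definition arr_zero :: arr where
  "arr_zero = (\<lambda>j i. 0)"

definition bounded_op :: "nat \<Rightarrow> (arr \<Rightarrow> arr) \<Rightarrow> bool" where
  "bounded_op m T \<longleftrightarrow>
     (\<forall>x\<in>Zsp m. T x \<in> Zsp m) \<and>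
     (\<forall>x\<in>Zsp m. \<forall>y\<in>Zsp m. T (arr_add x y) = arr_add (T x) (T y)) \<and>
     (\<forall>c. \<forall>x\<in>Zsp m. T (arr_scale c x) = arr_scale c (T x)) \<and>
     (\<exists>C. \<forall>x\<in>Zsp m. Znorm m (T x) \<le> C * Znorm m x)"

(* imath_{k,n}: (x_{k-1},...,x_0) |-> (x_{k-1},...,x_0,0,...,0) *)
definition emb :: "nat \<Rightarrow> nat \<Rightarrow> arr \<Rightarrow> arr" where
  "emb k n x = (\<lambda>j. if n - k \<le> j \<and> j < n then x (j - (n - k)) else (\<lambda>i. 0))"

definition emb_inv :: "nat \<Rightarrow> nat \<Rightarrow> arr \<Rightarrow> arr" where
  "emb_inv k n y = (\<lambda>j. if j < k then y (j + (n - k)) else (\<lambda>i. 0))"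

definition proj :: "nat \<Rightarrow> nat \<Rightarrow> arr \<Rightarrow> arr" where
  "proj m k y = (\<lambda>j. if j < k then y j else (\<lambda>i. 0))"

definition upper_triangular :: "nat \<Rightarrow> (arr \<Rightarrow> arr) \<Rightarrow> bool" where
  "upper_triangular n R \<longleftrightarrow> bounded_op n R \<and>
     (\<forall>k. 1 \<le> k \<and> k < n \<longrightarrow> (\<forall>x\<in>Zsp k. R (emb k n x) \<in> emb k n ` Zsp k))"

definition restr_op :: "nat \<Rightarrow> nat \<Rightarrow> (arr \<Rightarrow> arr) \<Rightarrow> arr \<Rightarrow> arr" where
  "restr_op n k R x = emb_inv k n (R (emb k n x))"

(* R^k, determined by R^k pi_{n,k} = pi_{n,k} R *)
definition quot_op :: "nat \<Rightarrow> nat \<Rightarrow> (arr \<Rightarrow> arr) \<Rightarrow> arr \<Rightarrow> arr" where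
  "quot_op n k R x = proj n k (R (SOME y. y \<in> Zsp n \<and> proj n k y = x))"

definition is_subspace :: "arr set \<Rightarrow> bool" where
  "is_subspace Y \<longleftrightarrow> arr_zero \<in> Y \<and> (\<forall>x\<in>Y. \<forall>y\<in>Y. arr_add x y \<in> Y) \<and>
                      (\<forall>c. \<forall>x\<in>Y. arr_scale c x \<in> Y)"

definition finite_dim :: "arr set \<Rightarrow> bool" where
  "finite_dim Y \<longleftrightarrow> (\<exists>B. finite B \<and> B \<subseteq> Y \<and>
      (\<forall>y\<in>Y. \<exists>c. y = (\<lambda>j i. \<Sum>b\<in>B. c b * b j i)))"

definition Z_closed :: "nat \<Rightarrow> arr set \<Rightarrow> bool" where
  "Z_closed m Y \<longleftrightarrow> (\<forall>s y. (\<forall>l. s l \<in> Y) \<longrightarrow> y \<in> Zsp m \<longrightarrow>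
      (\<lambda>l. Znorm m (arr_diff (s l) y)) \<longlonglongrightarrow> 0 \<longrightarrow> y \<in> Y)"

(* T is strictly singular on Z_m: no infinite-dimensional closed subspace on which
   T is an isomorphism (onto its image), i.e. bounded below *)
definition strictly_singular :: "nat \<Rightarrow> (arr \<Rightarrow> arr) \<Rightarrow> bool" where
  "strictly_singular m T \<longleftrightarrow> \<not> (\<exists>Y. Y \<subseteq> Zsp m \<and> is_subspace Y \<and> Z_closed m Y \<and>
      \<not> finite_dim Y \<and> (\<exists>c>0. \<forall>y\<in>Y. c * Znorm m y \<le> Znorm m (T y)))"

end

theory Submission
  imports Defs "HOL-Complex_Analysis.Complex_Analysis" "HOL-Library.Function_Algebras"
begin

text \<open>
  Write \<open>S\<close> for multiplication of jets by \<open>z - 1/2\<close>. If \<open>f\<^sub>1, \<dots>, f\<^sub>N\<close> are disjointly supported in the unit ball of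
  the Calderon space, then so is \<open>N\<^bsup>-z\<^esup> (f\<^sub>1 + \<dots> + f\<^sub>N)\<close>. Hence for disjointly supported \<open>x\<^sub>1, \<dots>, x\<^sub>N\<close> in the unit ball
  of \<open>Z\<^sub>n\<close> whose coefficients of index less than \<open>p\<close> vanish, \<open>N\<^bsup>-1/2\<^esup> (X - (ln N) S X)\<close> with
  \<open>X = x\<^sub>1 + \<dots> + x\<^sub>N\<close> is bounded independently of \<open>N\<close>, up to coefficients of index at least \<open>p + 2\<close>.

  Suppose that \<open>\<pi>\<^bsub>k,i+1\<^esub>\<close> is bounded below on an infinite-dimensional subspace \<open>Y\<close>, where \<open>i + 1 < k\<close> is minimal.
  A gliding hump gives almost disjoint normalized \<open>x\<^sub>l \<in> Y\<close> whose coefficients of index less than \<open>i\<close> are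
  negligible, and the bound forces \<open>ln N\<close> times the \<open>\<ell>\<^sub>2\<close>-norm of the \<open>i\<close>-th coefficient of \<open>N\<^bsup>-1/2\<^esup> X\<close> to stay
  bounded, which is absurd. So every infinite-dimensional subspace of \<open>Z\<^sub>k\<close> contains almost disjoint normalized
  sequences that almost lie in the copy of \<open>\<ell>\<^sub>2\<close> formed by the jets with only the top coefficient.

  On such a sequence \<open>R\<^sub>k - R\<^sup>k\<close> is a sum of diagonal differences, which are the leading coefficients of
  \<open>[R, S] S\<^sup>b\<close> for \<open>b < n - k\<close>. Comparing the bound for the \<open>S\<^sup>b x\<^sub>l\<close> after an application of \<open>R\<close> with the one for
  the \<open>R S\<^sup>b x\<^sub>l\<close>, which can also be made almost disjoint, shows that the leading coefficient of
  \<open>(ln N) N\<^bsup>-1/2\<^esup> [R, S] S\<^sup>b X\<close> is bounded. Hence \<open>R\<^sub>k - R\<^sup>k\<close> maps \<open>N\<^bsup>-1/2\<^esup> X\<close> to an element of norm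
  \<open>O(1 / ln N)\<close> and is not bounded below.
\<close>

section \<open>Bounded holomorphic functions on the strip\<close>

lemma open_open_strip: "open open_strip"
proof -
  have "open_strip = {z. 0 < Re z} \<inter> {z. Re z < 1}"
    by (auto simp: open_strip_def)
  moreover have "open ({z. 0 < Re z} \<inter> {z. Re z < 1})"
    by (intro open_Int open_halfspace_Re_gt open_halfspace_Re_lt)
  ultimately show ?thesis by simp
qed

lemma open_strip_subset: "open_strip \<subseteq> closed_strip"
  by (auto simp: open_strip_def closed_strip_def)

lemma half_in_open_strip: "1/2 \<in> open_strip"
  by (simp add: open_strip_def)

lemma cball_half_subset: "cball (1/2) (1/4) \<subseteq> open_strip"
proof
  fix z :: complex
  assume "z \<in> cball (1/2) (1/4)"
  then have "cmod (1/2 - z) \<le> 1/4"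
    by (simp add: dist_norm)
  then have "\<bar>Re (1/2 - z)\<bar> \<le> 1/4"
    using abs_Re_le_cmod order_trans by blast
  then have "\<bar>1/2 - Re z\<bar> \<le> 1/4"
    by simp
  then show "z \<in> open_strip"
    unfolding open_strip_def mem_Collect_eq by linarith
qed

text \<open>Phragmen-Lindelof: dividing \<open>F\<close> by \<open>1 + e * z\<close>, whose modulus
  is at least 1 on the strip and grows with the imaginary part, reduces the bounded case to the
  maximum principle on a rectangle; then \<open>e\<close> tends to 0.\<close>

lemma strip_max_principle:
  fixes F :: "complex \<Rightarrow> complex"
  assumes hol: "F holomorphic_on open_strip" and cont: "continuous_on closed_strip F"
    and bdd: "\<And>z. z \<in> closed_strip \<Longrightarrow> cmod (F z) \<le> B"
    and bd0: "\<And>z. Re z = 0 \<Longrightarrow> cmod (F z) \<le> K"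
    and bd1: "\<And>z. Re z = 1 \<Longrightarrow> cmod (F z) \<le> K"
    and z: "z \<in> closed_strip"
  shows "cmod (F z) \<le> K"
proof -
  have K: "0 \<le> K"
    using bd0[of 0] norm_ge_zero[of "F 0"] by (simp del: norm_ge_zero)
  have B: "0 \<le> B"
    using bdd[OF z] norm_ge_zero[of "F z"] by linarith
  have est: "cmod (F z) \<le> (K + e) * cmod (1 + of_real e * z)" if e: "e > 0" for e
  proof -
    \<comment> \<open>On the horizontal sides the divisor has modulus at least \<open>e * Y\<close>,
      so a height of \<open>B / (e * (K + e))\<close> brings the quotient below
      \<open>K + e\<close>; the term \<open>\<bar>Im z\<bar>\<close> puts \<open>z\<close> into the
      rectangle.\<close>
    define Y where "Y = \<bar>Im z\<bar> + B / (e * (K + e)) + 1"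
    have Ypos: "Y > 0" "\<bar>Im z\<bar> \<le> Y" "B / (e * (K + e)) \<le> Y"
      using e K B by (auto simp: Y_def intro: add_nonneg_pos)
    define S where "S = cbox (Complex 0 (-Y)) (Complex 1 Y)"
    define G where "G = (\<lambda>w. F w / (1 + of_real e * w))"
    have S_sub: "S \<subseteq> closed_strip"
      by (auto simp: S_def in_cbox_complex_iff closed_strip_def)
    have int: "interior S \<subseteq> open_strip"
      by (auto simp: S_def in_box_complex_iff open_strip_def)
    have re: "1 \<le> Re (1 + of_real e * w)" if "w \<in> closed_strip" for w
      using that e by (simp add: closed_strip_def)
    have ge1: "1 \<le> cmod (1 + of_real e * w)" if "w \<in> closed_strip" for w
      using re[OF that] complex_Re_le_cmod order_trans by blast
    have nz: "1 + of_real e * w \<noteq> 0" if "w \<in> closed_strip" for w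
      using ge1[OF that] by force
    have "cmod (G z) \<le> K + e"
    proof (rule maximum_modulus_frontier[of G S])
      show "G holomorphic_on interior S"
        unfolding G_def using int nz open_strip_subset
        by (intro holomorphic_intros holomorphic_on_subset[OF hol]) auto
      have "continuous_on S G"
        unfolding G_def using S_sub nz
        by (intro continuous_intros continuous_on_subset[OF cont]) auto
      then show "continuous_on (closure S) G"
        by (simp add: S_def)
      show "bounded S"
        by (simp add: S_def)
      show "z \<in> S"
        using z Ypos(2) by (auto simp: S_def in_cbox_complex_iff closed_strip_def)
      fix w assume "w \<in> frontier S"
      then have w: "w \<in> S" "w \<notin> box (Complex 0 (-Y)) (Complex 1 Y)"
        by (auto simp: S_def frontier_cbox)
      then have cs: "w \<in> closed_strip"
        using S_sub by auto
      have "Re w = 0 \<or> Re w = 1 \<or> \<bar>Im w\<bar> = Y"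
        using w by (auto simp: S_def in_cbox_complex_iff in_box_complex_iff)
      then show "cmod (G w) \<le> K + e"
      proof (elim disjE)
        assume "\<bar>Im w\<bar> = Y"
        moreover have "\<bar>Im (1 + of_real e * w)\<bar> \<le> cmod (1 + of_real e * w)"
          by (rule abs_Im_le_cmod)
        ultimately have "e * Y \<le> cmod (1 + of_real e * w)"
          using e by (simp add: abs_mult)
        moreover have "B \<le> (K + e) * (e * Y)"
        proof -
          have "e * (K + e) > 0"
            using e K by simp
          then have "B \<le> Y * (e * (K + e))"
            using Ypos(3) by (simp only: pos_divide_le_eq)
          then show ?thesis by (simp add: mult_ac)
        qed
        ultimately have "B \<le> (K + e) * cmod (1 + of_real e * w)"
          using e K by (smt (verit) mult_left_mono)
        then have "cmod (F w) \<le> (K + e) * cmod (1 + of_real e * w)"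
          using bdd[OF cs] by linarith
        then show ?thesis
          using nz[OF cs] by (simp add: G_def norm_divide divide_le_eq)
      next
        assume "Re w = 0"
        then have "cmod (F w) \<le> K" by (rule bd0)
        also have "\<dots> \<le> (K + e) * cmod (1 + of_real e * w)"
          using ge1[OF cs] e K by (smt (verit) mult_left_mono mult_cancel_left1)
        finally show ?thesis
          using nz[OF cs] by (simp add: G_def norm_divide divide_le_eq)
      next
        assume "Re w = 1"
        then have "cmod (F w) \<le> K" by (rule bd1)
        also have "\<dots> \<le> (K + e) * cmod (1 + of_real e * w)"
          using ge1[OF cs] e K by (smt (verit) mult_left_mono mult_cancel_left1)
        finally show ?thesis
          using nz[OF cs] by (simp add: G_def norm_divide divide_le_eq)
      qed
    qed
    then show ?thesis
      using nz[OF z] by (simp add: G_def norm_divide divide_le_eq)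
  qed
  have "((\<lambda>e. (K + e) * cmod (1 + of_real e * z)) \<longlongrightarrow> (K + 0) * cmod (1 + of_real 0 * z)) (at_right 0)"
    by (intro tendsto_intros)
  moreover have "\<forall>\<^sub>F e in at_right 0. cmod (F z) \<le> (K + e) * cmod (1 + of_real e * z)"
    using est by (auto simp: eventually_at_right_less intro!: eventually_mono[OF eventually_at_right_less])
  ultimately have "cmod (F z) \<le> (K + 0) * cmod (1 + of_real 0 * z)"
    by (intro tendsto_lowerbound) auto
  then show ?thesis by simp
qed

text \<open>Cauchy's inequality on discs of radius \<open>r\<close> about points of
  \<open>ball z r\<close> bounds the second derivative; the radius \<open>3 * r\<close> leaves room
  for these discs. What matters is that the bound depends on \<open>M\<close> and \<open>r\<close>
  only and is therefore uniform over coordinates.\<close>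

lemma holomorphic_remainder_bound:
  fixes f :: "complex \<Rightarrow> complex"
  assumes hol: "f holomorphic_on ball z (3 * r)" and r: "0 < r"
    and M: "\<And>w. w \<in> ball z (3 * r) \<Longrightarrow> cmod (f w) \<le> M" and w: "w \<in> ball z r"
  shows "cmod (f w - f z - deriv f z * (w - z)) \<le> 2 * M / r\<^sup>2 * (cmod (w - z))\<^sup>2"
proof -
  have B: "cmod ((deriv ^^ 2) f x) \<le> 2 * M / r\<^sup>2" if x: "x \<in> ball z r" for x
  proof -
    have sub: "cball x r \<subseteq> ball z (3 * r)"
    proof
      fix y assume "y \<in> cball x r"
      then show "y \<in> ball z (3 * r)"
        using x r dist_triangle[of z y x] by simp
    qed
    have "cmod ((deriv ^^ 2) f x) \<le> fact 2 * M / r ^ 2"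
    proof (rule Cauchy_inequality)
      show "f holomorphic_on ball x r"
        using sub ball_subset_cball by (intro holomorphic_on_subset[OF hol]) blast
      show "continuous_on (cball x r) f"
        using hol holomorphic_on_imp_continuous_on continuous_on_subset sub by blast
      show "0 < r" by (rule r)
      fix y assume "cmod (x - y) = r"
      then have "y \<in> cball x r" by (simp add: dist_norm)
      then show "cmod (f y) \<le> M" using sub M by blast
    qed
    then show ?thesis by simp
  qed
  have "cmod ((deriv ^^ 0) f w - (\<Sum>i\<le>1. (deriv ^^ i) f z * (w - z) ^ i / fact i))
      \<le> 2 * M / r\<^sup>2 * cmod (w - z) ^ Suc 1 / fact 1"
  proof (rule complex_Taylor[where S = "ball z r" and f = "\<lambda>i. (deriv ^^ i) f"])
    show "convex (ball z r)" by simp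
    show "cmod ((deriv ^^ Suc 1) f x) \<le> 2 * M / r\<^sup>2" if "x \<in> ball z r" for x
      using B[OF that] by (simp add: numeral_2_eq_2)
    fix i x assume x: "x \<in> ball z r" "i \<le> (1::nat)"
    have "(deriv ^^ i) f holomorphic_on ball z (3 * r)"
      using hol by (rule holomorphic_higher_deriv) simp
    moreover have "x \<in> ball z (3 * r)" using x r by auto
    ultimately have "((deriv ^^ i) f has_field_derivative deriv ((deriv ^^ i) f) x) (at x)"
      by (intro holomorphic_derivI) auto
    then show "((deriv ^^ i) f has_field_derivative (deriv ^^ Suc i) f x) (at x within ball z r)"
      by (simp add: has_field_derivative_at_within)
  qed (use w r in auto)
  then show ?thesis
    by (simp add: power2_eq_square algebra_simps)
qed

section \<open>The Calderon space\<close>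

text \<open>Norm continuity at \<open>z\<close>, spelled out as continuity uniform in the coordinate
  so that no supremum has to be handled.\<close>

definition equi_at :: "(complex \<Rightarrow> seq) \<Rightarrow> complex \<Rightarrow> bool" where
  "equi_at f z \<longleftrightarrow> (\<forall>e>0. \<exists>d>0. \<forall>w\<in>closed_strip. cmod (w - z) < d \<longrightarrow>
     (\<forall>i. cmod (f w i - f z i) \<le> e))"

text \<open>The Calderon space with its norm split into the bound \<open>a\<close> on
  \<open>Re z = 0\<close> and the bound \<open>b\<close> on \<open>Re z = 1\<close>: multipliers and
  disjoint sums affect the two differently. Holomorphy is asked coordinatewise; boundedness makes it
  holomorphy in norm.\<close>

definition cald_bd :: "(complex \<Rightarrow> seq) \<Rightarrow> real \<Rightarrow> real \<Rightarrow> bool" where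
  "cald_bd f a b \<longleftrightarrow>
     (\<exists>B. \<forall>z\<in>closed_strip. \<forall>i. cmod (f z i) \<le> B) \<and>
     (\<forall>z\<in>closed_strip. equi_at f z) \<and>
     (\<forall>i. (\<lambda>z. f z i) holomorphic_on open_strip) \<and>
     (\<forall>z i. Re z = 0 \<longrightarrow> cmod (f z i) \<le> a) \<and>
     (\<forall>z A. Re z = 1 \<longrightarrow> finite A \<longrightarrow> (\<Sum>i\<in>A. cmod (f z i)) \<le> b)"

lemma linf_norm_upper: "linf_bdd x \<Longrightarrow> cmod (x i) \<le> linf_norm x"
  unfolding linf_bdd_def linf_norm_def by (rule cSUP_upper) auto

lemma linf_norm_least: "(\<And>i. cmod (x i) \<le> B) \<Longrightarrow> linf_norm x \<le> B"
  unfolding linf_norm_def by (rule cSUP_least) auto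

lemma linf_bddI: "(\<And>i. cmod (x i) \<le> B) \<Longrightarrow> linf_bdd x"
  unfolding linf_bdd_def by (auto simp: bdd_above_def)

lemma linf_norm_nonneg: "linf_bdd x \<Longrightarrow> 0 \<le> linf_norm x"
  using linf_norm_upper[of x 0] norm_ge_zero[of "x 0"] by linarith

lemma linf_bdd_diff: "linf_bdd x \<Longrightarrow> linf_bdd y \<Longrightarrow> linf_bdd (\<lambda>i. x i - y i)"
  by (rule linf_bddI[of _ "linf_norm x + linf_norm y"])
     (meson add_mono linf_norm_upper norm_triangle_ineq4 order_trans)

lemma linf_bdd_divide: "linf_bdd x \<Longrightarrow> linf_bdd (\<lambda>i. x i / c)"
  by (rule linf_bddI[of _ "linf_norm x / cmod c"])
     (simp add: norm_divide divide_right_mono linf_norm_upper)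

lemma holomorphic_coordinates:
  assumes bdd: "\<And>z. z \<in> S \<Longrightarrow> linf_bdd (f z)" and S: "open S" and hol: "linf_holomorphic_on f S"
  shows "(\<lambda>z. f z i) holomorphic_on S"
proof -
  have "\<exists>d. ((\<lambda>z. f z i) has_field_derivative d) (at z within S)" if z: "z \<in> S" for z
  proof -
    obtain D where D: "linf_bdd D"
      "((\<lambda>w. linf_norm (\<lambda>i. (f w i - f z i) / (w - z) - D i)) \<longlongrightarrow> 0) (at z)"
      using hol z unfolding linf_holomorphic_on_def by blast
    have "\<forall>\<^sub>F w in at z. w \<in> S"
      using S z by (simp add: eventually_at_in_open')
    then have "\<forall>\<^sub>F w in at z. norm ((f w i - f z i) / (w - z) - D i)
        \<le> linf_norm (\<lambda>i. (f w i - f z i) / (w - z) - D i)"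
      by eventually_elim
        (use linf_norm_upper D(1) bdd z in \<open>blast intro: linf_bdd_diff linf_bdd_divide\<close>)
    then have "((\<lambda>w. (f w i - f z i) / (w - z) - D i) \<longlongrightarrow> 0) (at z)"
      by (rule Lim_null_comparison[OF _ D(2)])
    then have "((\<lambda>w. (f w i - f z i) / (w - z)) \<longlongrightarrow> D i) (at z)"
      by (simp add: LIM_zero_iff)
    then have "((\<lambda>z. f z i) has_field_derivative D i) (at z)"
      by (simp add: has_field_derivative_iff)
    then show ?thesis
      using DERIV_subset by blast
  qed
  then show ?thesis
    by (simp add: holomorphic_on_def field_differentiable_def)
qed

text \<open>Boundedness by a common \<open>M\<close> gives all coordinates the same linear rate of
  convergence of the difference quotients, so they converge in the supremum norm.\<close>

lemma linf_holomorphicI: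
  assumes S: "open S" and hol: "\<And>i. (\<lambda>z. f z i) holomorphic_on S"
    and M: "\<And>z i. z \<in> S \<Longrightarrow> cmod (f z i) \<le> M"
  shows "linf_holomorphic_on f S"
  unfolding linf_holomorphic_on_def
proof
  fix z assume z: "z \<in> S"
  obtain e where e: "e > 0" "ball z e \<subseteq> S"
    using S z openE by blast
  define r where "r = e / 3"
  have r: "r > 0" "ball z (3 * r) \<subseteq> S"
    using e by (auto simp: r_def)
  define D where "D = (\<lambda>i. deriv (\<lambda>z. f z i) z)"
  have hol': "(\<lambda>z. f z i) holomorphic_on ball z (3 * r)" for i
    using holomorphic_on_subset[OF hol r(2)] .
  have rem: "cmod (f w i - f z i - D i * (w - z)) \<le> 2 * M / r\<^sup>2 * (cmod (w - z))\<^sup>2"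
    if "w \<in> ball z r" for w i
    unfolding D_def
    by (rule holomorphic_remainder_bound[OF hol' r(1) _ that]) (use r M in blast)
  have quot: "cmod ((f w i - f z i) / (w - z) - D i) \<le> 2 * M / r\<^sup>2 * cmod (w - z)"
    if "w \<in> ball z r" "w \<noteq> z" for w i
  proof -
    have "(f w i - f z i) / (w - z) - D i = (f w i - f z i - D i * (w - z)) / (w - z)"
      using that by (simp add: field_simps)
    also have "cmod \<dots> \<le> 2 * M / r\<^sup>2 * (cmod (w - z))\<^sup>2 / cmod (w - z)"
      unfolding norm_divide using rem[OF that(1), of i] by (rule divide_right_mono) simp
    finally show ?thesis
      using that by (simp add: power2_eq_square)
  qed
  have D_bdd: "linf_bdd D"
  proof (rule linf_bddI)
    fix i
    have "cmod ((deriv ^^ 1) (\<lambda>z. f z i) z) \<le> fact 1 * M / r ^ 1"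
    proof (rule Cauchy_inequality)
      show "(\<lambda>z. f z i) holomorphic_on ball z r"
        using r by (intro holomorphic_on_subset[OF hol']) auto
      show "continuous_on (cball z r) (\<lambda>z. f z i)"
        using r by (intro holomorphic_on_imp_continuous_on holomorphic_on_subset[OF hol'[of i]]) auto
      show "cmod (f x i) \<le> M" if "cmod (z - x) = r" for x
      proof -
        have "x \<in> ball z (3 * r)"
          using that r by (simp add: dist_norm)
        then show ?thesis using M r by blast
      qed
    qed (rule r)
    then show "cmod (D i) \<le> M / r" by (simp add: D_def)
  qed
  have "((\<lambda>w. linf_norm (\<lambda>i. (f w i - f z i) / (w - z) - D i)) \<longlongrightarrow> 0) (at z)"
  proof (rule Lim_null_comparison)
    have "\<forall>\<^sub>F w in at z. w \<in> ball z r \<and> w \<noteq> z"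
      using r by (intro eventually_conj eventually_at_in_open') (auto simp: eventually_at_filter)
    then show "\<forall>\<^sub>F w in at z. norm (linf_norm (\<lambda>i. (f w i - f z i) / (w - z) - D i))
        \<le> 2 * M / r\<^sup>2 * cmod (w - z)"
    proof eventually_elim
      case (elim w)
      then have q: "cmod ((f w i - f z i) / (w - z) - D i) \<le> 2 * M / r\<^sup>2 * cmod (w - z)" for i
        using quot by blast
      then have "linf_bdd (\<lambda>i. (f w i - f z i) / (w - z) - D i)"
        by (rule linf_bddI)
      then show ?case
        using linf_norm_least[OF q] linf_norm_nonneg by simp
    qed
    have "((\<lambda>w. 2 * M / r\<^sup>2 * cmod (w - z)) \<longlongrightarrow> 2 * M / r\<^sup>2 * cmod (z - z)) (at z)"
      by (intro tendsto_intros)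
    then show "((\<lambda>w. 2 * M / r\<^sup>2 * cmod (w - z)) \<longlongrightarrow> 0) (at z)" by simp
  qed
  with D_bdd show "\<exists>D. linf_bdd D \<and>
      ((\<lambda>w. linf_norm (\<lambda>i. (f w i - f z i) / (w - z) - D i)) \<longlongrightarrow> 0) (at z)"
    by blast
qed

lemma cald_bd_imp_calderon:
  assumes "cald_bd f a b"
  shows "f \<in> calderon" "a \<le> K \<Longrightarrow> b \<le> K \<Longrightarrow> calderon_norm f \<le> K"
proof -
  obtain B where B: "\<And>z i. z \<in> closed_strip \<Longrightarrow> cmod (f z i) \<le> B"
    using assms unfolding cald_bd_def by metis
  have equi: "\<exists>d>0. \<forall>w\<in>closed_strip. cmod (w - z) < d \<longrightarrow> (\<forall>i. cmod (f w i - f z i) \<le> e)"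
    if "z \<in> closed_strip" "e > 0" for z e
    using assms that unfolding cald_bd_def equi_at_def by metis
  have hol: "(\<lambda>z. f z i) holomorphic_on open_strip" for i
    using assms unfolding cald_bd_def by metis
  have a: "cmod (f z i) \<le> a" if "Re z = 0" for z i
    using assms that unfolding cald_bd_def equi_at_def by metis
  have b: "(\<Sum>i\<in>A. cmod (f z i)) \<le> b" if "Re z = 1" "finite A" for z A
    using assms that unfolding cald_bd_def equi_at_def by metis
  have sm: "summable (\<lambda>i. cmod (f z i))" if "Re z = 1" for z
    by (rule summableI_nonneg_bounded[where x = b]) (use b that in auto)
  have l1: "l1_norm (f z) \<le> b" if "Re z = 1" for z
    unfolding l1_norm_def using b that by (intro suminf_le_const[OF sm]) auto
  have l1': "l1_norm (f z) \<ge> 0" if "Re z = 1" for z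
    unfolding l1_norm_def using that by (intro suminf_nonneg[OF sm]) auto
  show "f \<in> calderon"
    unfolding calderon_def mem_Collect_eq
  proof (intro conjI ballI allI impI)
    show "linf_bdd (f z)" if "z \<in> closed_strip" for z
      using B that by (blast intro: linf_bddI)
    show "bdd_above (linf_norm ` f ` closed_strip)"
      by (rule bdd_aboveI[of _ B]) (use B linf_norm_least in blast)
    show "\<exists>d>0. \<forall>w\<in>closed_strip. cmod (w - z) < d \<longrightarrow> linf_norm (\<lambda>i. f w i - f z i) < e"
      if "z \<in> closed_strip" "e > 0" for z e
    proof -
      obtain d where d: "d > 0"
        "\<And>w i. w \<in> closed_strip \<Longrightarrow> cmod (w - z) < d \<Longrightarrow> cmod (f w i - f z i) \<le> e / 2"
        using equi[of z "e / 2"] \<open>z \<in> closed_strip\<close> \<open>e > 0\<close> by auto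
      have "linf_norm (\<lambda>i. f w i - f z i) < e" if "w \<in> closed_strip" "cmod (w - z) < d" for w
      proof -
        have "linf_norm (\<lambda>i. f w i - f z i) \<le> e / 2"
          using d(2) that by (intro linf_norm_least)
        then show ?thesis using \<open>e > 0\<close> by linarith
      qed
      then show ?thesis using d(1) by blast
    qed
    show "linf_holomorphic_on f open_strip"
      using B open_strip_subset by (intro linf_holomorphicI[OF open_open_strip hol]) blast
    show "summable (\<lambda>i. cmod (f (1 + complex_of_real t * \<i>) i))" for t :: real
      by (rule sm) simp
    show "bdd_above (range (\<lambda>t::real. l1_norm (f (1 + complex_of_real t * \<i>))))"
      by (rule bdd_aboveI[of _ b]) (use l1 in auto)
  qed
  show "calderon_norm f \<le> K" if "a \<le> K" "b \<le> K"
  proof -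
    have "linf_norm (f (complex_of_real t * \<i>)) \<le> K" for t
    proof (rule linf_norm_least)
      fix i
      have "Re (complex_of_real t * \<i>) = 0" by simp
      then show "cmod (f (complex_of_real t * \<i>) i) \<le> K"
        using a that(1) order_trans by blast
    qed
    moreover have "l1_norm (f (1 + complex_of_real t * \<i>)) \<le> K" for t
      using l1[of "1 + complex_of_real t * \<i>"] that(2) by simp
    ultimately show ?thesis
      unfolding calderon_norm_def by (auto intro!: cSUP_least)
  qed
qed

lemma calderon_imp_cald_bd:
  assumes "f \<in> calderon"
  shows "cald_bd f (calderon_norm f) (calderon_norm f)"
proof -
  note c = assms[unfolded calderon_def mem_Collect_eq]
  have bdd: "linf_bdd (f z)" if "z \<in> closed_strip" for z
    using c[THEN conjunct1] that by blast
  have bda: "bdd_above (linf_norm ` f ` closed_strip)"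
    by (rule c[THEN conjunct2, THEN conjunct1])
  have equi: "\<exists>d>0. \<forall>w\<in>closed_strip. cmod (w - z) < d \<longrightarrow> linf_norm (\<lambda>i. f w i - f z i) < e"
    if "z \<in> closed_strip" "e > 0" for z e
    using c[THEN conjunct2, THEN conjunct2, THEN conjunct1, rule_format, OF that] .
  have hol: "linf_holomorphic_on f open_strip"
    by (rule c[THEN conjunct2, THEN conjunct2, THEN conjunct2, THEN conjunct1])
  have sm: "summable (\<lambda>i. cmod (f (1 + complex_of_real t * \<i>) i))" for t :: real
    by (rule c[THEN conjunct2, THEN conjunct2, THEN conjunct2, THEN conjunct2, THEN conjunct1, rule_format])
  have bda1: "bdd_above (range (\<lambda>t::real. l1_norm (f (1 + complex_of_real t * \<i>))))"
    by (rule c[THEN conjunct2, THEN conjunct2, THEN conjunct2, THEN conjunct2, THEN conjunct2])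
  obtain B where B: "\<And>z. z \<in> closed_strip \<Longrightarrow> linf_norm (f z) \<le> B"
    using bda unfolding bdd_above_def by blast
  have B': "cmod (f z i) \<le> B" if "z \<in> closed_strip" for z i
    using linf_norm_upper[OF bdd[OF that]] B[OF that] order_trans by blast
  have Re0: "z = complex_of_real (Im z) * \<i>" if "Re z = 0" for z
    using that by (simp add: complex_eq_iff)
  have Re1: "z = 1 + complex_of_real (Im z) * \<i>" if "Re z = 1" for z
    using that by (simp add: complex_eq_iff)
  show ?thesis
    unfolding cald_bd_def equi_at_def
  proof (intro conjI ballI allI impI)
    show "\<exists>B. \<forall>z\<in>closed_strip. \<forall>i. cmod (f z i) \<le> B"
      using B' by blast
    show "\<exists>d>0. \<forall>w\<in>closed_strip. cmod (w - z) < d \<longrightarrow> (\<forall>i. cmod (f w i - f z i) \<le> e)"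
      if z: "z \<in> closed_strip" "e > 0" for z e
    proof -
      obtain d where "d > 0"
        and d: "\<And>w. w \<in> closed_strip \<Longrightarrow> cmod (w - z) < d \<Longrightarrow> linf_norm (\<lambda>i. f w i - f z i) < e"
        using equi[OF z] by blast
      have "cmod (f w i - f z i) \<le> e" if "w \<in> closed_strip" "cmod (w - z) < d" for w i
        using linf_norm_upper[OF linf_bdd_diff[OF bdd[OF that(1)] bdd[OF z(1)]], of i] d[OF that]
        by linarith
      then show ?thesis using \<open>d > 0\<close> by blast
    qed
    show "(\<lambda>z. f z i) holomorphic_on open_strip" for i
      using bdd open_strip_subset
      by (intro holomorphic_coordinates[OF _ open_open_strip hol]) blast
    show "cmod (f z i) \<le> calderon_norm f" if "Re z = 0" for z i
    proof -
      have cs: "complex_of_real t * \<i> \<in> closed_strip" for t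
        by (simp add: closed_strip_def)
      have "bdd_above (range (\<lambda>t. linf_norm (f (complex_of_real t * \<i>))))"
        by (rule bdd_aboveI[of _ B]) (use B cs in auto)
      then have "linf_norm (f (complex_of_real (Im z) * \<i>)) \<le> calderon_norm f"
        unfolding calderon_norm_def by (intro max.coboundedI1 cSUP_upper) auto
      moreover have "cmod (f z i) \<le> linf_norm (f z)"
        using that by (intro linf_norm_upper bdd) (simp add: closed_strip_def)
      ultimately show ?thesis
        using Re0[OF that] by simp
    qed
    show "(\<Sum>i\<in>A. cmod (f z i)) \<le> calderon_norm f" if "Re z = 1" "finite A" for z A
    proof -
      have "l1_norm (f (1 + complex_of_real (Im z) * \<i>)) \<le> calderon_norm f"
        unfolding calderon_norm_def by (intro max.coboundedI2 cSUP_upper bda1) auto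
      moreover have "(\<Sum>i\<in>A. cmod (f (1 + complex_of_real (Im z) * \<i>) i))
          \<le> l1_norm (f (1 + complex_of_real (Im z) * \<i>))"
        unfolding l1_norm_def using that by (intro sum_le_suminf[OF sm]) auto
      ultimately show ?thesis
        using Re1[OF that(1)] by simp
    qed
  qed
qed

lemma cald_bdI:
  assumes "\<And>z i. z \<in> closed_strip \<Longrightarrow> cmod (f z i) \<le> B"
    and "\<And>z. z \<in> closed_strip \<Longrightarrow> equi_at f z"
    and "\<And>i. (\<lambda>z. f z i) holomorphic_on open_strip"
    and "\<And>z i. Re z = 0 \<Longrightarrow> cmod (f z i) \<le> a"
    and "\<And>z A. Re z = 1 \<Longrightarrow> finite A \<Longrightarrow> (\<Sum>i\<in>A. cmod (f z i)) \<le> b"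
  shows "cald_bd f a b"
  using assms unfolding cald_bd_def by blast

lemma cald_bdE:
  assumes "cald_bd f a b"
  obtains B where "0 \<le> B" "\<And>z i. z \<in> closed_strip \<Longrightarrow> cmod (f z i) \<le> B"
proof -
  obtain B where B: "\<And>z i. z \<in> closed_strip \<Longrightarrow> cmod (f z i) \<le> B"
    using assms unfolding cald_bd_def by metis
  have "0 \<le> B"
    using B[of "1/2" 0] half_in_open_strip open_strip_subset norm_ge_zero order_trans by blast
  with B that show thesis by blast
qed

lemma cald_bdD:
  assumes "cald_bd f a b"
  shows "\<And>z. z \<in> closed_strip \<Longrightarrow> equi_at f z"
    and "\<And>i. (\<lambda>z. f z i) holomorphic_on open_strip"
    and "\<And>z i. Re z = 0 \<Longrightarrow> cmod (f z i) \<le> a"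
    and "\<And>z A. Re z = 1 \<Longrightarrow> finite A \<Longrightarrow> (\<Sum>i\<in>A. cmod (f z i)) \<le> b"
  using assms unfolding cald_bd_def by metis+

lemma cald_bd_nonneg: "cald_bd f a b \<Longrightarrow> 0 \<le> a" "cald_bd f a b \<Longrightarrow> 0 \<le> b"
  using cald_bdD(3)[of f a b 0 0] norm_ge_zero[of "f 0 0"] cald_bdD(4)[of f a b 1 "{}"]
  by (auto simp del: norm_ge_zero)

lemma cald_bd_mono: "cald_bd f a b \<Longrightarrow> a \<le> a' \<Longrightarrow> b \<le> b' \<Longrightarrow> cald_bd f a' b'"
  unfolding cald_bd_def by (meson order_trans)

lemma equi_at_continuous:
  assumes "equi_at f z"
  shows "continuous (at z within closed_strip) (\<lambda>w. f w i)"
  unfolding continuous_within_eps_delta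
proof (intro allI impI)
  fix e :: real assume "e > 0"
  then obtain d where d: "d > 0" "\<And>w i. w \<in> closed_strip \<Longrightarrow> cmod (w - z) < d \<Longrightarrow> cmod (f w i - f z i) \<le> e / 2"
    using assms unfolding equi_at_def by (metis half_gt_zero)
  show "\<exists>d>0. \<forall>w\<in>closed_strip. dist w z < d \<longrightarrow> dist (f w i) (f z i) < e"
  proof (intro exI[of _ d] conjI ballI impI d(1))
    fix w assume "w \<in> closed_strip" "dist w z < d"
    then have "cmod (f w i - f z i) \<le> e / 2"
      using d(2) by (simp add: dist_norm)
    then show "dist (f w i) (f z i) < e"
      using \<open>e > 0\<close> by (simp add: dist_norm)
  qed
qed

lemma cald_bd_continuous: "cald_bd f a b \<Longrightarrow> continuous_on closed_strip (\<lambda>z. f z i)"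
  unfolding continuous_on_eq_continuous_within by (blast intro: equi_at_continuous cald_bdD(1))

section \<open>Operations on functions in the Calderon space\<close>

lemma equi_at_add:
  assumes "equi_at f z" "equi_at g z"
  shows "equi_at (\<lambda>z i. f z i + g z i) z"
  unfolding equi_at_def
proof (intro allI impI)
  fix e :: real assume e: "e > 0"
  obtain d where d: "d > 0" "\<And>w i. w \<in> closed_strip \<Longrightarrow> cmod (w - z) < d \<Longrightarrow> cmod (f w i - f z i) \<le> e / 2"
    using assms(1) e unfolding equi_at_def by (metis half_gt_zero)
  obtain d' where d': "d' > 0" "\<And>w i. w \<in> closed_strip \<Longrightarrow> cmod (w - z) < d' \<Longrightarrow> cmod (g w i - g z i) \<le> e / 2"
    using assms(2) e unfolding equi_at_def by (metis half_gt_zero)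
  have "cmod (f w i + g w i - (f z i + g z i)) \<le> e"
    if "w \<in> closed_strip" "cmod (w - z) < min d d'" for w i
  proof -
    have "f w i + g w i - (f z i + g z i) = (f w i - f z i) + (g w i - g z i)"
      by simp
    then have "cmod (f w i + g w i - (f z i + g z i)) \<le> cmod (f w i - f z i) + cmod (g w i - g z i)"
      by (metis norm_triangle_ineq)
    then show ?thesis
      using d(2)[of w i] d'(2)[of w i] that by simp
  qed
  then show "\<exists>d>0. \<forall>w\<in>closed_strip. cmod (w - z) < d \<longrightarrow>
      (\<forall>i. cmod (f w i + g w i - (f z i + g z i)) \<le> e)"
    using d(1) d'(1) by (intro exI[of _ "min d d'"]) auto
qed

lemma equi_at_mult:
  assumes f: "equi_at f z" and B: "\<And>w i. w \<in> closed_strip \<Longrightarrow> cmod (f w i) \<le> B"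
    and h: "continuous (at z within closed_strip) h"
  shows "equi_at (\<lambda>z i. h z * f z i) z"
  unfolding equi_at_def
proof (intro allI impI)
  fix e :: real assume e: "e > 0"
  define c where "c = e / (2 * (cmod (h z) + \<bar>B\<bar> + 1))"
  have c: "c > 0" using e by (simp add: c_def add_nonneg_pos)
  obtain d where d: "d > 0" "\<And>w i. w \<in> closed_strip \<Longrightarrow> cmod (w - z) < d \<Longrightarrow> cmod (f w i - f z i) \<le> c"
    using f c unfolding equi_at_def by metis
  obtain d' where d': "d' > 0" "\<And>w. w \<in> closed_strip \<Longrightarrow> cmod (w - z) < d' \<Longrightarrow> cmod (h w - h z) < c"
    using h c unfolding continuous_within_eps_delta dist_norm by metis
  have "cmod (h w * f w i - h z * f z i) \<le> e"
    if w: "w \<in> closed_strip" "cmod (w - z) < min d d'" for w i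
  proof -
    have "h w * f w i - h z * f z i = (h w - h z) * f w i + h z * (f w i - f z i)"
      by (simp add: algebra_simps)
    then have "cmod (h w * f w i - h z * f z i) \<le> cmod (h w - h z) * cmod (f w i) + cmod (h z) * cmod (f w i - f z i)"
      by (metis norm_mult norm_triangle_ineq)
    also have "\<dots> \<le> c * \<bar>B\<bar> + cmod (h z) * c"
      using d(2)[of w i] d'(2)[of w] w B[OF w(1), of i] c
      by (intro add_mono mult_mono) (auto intro: order_trans)
    also have "\<dots> \<le> 2 * (cmod (h z) + \<bar>B\<bar> + 1) * c"
      using c by (simp add: algebra_simps)
    also have "\<dots> = e"
      using norm_ge_zero[of "h z"] by (simp add: c_def del: norm_ge_zero)
    finally show ?thesis .
  qed
  then show "\<exists>d>0. \<forall>w\<in>closed_strip. cmod (w - z) < d \<longrightarrow> (\<forall>i. cmod (h w * f w i - h z * f z i) \<le> e)"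
    using d(1) d'(1) by (intro exI[of _ "min d d'"]) auto
qed

lemma equi_at_restrict:
  assumes "equi_at f z"
  shows "equi_at (\<lambda>z i. if i \<in> A then f z i else 0) z"
  unfolding equi_at_def
proof (intro allI impI)
  fix e :: real assume "e > 0"
  then obtain d where "d > 0"
    "\<And>w i. w \<in> closed_strip \<Longrightarrow> cmod (w - z) < d \<Longrightarrow> cmod (f w i - f z i) \<le> e"
    using assms unfolding equi_at_def by metis
  then show "\<exists>d>0. \<forall>w\<in>closed_strip. cmod (w - z) < d \<longrightarrow>
      (\<forall>i. cmod ((if i \<in> A then f w i else 0) - (if i \<in> A then f z i else 0)) \<le> e)"
    using \<open>e > 0\<close> by (intro exI[of _ d]) auto
qed

text \<open>Coordinates beyond some \<open>M\<close> vary by less than \<open>e\<close> because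
  \<open>r\<close> dominates them, and the finitely many others are continuous one by one.\<close>

lemma equi_at_vanishing:
  assumes cont: "\<And>i. continuous (at z within closed_strip) (\<lambda>w. f w i)"
    and z: "z \<in> closed_strip"
    and bd: "\<And>w i. w \<in> closed_strip \<Longrightarrow> cmod (f w i) \<le> r i" and r: "r \<longlonglongrightarrow> 0"
  shows "equi_at f z"
  unfolding equi_at_def
proof (intro allI impI)
  fix e :: real assume e: "e > 0"
  obtain M where M: "\<And>i. i \<ge> M \<Longrightarrow> \<bar>r i\<bar> < e / 2"
    using r e unfolding LIMSEQ_iff by (metis half_gt_zero real_norm_def diff_zero)
  have "\<forall>\<^sub>F w in at z within closed_strip. \<forall>i\<in>{..<M}. dist (f w i) (f z i) < e"
    using cont e by (intro eventually_ball_finite ballI) (auto simp: continuous_within tendsto_iff)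
  then obtain d where d: "d > 0"
    "\<And>w i. w \<in> closed_strip \<Longrightarrow> w \<noteq> z \<Longrightarrow> dist w z < d \<Longrightarrow> i < M \<Longrightarrow> dist (f w i) (f z i) < e"
    unfolding eventually_at by auto
  have "cmod (f w i - f z i) \<le> e" if w: "w \<in> closed_strip" "cmod (w - z) < d" for w i
  proof (cases "i < M")
    case True
    show ?thesis
    proof (cases "w = z")
      case False
      then show ?thesis
        using d(2)[of w i] w True by (simp add: dist_norm)
    qed (use e in simp)
  next
    case False
    then have "r i < e / 2" using M[of i] by simp
    moreover have "cmod (f w i - f z i) \<le> cmod (f w i) + cmod (f z i)"
      by (rule norm_triangle_ineq4)
    ultimately show ?thesis
      using bd[OF w(1), of i] bd[OF z, of i] by linarith
  qed
  then show "\<exists>d>0. \<forall>w\<in>closed_strip. cmod (w - z) < d \<longrightarrow> (\<forall>i. cmod (f w i - f z i) \<le> e)"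
    using d(1) by blast
qed

lemma cald_bd_add:
  assumes f: "cald_bd f a b" and g: "cald_bd g a' b'"
  shows "cald_bd (\<lambda>z i. f z i + g z i) (a + a') (b + b')"
proof -
  obtain B where B: "\<And>z i. z \<in> closed_strip \<Longrightarrow> cmod (f z i) \<le> B"
    using cald_bdE[OF f] by blast
  obtain B' where B': "\<And>z i. z \<in> closed_strip \<Longrightarrow> cmod (g z i) \<le> B'"
    using cald_bdE[OF g] by blast
  show ?thesis
  proof (rule cald_bdI)
    show "cmod (f z i + g z i) \<le> B + B'" if "z \<in> closed_strip" for z i
      using B[OF that] B'[OF that] by (meson add_mono norm_triangle_ineq order_trans)
    show "equi_at (\<lambda>z i. f z i + g z i) z" if "z \<in> closed_strip" for z
      using that f g by (blast intro: equi_at_add cald_bdD(1))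
    show "(\<lambda>z. f z i + g z i) holomorphic_on open_strip" for i
      using cald_bdD(2)[OF f, of i] cald_bdD(2)[OF g, of i] by (intro holomorphic_intros)
    show "cmod (f z i + g z i) \<le> a + a'" if "Re z = 0" for z i
      using cald_bdD(3)[OF f that] cald_bdD(3)[OF g that] by (meson add_mono norm_triangle_ineq order_trans)
    show "(\<Sum>i\<in>A. cmod (f z i + g z i)) \<le> b + b'" if "Re z = 1" "finite A" for z A
    proof -
      have "(\<Sum>i\<in>A. cmod (f z i + g z i)) \<le> (\<Sum>i\<in>A. cmod (f z i)) + (\<Sum>i\<in>A. cmod (g z i))"
        by (simp add: norm_triangle_ineq sum_mono flip: sum.distrib)
      then show ?thesis
        using cald_bdD(4)[OF f that] cald_bdD(4)[OF g that] by linarith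
    qed
  qed
qed

lemma cald_bd_mult:
  assumes f: "cald_bd f a b" and hol: "h holomorphic_on open_strip" and cont: "continuous_on closed_strip h"
    and H: "\<And>z. z \<in> closed_strip \<Longrightarrow> cmod (h z) \<le> H"
    and h0: "\<And>z. Re z = 0 \<Longrightarrow> cmod (h z) \<le> h0" and h1: "\<And>z. Re z = 1 \<Longrightarrow> cmod (h z) \<le> h1"
  shows "cald_bd (\<lambda>z i. h z * f z i) (h0 * a) (h1 * b)"
proof -
  obtain B where B: "\<And>z i. z \<in> closed_strip \<Longrightarrow> cmod (f z i) \<le> B"
    using cald_bdE[OF f] by blast
  have h0': "0 \<le> h0" and h1': "0 \<le> h1"
    using h0[of 0] h1[of 1] by (auto intro: order_trans[OF norm_ge_zero])
  show ?thesis
  proof (rule cald_bdI)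
    show "cmod (h z * f z i) \<le> H * B" if "z \<in> closed_strip" for z i
      using H[OF that] B[OF that] unfolding norm_mult
      by (intro mult_mono) (auto intro: order_trans[OF norm_ge_zero])
    show "equi_at (\<lambda>z i. h z * f z i) z" if "z \<in> closed_strip" for z
      using that cont by (intro equi_at_mult[OF cald_bdD(1)[OF f that] B])
        (auto simp: continuous_on_eq_continuous_within)
    show "(\<lambda>z. h z * f z i) holomorphic_on open_strip" for i
      using hol cald_bdD(2)[OF f, of i] by (intro holomorphic_intros)
    show "cmod (h z * f z i) \<le> h0 * a" if "Re z = 0" for z i
      using h0[OF that] cald_bdD(3)[OF f that] h0' unfolding norm_mult by (intro mult_mono) auto
    show "(\<Sum>i\<in>A. cmod (h z * f z i)) \<le> h1 * b" if "Re z = 1" "finite A" for z A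
    proof -
      have "(\<Sum>i\<in>A. cmod (h z * f z i)) = cmod (h z) * (\<Sum>i\<in>A. cmod (f z i))"
        by (simp add: norm_mult sum_distrib_left)
      then show ?thesis
        using h1[OF that(1)] cald_bdD(4)[OF f that] h1' by (simp add: mult_mono sum_nonneg)
    qed
  qed
qed

lemma cald_bd_cmult: "cald_bd f a b \<Longrightarrow> cald_bd (\<lambda>z i. c * f z i) (cmod c * a) (cmod c * b)"
  by (rule cald_bd_mult[where H = "cmod c"]) auto

lemma cald_bd_coordinate: "cald_bd (\<lambda>z i. if i = i0 then c else 0) (cmod c) (cmod c)"
proof (rule cald_bdI[where B = "cmod c"])
  show "equi_at (\<lambda>z i. if i = i0 then c else 0) z" for z
    unfolding equi_at_def by (auto intro: exI[of _ 1])
  show "(\<Sum>i\<in>A. cmod (if i = i0 then c else 0)) \<le> cmod c" if "finite A" for A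
    using that by (simp add: if_distrib[of cmod] cong: if_cong)
qed auto

lemma cald_bd_zero: "cald_bd (\<lambda>z i. 0) 0 0"
  using cald_bd_coordinate[of 0 0] by simp

lemma cald_bd_restrict:
  assumes f: "cald_bd f a b"
  shows "cald_bd (\<lambda>z i. if i \<in> A then f z i else 0) a b"
proof -
  obtain B where B: "0 \<le> B" "\<And>z i. z \<in> closed_strip \<Longrightarrow> cmod (f z i) \<le> B"
    using cald_bdE[OF f] by blast
  show ?thesis
  proof (rule cald_bdI)
    show "cmod (if i \<in> A then f z i else 0) \<le> B" if "z \<in> closed_strip" for z i
      using B that by simp
    show "equi_at (\<lambda>z i. if i \<in> A then f z i else 0) z" if "z \<in> closed_strip" for z
      by (rule equi_at_restrict[OF cald_bdD(1)[OF f that]])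
    show "(\<lambda>z. if i \<in> A then f z i else 0) holomorphic_on open_strip" for i
      using cald_bdD(2)[OF f, of i] by (cases "i \<in> A") auto
    show "cmod (if i \<in> A then f z i else 0) \<le> a" if "Re z = 0" for z i
      using cald_bdD(3)[OF f that] cald_bd_nonneg(1)[OF f] by simp
    show "(\<Sum>i\<in>F. cmod (if i \<in> A then f z i else 0)) \<le> b" if "Re z = 1" "finite F" for z F
    proof -
      have "(\<Sum>i\<in>F. cmod (if i \<in> A then f z i else 0)) \<le> (\<Sum>i\<in>F. cmod (f z i))"
        by (intro sum_mono) auto
      then show ?thesis
        using cald_bdD(4)[OF f that] by linarith
    qed
  qed
qed

lemma cald_bd_sum:
  assumes "\<And>l. l < N \<Longrightarrow> cald_bd (f l) a b"
  shows "cald_bd (\<lambda>z i. \<Sum>l<(N::nat). f l z i) (real N * a) (real N * b)"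
  using assms
proof (induction N)
  case 0
  then show ?case using cald_bd_zero by simp
next
  case (Suc N)
  have "cald_bd (\<lambda>z i. (\<Sum>l<N. f l z i) + f N z i) (real N * a + a) (real N * b + b)"
    using Suc by (intro cald_bd_add) auto
  then show ?case by (simp add: algebra_simps)
qed

text \<open>At each coordinate at most one summand is nonzero, so the supremum bound does not grow;
  only the l1 bound picks up the factor \<open>N\<close>.\<close>

lemma cald_bd_disjoint_sum:
  assumes f: "\<And>l. l < N \<Longrightarrow> cald_bd (f l) a b" and N: "0 < N"
    and supp: "\<And>l z i. l < N \<Longrightarrow> i \<notin> A l \<Longrightarrow> f l z i = 0"
    and disj: "\<And>l l'. l < N \<Longrightarrow> l' < N \<Longrightarrow> l \<noteq> l' \<Longrightarrow> A l \<inter> A l' = {}"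
  shows "cald_bd (\<lambda>z i. \<Sum>l<(N::nat). f l z i) a (real N * b)"
proof -
  have sum: "cald_bd (\<lambda>z i. \<Sum>l<(N::nat). f l z i) (real N * a) (real N * b)"
    by (rule cald_bd_sum[OF f])
  obtain B where B: "\<And>z i. z \<in> closed_strip \<Longrightarrow> cmod (\<Sum>l<N. f l z i) \<le> B"
    using cald_bdE[OF sum] by blast
  show ?thesis
  proof (rule cald_bdI[OF B])
    show "cmod (\<Sum>l<N. f l z i) \<le> a" if "Re z = 0" for z i
    proof (cases "\<exists>l<N. i \<in> A l")
      case True
      then obtain l where l: "l < N" "i \<in> A l" by blast
      have "(\<Sum>l<N. f l z i) = (\<Sum>l'\<in>{l}. f l' z i)"
      proof (rule sum.mono_neutral_right)
        show "\<forall>j\<in>{..<N} - {l}. f j z i = 0"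
          using l supp disj by blast
      qed (use l in auto)
      then show ?thesis
        using cald_bdD(3)[OF f[OF l(1)] that, of i] by simp
    next
      case False
      then have "(\<Sum>l<N. f l z i) = 0"
        using supp by (intro sum.neutral) auto
      then show ?thesis
        using cald_bd_nonneg(1)[OF f[OF N]] by simp
    qed
  qed (use cald_bdD[OF sum] in auto)
qed

section \<open>Behaviour at the point 1/2: division by z - 1/2 and the l2 norm\<close>

lemma cald_bd_strip_bound:
  assumes f: "cald_bd f a b" and "a \<le> K" "b \<le> K" and z: "z \<in> closed_strip"
  shows "cmod (f z i) \<le> K"
proof -
  obtain B where B: "\<And>z i. z \<in> closed_strip \<Longrightarrow> cmod (f z i) \<le> B"
    using cald_bdE[OF f] by blast
  show ?thesis
  proof (rule strip_max_principle[OF cald_bdD(2)[OF f] cald_bd_continuous[OF f] B _ _ z])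
    show "cmod (f z i) \<le> K" if "Re z = 0" for z
      using cald_bdD(3)[OF f that] assms(2) order_trans by blast
    show "cmod (f z i) \<le> K" if "Re z = 1" for z
      using cald_bdD(4)[OF f that, of "{i}"] assms(3) by simp
  qed
qed

text \<open>On both boundary lines \<open>z - 1/2\<close> has modulus at least 1/2, so division
  costs a factor 2. The delicate point is continuity in norm at 1/2, which comes from a second-order
  remainder uniform in the coordinate.\<close>

lemma cald_bd_divide:
  assumes f: "cald_bd f a b" and f0: "\<And>i. f (1/2) i = 0"
  obtains g where "cald_bd g (2 * a) (2 * b)" "\<And>z i. f z i = (z - 1/2) * g z i"
proof -
  obtain B where B: "0 \<le> B" "\<And>z i. z \<in> closed_strip \<Longrightarrow> cmod (f z i) \<le> B"
    using cald_bdE[OF f] by blast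
  define D where "D = (\<lambda>i. deriv (\<lambda>z. f z i) (1/2))"
  define g where "g = (\<lambda>z i. if z = 1/2 then D i else f z i / (z - 1/2))"
  have fg: "f z i = (z - 1/2) * g z i" for z i
  proof (cases "z = 1/2")
    case True
    then show ?thesis
      unfolding True using f0 by simp
  qed (simp add: g_def)
  have hol: "(\<lambda>z. f z i) holomorphic_on open_strip" for i
    using cald_bdD(2)[OF f] .
  have ball: "ball (1/2) (3 * (1/12)) \<subseteq> open_strip"
    using cball_half_subset ball_subset_cball by force
  have g_near: "cmod (g w i - D i) \<le> 288 * B * cmod (w - 1/2)" if w: "w \<in> ball (1/2) (1/12)" for w i
  proof (cases "w = 1/2")
    case True
    show ?thesis unfolding True by (simp add: g_def)
  next
    case False
    have near: "cmod (f w i) \<le> B" if "w \<in> ball (1/2) (3 * (1/12))" for w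
      using that B(2) ball open_strip_subset by blast
    have "cmod (f w i - f (1/2) i - D i * (w - 1/2)) \<le> 2 * B / (1/12)\<^sup>2 * (cmod (w - 1/2))\<^sup>2"
      unfolding D_def
      by (rule holomorphic_remainder_bound[OF holomorphic_on_subset[OF hol ball] _ near w]) simp
    then have "cmod (f w i - D i * (w - 1/2)) \<le> 288 * B * (cmod (w - 1/2))\<^sup>2"
      using f0 by (simp add: power2_eq_square)
    then have "cmod (f w i - D i * (w - 1/2)) / cmod (w - 1/2) \<le> 288 * B * (cmod (w - 1/2))\<^sup>2 / cmod (w - 1/2)"
      by (rule divide_right_mono) simp
    moreover have "g w i - D i = (f w i - D i * (w - 1/2)) / (w - 1/2)"
      using False by (simp add: g_def diff_divide_distrib)
    ultimately show ?thesis
      using False by (simp add: norm_divide power2_eq_square)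
  qed
  have D_bd: "cmod (D i) \<le> 4 * B" for i
  proof -
    have "cmod ((deriv ^^ 1) (\<lambda>z. f z i) (1/2)) \<le> fact 1 * B / (1/4) ^ 1"
    proof (rule Cauchy_inequality)
      show "(\<lambda>z. f z i) holomorphic_on ball (1/2) (1/4)"
        using cball_half_subset ball_subset_cball by (intro holomorphic_on_subset[OF hol]) blast
      show "continuous_on (cball (1/2) (1/4)) (\<lambda>z. f z i)"
        using cball_half_subset
        by (intro holomorphic_on_imp_continuous_on holomorphic_on_subset[OF hol])
      show "cmod (f x i) \<le> B" if "cmod (1/2 - x) = 1/4" for x
      proof -
        have "x \<in> cball (1/2) (1/4)"
          using that by (simp add: dist_norm)
        then show ?thesis
          using B(2) cball_half_subset open_strip_subset by blast
      qed
    qed simp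
    then show ?thesis by (simp add: D_def)
  qed
  have bd2: "cmod (g z i) \<le> 2 * cmod (f z i)" if "Re z = 0 \<or> Re z = 1" for z i
  proof -
    have "1/2 \<le> \<bar>Re (z - 1/2)\<bar>"
      using that by auto
    also have "\<dots> \<le> cmod (z - 1/2)"
      by (rule abs_Re_le_cmod)
    finally have "1/2 * cmod (g z i) \<le> cmod (z - 1/2) * cmod (g z i)"
      by (rule mult_right_mono) simp
    then show ?thesis
      using fg[of z i] by (simp add: norm_mult)
  qed
  have "cald_bd g (2 * a) (2 * b)"
  proof (rule cald_bdI)
    \<comment> \<open>Near 1/2 the bound is \<open>288 * B / 12 + 4 * B\<close>; farther away the
      quotient is at most \<open>12 * B\<close>.\<close>
    show "cmod (g z i) \<le> 28 * B" if z: "z \<in> closed_strip" for z i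
    proof (cases "z \<in> ball (1/2) (1/12)")
      case True
      have "cmod (g z i) \<le> cmod (g z i - D i) + cmod (D i)"
        by (metis diff_add_cancel norm_triangle_ineq)
      also have "\<dots> \<le> 288 * B * cmod (z - 1/2) + 4 * B"
        using g_near[OF True] D_bd by (intro add_mono)
      also have "\<dots> \<le> 288 * B * (1/12) + 4 * B"
        using True B(1) by (intro add_mono mult_left_mono) (auto simp: dist_norm norm_minus_commute)
      finally show ?thesis by simp
    next
      case False
      then have "1/12 \<le> cmod (z - 1/2)"
        by (simp add: dist_norm norm_minus_commute)
      then have "1/12 * cmod (g z i) \<le> cmod (z - 1/2) * cmod (g z i)"
        by (rule mult_right_mono) simp
      also have "\<dots> = cmod (f z i)"
        using fg[of z i] by (simp add: norm_mult)
      finally show ?thesis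
        using B(2)[OF z, of i] B(1) by linarith
    qed
    show "equi_at g z" if z: "z \<in> closed_strip" for z
    proof (cases "z = 1/2")
      case True
      show ?thesis
        unfolding equi_at_def
      proof (intro allI impI)
        fix e :: real assume e: "e > 0"
        define d where "d = min (1/12) (e / (288 * B + 1))"
        have "d > 0" using e B(1) by (simp add: d_def)
        moreover have "cmod (g w i - g z i) \<le> e" if "cmod (w - z) < d" for w i
        proof -
          have "cmod (g w i - D i) \<le> 288 * B * cmod (w - 1/2)"
            using that True by (intro g_near) (simp add: d_def dist_norm norm_minus_commute)
          also have "\<dots> \<le> (288 * B + 1) * (e / (288 * B + 1))"
            using that True B(1) by (intro mult_mono) (auto simp: d_def)
          also have "\<dots> = e" using B(1) by simp
          finally show ?thesis using True by (simp add: g_def)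
        qed
        ultimately show "\<exists>d>0. \<forall>w\<in>closed_strip. cmod (w - z) < d \<longrightarrow> (\<forall>i. cmod (g w i - g z i) \<le> e)"
          by blast
      qed
    next
      case False
      have "continuous (at z within closed_strip) (\<lambda>w. 1 / (w - 1/2))"
        using False by (intro continuous_intros) auto
      with cald_bdD(1)[OF f z] B(2) have *: "equi_at (\<lambda>w i. 1 / (w - 1/2) * f w i) z"
        by (rule equi_at_mult)
      show ?thesis
        unfolding equi_at_def
      proof (intro allI impI)
        fix e :: real assume "e > 0"
        then obtain d where d: "d > 0" "\<And>w i. w \<in> closed_strip \<Longrightarrow> cmod (w - z) < d \<Longrightarrow>
            cmod (1 / (w - 1/2) * f w i - 1 / (z - 1/2) * f z i) \<le> e"
          using * unfolding equi_at_def by metis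
        have "cmod (g w i - g z i) \<le> e"
          if "w \<in> closed_strip" "cmod (w - z) < min d (cmod (z - 1/2))" for w i
        proof -
          have "w \<noteq> 1/2"
          proof
            assume w: "w = 1/2"
            show False
              using that(2) unfolding w by (simp add: norm_minus_commute)
          qed
          then show ?thesis
            using d(2)[of w i] that False by (simp add: g_def)
        qed
        then show "\<exists>d>0. \<forall>w\<in>closed_strip. cmod (w - z) < d \<longrightarrow> (\<forall>i. cmod (g w i - g z i) \<le> e)"
          using d(1) False by (intro exI[of _ "min d (cmod (z - 1/2))"]) auto
      qed
    qed
    show "(\<lambda>z. g z i) holomorphic_on open_strip" for i
    proof (rule pole_theorem_open_0[OF hol[of i] open_open_strip, where a = "1/2"])
      show "g (1/2) i = deriv (\<lambda>z. f z i) (1/2)" by (simp add: g_def D_def)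
    qed (use fg f0 in auto)
    show "cmod (g z i) \<le> 2 * a" if "Re z = 0" for z i
      using bd2[of z i] cald_bdD(3)[OF f that, of i] that by simp
    show "(\<Sum>i\<in>A. cmod (g z i)) \<le> 2 * b" if "Re z = 1" "finite A" for z A
    proof -
      have "(\<Sum>i\<in>A. cmod (g z i)) \<le> (\<Sum>i\<in>A. 2 * cmod (f z i))"
        using bd2 that by (intro sum_mono) auto
      also have "\<dots> = 2 * (\<Sum>i\<in>A. cmod (f z i))"
        by (simp add: sum_distrib_left)
      finally show ?thesis
        using cald_bdD(4)[OF f that] by linarith
    qed
  qed
  with fg that show thesis by blast
qed

text \<open>Testing \<open>f\<close> against the dual extremal function \<open>cnj u\<^sub>i (\<bar>u\<^sub>i\<bar>/R)\<^bsup>1-2z\<^esup>\<close> of \<open>u = f(1/2)\<close>.\<close>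
lemma cald_bd_imp_l2:
  assumes f: "cald_bd f a b" and ab: "a \<le> K" "b \<le> K" and A: "finite A"
  shows "(\<Sum>i\<in>A. (cmod (f (1/2) i))\<^sup>2) \<le> K\<^sup>2"
proof -
  define u where "u = f (1/2)"
  define S where "S = {i \<in> A. u i \<noteq> 0}"
  have S: "finite S" using A by (simp add: S_def)
  have eqS: "(\<Sum>i\<in>A. (cmod (u i))\<^sup>2) = (\<Sum>i\<in>S. (cmod (u i))\<^sup>2)"
    unfolding S_def using A by (intro sum.mono_neutral_right) auto
  define R where "R = sqrt (\<Sum>i\<in>S. (cmod (u i))\<^sup>2)"
  have K: "0 \<le> K" using cald_bd_nonneg(1)[OF f] ab by linarith
  have R2: "R\<^sup>2 = (\<Sum>i\<in>S. (cmod (u i))\<^sup>2)"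
    by (simp add: R_def sum_nonneg)
  have "R \<le> K"
  proof (cases "S = {}")
    case True
    then show ?thesis using K by (simp add: R_def)
  next
    case False
    have R: "R > 0"
      unfolding R_def real_sqrt_gt_0_iff using S False by (intro sum_pos) (auto simp: S_def)
    define g where "g = (\<lambda>z i. cnj (u i) * exp ((1 - 2 * z) * complex_of_real (ln (cmod (u i) / R))))"
    have g_norm: "cmod (g z i) = cmod (u i) * exp ((1 - 2 * Re z) * ln (cmod (u i) / R))" for z i
      by (simp add: g_def norm_mult)
    \<comment> \<open>On \<open>S\<close>, \<open>g z\<close> thus has l1 norm \<open>R\<close> on
      \<open>Re z = 0\<close> and supremum norm \<open>R\<close> on \<open>Re z = 1\<close>, which
      pairs with the bounds for \<open>f\<close> on the two lines.\<close>
    have g0: "cmod (g z i) = (cmod (u i))\<^sup>2 / R" if "i \<in> S" "Re z = 0" for z i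
      using that R by (simp add: g_norm S_def power2_eq_square)
    have g1: "cmod (g z i) = R" if "i \<in> S" "Re z = 1" for z i
      using that R by (simp add: g_norm S_def exp_minus)
    define F where "F = (\<lambda>z. \<Sum>i\<in>S. f z i * g z i)"
    have g_cont: "continuous_on X (\<lambda>z. g z i)" for i X
      unfolding g_def by (intro continuous_intros)
    have g_hol: "(\<lambda>z. g z i) holomorphic_on X" for i X
      unfolding g_def by (intro holomorphic_intros)
    have "cmod (F (1/2)) \<le> K * R"
    proof (rule strip_max_principle[where F = F and z = "1/2"])
      show "F holomorphic_on open_strip"
        unfolding F_def by (intro holomorphic_intros cald_bdD(2)[OF f] g_hol)
      show "continuous_on closed_strip F"
        unfolding F_def by (intro continuous_intros cald_bd_continuous[OF f] g_cont)
      show "1/2 \<in> closed_strip"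
        using half_in_open_strip open_strip_subset by blast
      \<comment> \<open>Any bound will do here, since its size does not enter the conclusion of the
        maximum principle.\<close>
      show "cmod (F z) \<le> (\<Sum>i\<in>S. K * (cmod (u i) * exp \<bar>ln (cmod (u i) / R)\<bar>))" if z: "z \<in> closed_strip" for z
        unfolding F_def
      proof (rule sum_norm_le)
        fix i assume "i \<in> S"
        have "\<bar>1 - 2 * Re z\<bar> \<le> 1"
          using z by (auto simp: closed_strip_def)
        then have "\<bar>1 - 2 * Re z\<bar> * \<bar>ln (cmod (u i) / R)\<bar> \<le> \<bar>ln (cmod (u i) / R)\<bar>"
          by (intro mult_left_le_one_le) auto
        then have "(1 - 2 * Re z) * ln (cmod (u i) / R) \<le> \<bar>ln (cmod (u i) / R)\<bar>"
          by (metis abs_le_D1 abs_mult)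
        then have "cmod (g z i) \<le> cmod (u i) * exp \<bar>ln (cmod (u i) / R)\<bar>"
          unfolding g_norm by (intro mult_left_mono) auto
        then show "cmod (f z i * g z i) \<le> K * (cmod (u i) * exp \<bar>ln (cmod (u i) / R)\<bar>)"
          unfolding norm_mult using K cald_bd_strip_bound[OF f ab z] by (intro mult_mono) auto
      qed
      show "cmod (F z) \<le> K * R" if z: "Re z = 0" for z
      proof -
        have "cmod (F z) \<le> (\<Sum>i\<in>S. K * ((cmod (u i))\<^sup>2 / R))"
          unfolding F_def
        proof (rule sum_norm_le)
          fix i assume "i \<in> S"
          then show "cmod (f z i * g z i) \<le> K * ((cmod (u i))\<^sup>2 / R)"
            unfolding norm_mult using g0[OF _ z] cald_bdD(3)[OF f z, of i] ab K R
            by (intro mult_mono) auto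
        qed
        also have "\<dots> = K * (R\<^sup>2 / R)"
          unfolding R2 by (simp add: sum_distrib_left sum_divide_distrib)
        finally show ?thesis using R by (simp add: power2_eq_square)
      qed
      show "cmod (F z) \<le> K * R" if z: "Re z = 1" for z
      proof -
        have "cmod (F z) \<le> (\<Sum>i\<in>S. cmod (f z i) * R)"
          unfolding F_def
        proof (rule sum_norm_le)
          fix i assume "i \<in> S"
          then show "cmod (f z i * g z i) \<le> cmod (f z i) * R"
            unfolding norm_mult using g1[OF _ z] by simp
        qed
        also have "\<dots> = (\<Sum>i\<in>S. cmod (f z i)) * R"
          by (simp add: sum_distrib_right)
        also have "\<dots> \<le> K * R"
          using cald_bdD(4)[OF f z S] ab R by (intro mult_right_mono) auto
        finally show ?thesis .
      qed
    qed
    moreover have "F (1/2) = of_real (R\<^sup>2)"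
      unfolding F_def R2 of_real_sum
      by (intro sum.cong) (auto simp: g_def u_def complex_mult_cnj cmod_power2)
    ultimately have "R * R \<le> K * R"
      by (simp add: power2_eq_square norm_mult)
    then show ?thesis using R by simp
  qed
  then have "R\<^sup>2 \<le> K\<^sup>2"
    using real_sqrt_ge_zero by (intro power_mono) (auto simp: R_def sum_nonneg)
  then show ?thesis
    using R2 eqS by (simp add: u_def)
qed

text \<open>Bounding all finite partial sums replaces summability; requiring
  \<open>0 \<le> K\<close> makes the bound on squares a bound on the norm.\<close>

definition l2_le :: "seq \<Rightarrow> real \<Rightarrow> bool" where
  "l2_le u K \<longleftrightarrow> 0 \<le> K \<and> (\<forall>A. finite A \<longrightarrow> (\<Sum>i\<in>A. (cmod (u i))\<^sup>2) \<le> K\<^sup>2)"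

lemma l2_le_mono:
  assumes "l2_le u K" "K \<le> K'"
  shows "l2_le u K'"
proof -
  have K: "0 \<le> K" and u: "\<And>A. finite A \<Longrightarrow> (\<Sum>i\<in>A. (cmod (u i))\<^sup>2) \<le> K\<^sup>2"
    using assms(1) by (auto simp only: l2_le_def)
  have "K\<^sup>2 \<le> K'\<^sup>2"
    using assms(2) K by (rule power_mono)
  then have "(\<Sum>i\<in>A. (cmod (u i))\<^sup>2) \<le> K'\<^sup>2" if "finite A" for A
    using u[OF that] by linarith
  then show ?thesis
    using K assms(2) unfolding l2_le_def by simp
qed

lemma l2_le_finite_support:
  assumes "finite A" "\<And>j. j \<notin> A \<Longrightarrow> u j = 0" "0 \<le> K" "(\<Sum>j\<in>A. (cmod (u j))\<^sup>2) \<le> K\<^sup>2"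
  shows "l2_le u K"
  unfolding l2_le_def
proof (intro conjI allI impI assms(3))
  fix B :: "nat set" assume B: "finite B"
  have "(\<Sum>j\<in>B. (cmod (u j))\<^sup>2) = (\<Sum>j\<in>B \<inter> A. (cmod (u j))\<^sup>2)"
    using B assms(2) by (intro sum.mono_neutral_right) auto
  also have "\<dots> \<le> (\<Sum>j\<in>A. (cmod (u j))\<^sup>2)"
    using assms(1) by (intro sum_mono2) auto
  finally show "(\<Sum>j\<in>B. (cmod (u j))\<^sup>2) \<le> K\<^sup>2"
    using assms(4) by linarith
qed

text \<open>The weights are \<open>r\<^sub>i = (\<Sum>\<^bsub>l\<ge>i\<^esub> \<bar>u\<^sub>l\<bar>\<^sup>2)\<^bsup>1/2\<^esup>\<close>. A constant weight would give the usual extremal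
  function \<open>u\<^sub>i (\<bar>u\<^sub>i\<bar>/\<parallel>u\<parallel>)\<^bsup>2z-1\<^esup>\<close>, which is not norm continuous up to the line \<open>Re z = 0\<close>.\<close>
lemma l2_representative:
  assumes "l2_le u K"
  shows "\<exists>g r. (\<forall>M. cald_bd (\<lambda>z i. if i \<in> {M..} then g z i else 0) (r M) (2 * r M)) \<and>
    r \<longlonglongrightarrow> 0 \<and> r 0 \<le> K \<and> (\<forall>i. g (1/2) i = u i) \<and> (\<forall>z i. u i = 0 \<longrightarrow> g z i = 0)"
proof -
  have u: "(\<Sum>i\<in>A. (cmod (u i))\<^sup>2) \<le> K\<^sup>2" if "finite A" for A
    using assms that by (simp add: l2_le_def)
  have K: "0 \<le> K"
    using assms by (simp add: l2_le_def)
  have sm: "summable (\<lambda>i. (cmod (u i))\<^sup>2)"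
    by (rule summableI_nonneg_bounded[where x = "K\<^sup>2"]) (use u in auto)
  define t where "t = (\<lambda>M. \<Sum>i. (cmod (u (i + M)))\<^sup>2)"
  define r where "r = (\<lambda>M. sqrt (t M))"
  have smM: "summable (\<lambda>i. (cmod (u (i + M)))\<^sup>2)" for M
    using sm by (rule summable_ignore_initial_segment)
  have t_nonneg: "0 \<le> t M" for M
    unfolding t_def by (rule suminf_nonneg[OF smM]) simp
  have t_Suc: "t M = (cmod (u M))\<^sup>2 + t (Suc M)" for M
    using suminf_split_head[OF smM[of M]] by (simp add: t_def)
  have r_nonneg: "0 \<le> r M" for M
    by (simp add: r_def t_nonneg)
  have r2: "(r M)\<^sup>2 = t M" for M
    by (simp add: r_def t_nonneg)
  have u_le_r: "cmod (u M) \<le> r M" for M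
    unfolding r_def by (rule real_le_rsqrt) (use t_Suc[of M] t_nonneg[of "Suc M"] in linarith)
  have r_Suc: "r (Suc M) \<le> r M" for M
    unfolding r_def using t_Suc[of M] by simp
  have r_anti: "r M' \<le> r M" if "M \<le> M'" for M M'
    using lift_Suc_antimono_le[of r, OF r_Suc that] .
  have "t \<longlonglongrightarrow> 0"
  proof -
    have "(\<lambda>M. (\<Sum>i. (cmod (u i))\<^sup>2) - (\<Sum>i<M. (cmod (u i))\<^sup>2))
        \<longlonglongrightarrow> (\<Sum>i. (cmod (u i))\<^sup>2) - (\<Sum>i. (cmod (u i))\<^sup>2)"
      by (intro tendsto_intros summable_LIMSEQ sm)
    then show ?thesis
      by (simp add: t_def suminf_minus_initial_segment[OF sm])
  qed
  then have r_lim: "r \<longlonglongrightarrow> 0"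
    unfolding r_def using tendsto_real_sqrt by fastforce
  have "t 0 \<le> K\<^sup>2"
    unfolding t_def using u by (intro suminf_le_const smM) simp
  then have r0: "r 0 \<le> K"
    using K by (simp add: r_def real_le_lsqrt t_nonneg)
  define g where "g = (\<lambda>z i. if u i = 0 then 0 else u i * exp ((2 * z - 1) * complex_of_real (ln (cmod (u i) / r i))))"
  have rpos: "r i > 0" if "u i \<noteq> 0" for i
    using u_le_r[of i] that by (metis less_le_trans zero_less_norm_iff)
  have g_norm: "cmod (g z i) = cmod (u i) * exp ((2 * Re z - 1) * ln (cmod (u i) / r i))" for z i
    by (simp add: g_def norm_mult)
  have g_le: "cmod (g z i) \<le> r i" if z: "z \<in> closed_strip" for z i
  proof (cases "u i = 0")
    case False
    define c where "c = ln (cmod (u i) / r i)"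
    have "c \<le> 0"
      using False rpos[OF False] u_le_r[of i] by (simp add: c_def)
    then have "Re z * c \<le> 0"
      using z by (simp add: closed_strip_def mult_nonneg_nonpos)
    then have "(2 * Re z - 1) * c \<le> - c"
      by (simp add: algebra_simps)
    then have "cmod (g z i) \<le> cmod (u i) * exp (- c)"
      unfolding g_norm c_def[symmetric] by (intro mult_left_mono) auto
    also have "\<dots> = r i"
      using False rpos[OF False] by (simp add: c_def exp_minus)
    finally show ?thesis .
  qed (simp add: g_def r_nonneg)
  \<comment> \<open>Here \<open>(cmod (u i))\<^sup>2\<close> is
    \<open>(r i)\<^sup>2 - (r (Suc i))\<^sup>2\<close>, so the l1 norm on this line is dominated by
    a telescoping sum; this is the origin of the factor 2 in \<open>2 * r M\<close>.\<close>
  have g_one: "cmod (g z i) \<le> 2 * (r i - r (Suc i))" if z: "Re z = 1" for z i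
  proof (cases "u i = 0")
    case True
    then show ?thesis using r_Suc[of i] by (simp add: g_def)
  next
    case False
    have "cmod (g z i) = (cmod (u i))\<^sup>2 / r i"
      unfolding g_norm using z False rpos[OF False] by (simp add: power2_eq_square)
    also have "\<dots> = ((r i)\<^sup>2 - (r (Suc i))\<^sup>2) / r i"
      using t_Suc[of i] by (simp add: r2)
    also have "\<dots> \<le> 2 * (r i - r (Suc i))"
    proof -
      have "(r i)\<^sup>2 - (r (Suc i))\<^sup>2 = (r i - r (Suc i)) * (r i + r (Suc i))"
        by (simp add: power2_eq_square algebra_simps)
      also have "\<dots> \<le> (r i - r (Suc i)) * (2 * r i)"
        using r_Suc[of i] by (intro mult_left_mono) auto
      finally show ?thesis
        using rpos[OF False] by (simp add: pos_divide_le_eq mult_ac)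
    qed
    finally show ?thesis .
  qed
  have g_hol: "(\<lambda>z. g z i) holomorphic_on X" for i X
    by (cases "u i = 0") (auto simp: g_def intro!: holomorphic_intros)
  have g_cont: "continuous_on X (\<lambda>z. g z i)" for i X
    using g_hol holomorphic_on_imp_continuous_on by blast
  have "cald_bd (\<lambda>z i. if i \<in> {M..} then g z i else 0) (r M) (2 * r M)" for M
  proof (rule cald_bdI)
    show le: "cmod (if i \<in> {M..} then g z i else 0) \<le> r M" if "z \<in> closed_strip" for z i
      using g_le[OF that, of i] r_anti[of M i] r_nonneg[of M] by auto
    show "equi_at (\<lambda>z i. if i \<in> {M..} then g z i else 0) z" if z: "z \<in> closed_strip" for z
    proof (rule equi_at_restrict)
      show "equi_at g z"
        using g_le r_lim z g_cont
        by (intro equi_at_vanishing[where r = r]) (auto simp: continuous_on_eq_continuous_within)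
    qed
    show "(\<lambda>z. if i \<in> {M..} then g z i else 0) holomorphic_on open_strip" for i
      using g_hol by (cases "i \<ge> M") auto
    show "cmod (if i \<in> {M..} then g z i else 0) \<le> r M" if "Re z = 0" for z i
      using le[of z i] that by (simp add: closed_strip_def)
    show "(\<Sum>i\<in>A. cmod (if i \<in> {M..} then g z i else 0)) \<le> 2 * r M" if "Re z = 1" "finite A" for z A
    proof -
      obtain L where L: "\<And>i. i \<in> A \<Longrightarrow> i < L"
        using \<open>finite A\<close> unfolding finite_nat_set_iff_bounded by blast
      define L' where "L' = max L M"
      have "(\<Sum>i\<in>A. cmod (if i \<in> {M..} then g z i else 0)) = (\<Sum>i\<in>A \<inter> {M..}. cmod (g z i))"
        using \<open>finite A\<close> by (simp add: sum.inter_restrict if_distrib[of cmod] cong: if_cong)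
      also have "\<dots> \<le> (\<Sum>i\<in>{M..<L'}. cmod (g z i))"
        using L by (intro sum_mono2) (auto simp: L'_def less_max_iff_disj)
      also have "\<dots> \<le> (\<Sum>i\<in>{M..<L'}. 2 * (r i - r (Suc i)))"
        using g_one that(1) by (intro sum_mono) auto
      also have "\<dots> = 2 * (r M - r L')"
        unfolding sum_distrib_left[symmetric] using sum_Suc_diff'[of M L' "\<lambda>i. - r i"]
        by (simp add: L'_def)
      finally show ?thesis
        using r_nonneg[of L'] by simp
    qed
  qed
  moreover have "g (1/2) i = u i" for i
    by (simp add: g_def)
  moreover have "g z i = 0" if "u i = 0" for z i
    using that by (simp add: g_def)
  ultimately show ?thesis
    using r_lim r0 by (intro exI[of _ g] exI[of _ r]) auto
qed

section \<open>Taylor coefficients\<close>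

definition tcoef :: "(complex \<Rightarrow> complex) \<Rightarrow> nat \<Rightarrow> complex" where
  "tcoef h j = (deriv ^^ j) h (1/2) / fact j"

lemma taylor_coeff_eq: "taylor_coeff f j i = tcoef (\<lambda>z. f z i) j"
  by (simp add: taylor_coeff_def tcoef_def)

lemma tcoef_0: "tcoef h 0 = h (1/2)"
  by (simp add: tcoef_def)

lemma tcoef_add:
  assumes "g holomorphic_on open_strip" "h holomorphic_on open_strip"
  shows "tcoef (\<lambda>z. g z + h z) j = tcoef g j + tcoef h j"
  using higher_deriv_add[OF assms open_open_strip half_in_open_strip]
  by (simp add: tcoef_def add_divide_distrib)

lemma tcoef_diff:
  assumes "g holomorphic_on open_strip" "h holomorphic_on open_strip"
  shows "tcoef (\<lambda>z. g z - h z) j = tcoef g j - tcoef h j"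
  using higher_deriv_diff[OF assms open_open_strip half_in_open_strip]
  by (simp add: tcoef_def diff_divide_distrib)

lemma tcoef_const: "tcoef (\<lambda>z. c) j = (if j = 0 then c else 0)"
  by (simp add: tcoef_def)

lemma tcoef_sum:
  assumes "\<And>l. l < N \<Longrightarrow> f l holomorphic_on open_strip"
  shows "tcoef (\<lambda>z. \<Sum>l<(N::nat). f l z) j = (\<Sum>l<N. tcoef (f l) j)"
  using assms
proof (induction N)
  case 0
  then show ?case by (simp add: tcoef_const)
next
  case (Suc N)
  have "(\<lambda>z. \<Sum>l<N. f l z) holomorphic_on open_strip"
    using Suc.prems by (intro holomorphic_intros) auto
  then show ?case
    using Suc by (simp add: tcoef_add)
qed

lemma tcoef_mult:
  assumes "g holomorphic_on open_strip" "h holomorphic_on open_strip"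
  shows "tcoef (\<lambda>z. g z * h z) j = (\<Sum>l\<le>j. tcoef g l * tcoef h (j - l))"
proof -
  have "tcoef (\<lambda>z. g z * h z) j
      = (\<Sum>l\<le>j. of_nat (j choose l) * (deriv ^^ l) g (1/2) * (deriv ^^ (j - l)) h (1/2) / fact j)"
    unfolding tcoef_def higher_deriv_mult[OF assms open_open_strip half_in_open_strip]
    by (simp add: sum_divide_distrib atMost_atLeast0)
  also have "\<dots> = (\<Sum>l\<le>j. tcoef g l * tcoef h (j - l))"
  proof (rule sum.cong[OF refl])
    fix l assume "l \<in> {..j}"
    then have "(of_nat (j choose l) :: complex) = fact j / (fact l * fact (j - l))"
      by (simp add: binomial_fact)
    then show "of_nat (j choose l) * (deriv ^^ l) g (1/2) * (deriv ^^ (j - l)) h (1/2) / fact j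
        = tcoef g l * tcoef h (j - l)"
      by (simp add: tcoef_def field_simps)
  qed
  finally show ?thesis .
qed

lemma tcoef_cmult:
  assumes "h holomorphic_on open_strip"
  shows "tcoef (\<lambda>z. c * h z) j = c * tcoef h j"
proof -
  have "(\<Sum>l\<le>j. tcoef (\<lambda>z. c) l * tcoef h (j - l)) = (\<Sum>l\<in>{0}. tcoef (\<lambda>z. c) l * tcoef h (j - l))"
    by (intro sum.mono_neutral_right) (auto simp: tcoef_const)
  then show ?thesis
    using tcoef_mult[of "\<lambda>z. c" h j] assms by (simp add: tcoef_const)
qed

lemma tcoef_ident: "tcoef (\<lambda>z. z - 1/2) j = (if j = 1 then 1 else 0)"
proof -
  have "tcoef (\<lambda>z. z) j = (if j = 0 then 1/2 else if j = 1 then 1 else 0)"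
    by (simp add: tcoef_def)
  then show ?thesis
    using tcoef_diff[of "\<lambda>z. z" "\<lambda>z. 1/2" j] by (simp add: tcoef_const holomorphic_on_ident)
qed

lemma tcoef_shift:
  assumes "h holomorphic_on open_strip"
  shows "tcoef (\<lambda>z. (z - 1/2) * h z) j = (if j = 0 then 0 else tcoef h (j - 1))"
proof -
  have hol: "(\<lambda>z. z - 1/2) holomorphic_on open_strip"
    by (intro holomorphic_intros)
  have "(\<Sum>l\<le>j. tcoef (\<lambda>z. z - 1/2) l * tcoef h (j - l))
      = (\<Sum>l\<in>{..j} \<inter> {1}. tcoef (\<lambda>z. z - 1/2) l * tcoef h (j - l))"
    by (intro sum.mono_neutral_right) (auto simp: tcoef_ident)
  then show ?thesis
    unfolding tcoef_mult[OF hol assms] by (cases "j = 0") (auto simp: tcoef_ident)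
qed

lemma tcoef_shift_power:
  assumes "h holomorphic_on open_strip"
  shows "tcoef (\<lambda>z. (z - 1/2) ^ m * h z) j = (if j < m then 0 else tcoef h (j - m))"
proof (induction m arbitrary: j)
  case (Suc m)
  have "(\<lambda>z. (z - 1/2) ^ m * h z) holomorphic_on open_strip"
    using assms by (intro holomorphic_intros)
  then have "tcoef (\<lambda>z. (z - 1/2) * ((z - 1/2) ^ m * h z)) j
      = (if j = 0 then 0 else tcoef (\<lambda>z. (z - 1/2) ^ m * h z) (j - 1))"
    by (rule tcoef_shift)
  then show ?case
    using Suc.IH by (auto simp: mult.assoc)
qed simp

section \<open>Norm bounds in Rochberg spaces\<close>

definition jet :: "nat \<Rightarrow> (complex \<Rightarrow> seq) \<Rightarrow> arr" where
  "jet n f = (\<lambda>j i. if j < n then tcoef (\<lambda>z. f z i) j else 0)"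

text \<open>\<open>Zbd n x K\<close> says that \<open>x\<close> is the jet of a function of norm at most \<open>K\<close>. It differs from
  \<open>Znorm n x \<le> K\<close> only in that the infimum has to be attained.\<close>
definition Zbd :: "nat \<Rightarrow> arr \<Rightarrow> real \<Rightarrow> bool" where
  "Zbd n x K \<longleftrightarrow> (\<exists>f. cald_bd f K K \<and> x = jet n f)"

definition res :: "nat set \<Rightarrow> arr \<Rightarrow> arr" where
  "res A x = (\<lambda>j i. if i \<in> A then x j i else 0)"

definition ord_ge :: "nat \<Rightarrow> arr \<Rightarrow> bool" where
  "ord_ge p x \<longleftrightarrow> (\<forall>q<p. \<forall>i. x q i = 0)"

definition supp_in :: "nat set \<Rightarrow> arr \<Rightarrow> bool" where
  "supp_in A x \<longleftrightarrow> (\<forall>j i. i \<notin> A \<longrightarrow> x j i = 0)"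

lemma ZbdI: "cald_bd f a b \<Longrightarrow> a \<le> K \<Longrightarrow> b \<le> K \<Longrightarrow> Zbd n (jet n f) K"
  unfolding Zbd_def using cald_bd_mono by blast

lemma Zbd_nonneg: "Zbd n x K \<Longrightarrow> 0 \<le> K"
  unfolding Zbd_def using cald_bd_nonneg by blast

lemma Zbd_mono: "Zbd n x K \<Longrightarrow> K \<le> K' \<Longrightarrow> Zbd n x K'"
  unfolding Zbd_def using cald_bd_mono by blast

lemma Zbd_high: "Zbd n x K \<Longrightarrow> n \<le> j \<Longrightarrow> x j i = 0"
  by (auto simp: Zbd_def jet_def)

lemma represents_jet:
  "represents n f x \<and> (\<forall>j\<ge>n. x j = (\<lambda>i. 0)) \<longleftrightarrow> f \<in> calderon \<and> x = jet n f"
proof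
  assume h: "represents n f x \<and> (\<forall>j\<ge>n. x j = (\<lambda>i. 0))"
  then have "x j i = jet n f j i" for j i
    by (cases "j < n") (simp_all add: represents_def jet_def taylor_coeff_eq)
  then show "f \<in> calderon \<and> x = jet n f"
    using h by (auto simp: represents_def fun_eq_iff)
qed (auto simp: represents_def jet_def taylor_coeff_eq fun_eq_iff)

lemma Zsp_iff_Zbd: "x \<in> Zsp n \<longleftrightarrow> (\<exists>K. Zbd n x K)"
proof
  assume "x \<in> Zsp n"
  then obtain f where "f \<in> calderon" "x = jet n f"
    unfolding Zsp_def using represents_jet by blast
  then show "\<exists>K. Zbd n x K"
    unfolding Zbd_def using calderon_imp_cald_bd by blast
next
  assume "\<exists>K. Zbd n x K"
  then obtain f where "f \<in> calderon" "x = jet n f"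
    unfolding Zbd_def using cald_bd_imp_calderon(1) by blast
  then show "x \<in> Zsp n"
    unfolding Zsp_def using represents_jet by blast
qed

lemma calderon_norm_nonneg: "f \<in> calderon \<Longrightarrow> 0 \<le> calderon_norm f"
  using calderon_imp_cald_bd cald_bd_nonneg by blast

lemma Znorm_le:
  assumes "Zbd n x K"
  shows "Znorm n x \<le> K"
proof -
  obtain f where f: "cald_bd f K K" "x = jet n f"
    using assms unfolding Zbd_def by blast
  then have "represents n f x" "calderon_norm f \<le> K"
    using represents_jet cald_bd_imp_calderon by blast+
  moreover have "bdd_below {calderon_norm f | f. represents n f x}"
    using calderon_norm_nonneg by (auto simp: bdd_below_def represents_def)
  ultimately show ?thesis
    unfolding Znorm_def by (intro cInf_lower2[of "calderon_norm f"]) auto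
qed

lemma Znorm_less_imp_Zbd:
  assumes "x \<in> Zsp n" "Znorm n x < K"
  shows "Zbd n x K"
proof -
  let ?S = "{calderon_norm f | f. represents n f x}"
  have "?S \<noteq> {}"
    using assms(1) unfolding Zsp_def by blast
  moreover have "Inf ?S < K"
    using assms(2) by (simp only: Znorm_def)
  ultimately have "\<exists>c\<in>?S. c < K"
    by (rule cInf_lessD)
  then obtain c where "c \<in> ?S" "c < K"
    by (elim bexE)
  then obtain f where f: "represents n f x" "calderon_norm f < K"
    by blast
  have "\<forall>j\<ge>n. x j = (\<lambda>i. 0)"
    using assms(1) by (simp add: Zsp_def)
  then have "f \<in> calderon" "x = jet n f"
    using represents_jet f(1) by blast+
  then show ?thesis
    using calderon_imp_cald_bd[of f] f(2) by (auto intro: ZbdI)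
qed

lemma Znorm_nonneg: "x \<in> Zsp n \<Longrightarrow> 0 \<le> Znorm n x"
  unfolding Znorm_def
  by (rule cInf_greatest) (auto simp: Zsp_def represents_def intro: calderon_norm_nonneg)

lemma Zbd_add:
  assumes "Zbd n x K" "Zbd n y K'"
  shows "Zbd n (x + y) (K + K')"
proof -
  obtain f g where f: "cald_bd f K K" "x = jet n f" and g: "cald_bd g K' K'" "y = jet n g"
    using assms unfolding Zbd_def by blast
  have "x + y = jet n (\<lambda>z i. f z i + g z i)"
    using tcoef_add[OF cald_bdD(2)[OF f(1)] cald_bdD(2)[OF g(1)]]
    by (simp add: f(2) g(2) jet_def fun_eq_iff)
  then show ?thesis
    unfolding Zbd_def using cald_bd_add[OF f(1) g(1)] by blast
qed

lemma Zbd_scale: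
  assumes "Zbd n x K"
  shows "Zbd n (arr_scale c x) (cmod c * K)"
proof -
  obtain f where f: "cald_bd f K K" "x = jet n f"
    using assms unfolding Zbd_def by blast
  have "arr_scale c x = jet n (\<lambda>z i. c * f z i)"
    using tcoef_cmult[OF cald_bdD(2)[OF f(1)]]
    by (simp add: f(2) jet_def fun_eq_iff arr_scale_def)
  then show ?thesis
    unfolding Zbd_def using cald_bd_cmult[OF f(1)] by blast
qed

lemma Zbd_weaken_scale:
  assumes "Zbd n x K" "cmod c * K \<le> K'"
  shows "Zbd n (arr_scale c x) K'"
  using Zbd_mono[OF Zbd_scale[OF assms(1)] assms(2)] .

lemma Zbd_diff:
  assumes "Zbd n x K" "Zbd n y K'"
  shows "Zbd n (x - y) (K + K')"
proof -
  have eq: "x - y = x + arr_scale (-1) y"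
    by (simp add: fun_eq_iff arr_scale_def)
  show ?thesis
    unfolding eq using Zbd_add[OF assms(1) Zbd_scale[OF assms(2), of "-1"]] by simp
qed

lemma Zbd_zero: "Zbd n 0 0"
proof -
  have "jet n (\<lambda>z i. 0) = 0"
    by (simp add: jet_def fun_eq_iff tcoef_const)
  then show ?thesis
    using ZbdI[OF cald_bd_zero, of 0 n] by simp
qed

lemma sum_arr_apply: "(\<Sum>l\<in>I. x l) j i = (\<Sum>l\<in>I. (x l :: arr) j i)"
  by (induction I rule: infinite_finite_induct) auto

lemma Zbd_sum:
  assumes "\<And>l. l < N \<Longrightarrow> Zbd n (x l) K"
  shows "Zbd n (\<Sum>l<(N::nat). x l) (real N * K)"
  using assms
proof (induction N)
  case 0
  show ?case
    by (simp only: lessThan_0 sum.empty of_nat_0 mult_zero_left Zbd_zero)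
next
  case (Suc N)
  have "Zbd n ((\<Sum>l<N. x l) + x N) (real N * K + K)"
    using Suc by (intro Zbd_add) auto
  then show ?case by (simp only: sum.lessThan_Suc of_nat_Suc distrib_right mult_1 add.commute)
qed

lemma Zbd_res:
  assumes "Zbd n x K"
  shows "Zbd n (res A x) K"
proof -
  obtain f where f: "cald_bd f K K" "x = jet n f"
    using assms unfolding Zbd_def by blast
  have "res A x = jet n (\<lambda>z i. if i \<in> A then f z i else 0)"
    by (auto simp add: f(2) jet_def fun_eq_iff res_def tcoef_const)
  then show ?thesis
    unfolding Zbd_def using cald_bd_restrict[OF f(1)] by blast
qed

text \<open>The nilpotent operator \<open>\<iota>\<^bsub>n-1,n\<^esub> \<pi>\<^bsub>n,n-1\<^esub>\<close>, i.e. multiplication of jets by \<open>z - 1/2\<close>.\<close>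
definition shift :: "nat \<Rightarrow> arr \<Rightarrow> arr" where
  "shift n x = (\<lambda>j i. if 0 < j \<and> j < n then x (j - 1) i else 0)"

text \<open>Multiplication by \<open>z - 1/2\<close> is unbounded on the strip. With \<open>\<rho> = (z - 1/2)/(z + 1/2)\<close>, which is
  bounded there, it is replaced by \<open>\<rho> + \<dots> + \<rho>\<^sup>n = (z - 1/2)(1 - \<rho>\<^sup>n)\<close>, which has the same jet.\<close>
lemma Zbd_shift:
  assumes "Zbd n x K"
  shows "Zbd n (shift n x) ((\<Sum>j=1..n. 3 ^ j) * K)"
proof -
  obtain f where f: "cald_bd f K K" "x = jet n f"
    using assms unfolding Zbd_def by blast
  define q where "q = (\<lambda>z::complex. 1 / (z + 1/2))"
  define \<rho> where "\<rho> = (\<lambda>z. (z - 1/2) * q z)"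
  define b where "b = (\<lambda>z. \<Sum>j=1..n. \<rho> z ^ j)"
  have re: "1/2 \<le> cmod (z + 1/2)" if "z \<in> closed_strip" for z
  proof -
    have "1/2 \<le> Re (z + 1/2)" using that by (simp add: closed_strip_def)
    then show ?thesis using complex_Re_le_cmod order_trans by blast
  qed
  have nz: "z + 1/2 \<noteq> 0" if "z \<in> closed_strip" for z
    using re[OF that] by fastforce
  have rho_eq: "\<rho> z = 1 - q z" if "z \<in> closed_strip" for z
  proof -
    have "(w - 1) * (1 / w) = 1 - 1 / w" if "w \<noteq> 0" for w :: complex
      using that by (simp add: field_simps)
    from this[OF nz[OF that]] show ?thesis
      by (simp add: \<rho>_def q_def)
  qed
  have q_le: "cmod (q z) \<le> 2" if "z \<in> closed_strip" for z
  proof -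
    have "1 / cmod (z + 1/2) \<le> 1 / (1/2)"
      using re[OF that] by (intro divide_left_mono) auto
    then show ?thesis
      by (simp add: q_def norm_divide)
  qed
  have rho_le: "cmod (\<rho> z) \<le> 3" if "z \<in> closed_strip" for z
    using rho_eq[OF that] q_le[OF that] norm_triangle_ineq4[of 1 "q z"] by simp
  have b_le: "cmod (b z) \<le> (\<Sum>j=1..n. 3 ^ j)" if "z \<in> closed_strip" for z
    unfolding b_def using rho_le[OF that] by (intro sum_norm_le) (auto simp: norm_power intro: power_mono)
  have q_cont: "continuous_on closed_strip q"
    unfolding q_def using nz by (intro continuous_intros) auto
  have q_hol: "q holomorphic_on open_strip"
    unfolding q_def using nz open_strip_subset by (intro holomorphic_intros) auto
  have b_cont: "continuous_on closed_strip b"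
    unfolding b_def \<rho>_def using q_cont by (intro continuous_intros) auto
  have b_hol: "b holomorphic_on open_strip"
    unfolding b_def \<rho>_def using q_hol by (intro holomorphic_intros) auto
  have bnd: "z \<in> closed_strip" if "Re z = 0 \<or> Re z = 1" for z
    using that by (auto simp: closed_strip_def)
  have cb: "cald_bd (\<lambda>z i. b z * f z i) ((\<Sum>j=1..n. 3 ^ j) * K) ((\<Sum>j=1..n. 3 ^ j) * K)"
    by (rule cald_bd_mult[OF f(1) b_hol b_cont b_le]) (use b_le bnd in auto)
  have b_eq: "b z = (z - 1/2) - (z - 1/2) ^ Suc n * q z ^ n" if "z \<in> open_strip" for z
  proof -
    have z: "z \<in> closed_strip" using that open_strip_subset by blast
    have geo: "(1 - t) * (\<Sum>j=1..m. t ^ j) = t - t ^ Suc m" for t :: complex and m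
    proof (induction m)
      case (Suc m)
      have "(1 - t) * (\<Sum>j=1..Suc m. t ^ j) = (1 - t) * (\<Sum>j=1..m. t ^ j) + (1 - t) * t ^ Suc m"
        by (simp add: distrib_left)
      also have "\<dots> = t - t ^ Suc m + (1 - t) * t ^ Suc m"
        by (simp only: Suc)
      finally show ?case
        by (simp only:) (simp add: left_diff_distrib)
    qed simp
    have "(1 - \<rho> z) * b z = \<rho> z - \<rho> z ^ Suc n"
      unfolding b_def by (rule geo)
    moreover have "1 - \<rho> z = q z"
      using rho_eq[OF z] by simp
    moreover have "t - t ^ Suc n = c * (d - d * t ^ n)" if "t = d * c" for t c d :: complex
      using that by (simp add: right_diff_distrib mult_ac)
    ultimately have "q z * b z = q z * ((z - 1/2) - (z - 1/2) * \<rho> z ^ n)"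
      by (simp add: \<rho>_def)
    moreover have "q z \<noteq> 0" using nz[OF z] by (simp add: q_def)
    ultimately show ?thesis
      by (simp add: \<rho>_def power_mult_distrib mult.assoc)
  qed
  have "tcoef (\<lambda>z. b z * f z i) j = (if j = 0 then 0 else tcoef (\<lambda>z. f z i) (j - 1))" if "j < n" for i j
  proof -
    have fi: "(\<lambda>z. f z i) holomorphic_on open_strip"
      by (rule cald_bdD(2)[OF f(1)])
    have h1: "(\<lambda>z. (z - 1/2) * f z i) holomorphic_on open_strip"
      using fi by (intro holomorphic_intros)
    have h2: "(\<lambda>z. q z ^ n * f z i) holomorphic_on open_strip"
      using fi q_hol by (intro holomorphic_intros)
    have h3: "(\<lambda>z. (z - 1/2) ^ Suc n * (q z ^ n * f z i)) holomorphic_on open_strip"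
      using fi q_hol by (intro holomorphic_intros)
    have h4: "(\<lambda>z. b z * f z i) holomorphic_on open_strip"
      using fi b_hol by (intro holomorphic_intros)
    have "tcoef (\<lambda>z. b z * f z i) j = tcoef (\<lambda>z. (z - 1/2) * f z i - (z - 1/2) ^ Suc n * (q z ^ n * f z i)) j"
      unfolding tcoef_def
      using higher_deriv_transform_within_open[OF h4 holomorphic_on_diff[OF h1 h3] open_open_strip half_in_open_strip]
      by (simp add: b_eq algebra_simps)
    also have "\<dots> = tcoef (\<lambda>z. (z - 1/2) * f z i) j - tcoef (\<lambda>z. (z - 1/2) ^ Suc n * (q z ^ n * f z i)) j"
      by (rule tcoef_diff[OF h1 h3])
    finally show ?thesis
      using tcoef_shift[OF fi] tcoef_shift_power[OF h2, of "Suc n"] that by simp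
  qed
  then have "shift n x = jet n (\<lambda>z i. b z * f z i)"
    by (auto simp: f(2) shift_def jet_def fun_eq_iff)
  then show ?thesis
    unfolding Zbd_def using cb by blast
qed

text \<open>The summand 1 makes the constant at least 1, so that its powers increase.\<close>

definition shift_const :: "nat \<Rightarrow> real" where
  "shift_const n = 1 + (\<Sum>j=1..n. 3 ^ j)"

lemma shift_const_ge_1: "1 \<le> shift_const n"
  by (simp add: shift_const_def sum_nonneg)

lemma Zbd_shift_power: "Zbd n x K \<Longrightarrow> Zbd n ((shift n ^^ m) x) (shift_const n ^ m * K)"
proof (induction m)
  case (Suc m)
  have "Zbd n (shift n ((shift n ^^ m) x)) ((\<Sum>j=1..n. 3 ^ j) * (shift_const n ^ m * K))"
    using Suc by (intro Zbd_shift)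
  moreover have "(\<Sum>j=1..n. 3 ^ j) * (shift_const n ^ m * K) \<le> shift_const n * (shift_const n ^ m * K)"
    using Zbd_nonneg[OF Suc.prems] shift_const_ge_1[of n] by (intro mult_right_mono) (auto simp: shift_const_def)
  ultimately show ?case
    by (simp add: Zbd_mono mult.assoc)
qed simp

lemma shift_power:
  assumes "\<And>j i. n \<le> j \<Longrightarrow> x j i = 0"
  shows "(shift n ^^ m) x = (\<lambda>j i. if m \<le> j \<and> j < n then x (j - m) i else 0)"
proof (induction m)
  case 0
  show ?case using assms by (auto simp: fun_eq_iff)
next
  case (Suc m)
  have "(shift n ^^ Suc m) x j i = (if Suc m \<le> j \<and> j < n then x (j - Suc m) i else 0)" for j i
    by (cases j) (simp_all add: Suc shift_def)
  then show ?case by blast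
qed

lemma Zbd_proj:
  assumes "Zbd n x K" "k \<le> n"
  shows "Zbd k (proj n k x) K"
proof -
  obtain f where f: "cald_bd f K K" "x = jet n f"
    using assms unfolding Zbd_def by blast
  have "proj n k x = jet k f"
    using assms(2) by (auto simp: f(2) proj_def jet_def fun_eq_iff)
  then show ?thesis
    unfolding Zbd_def using f(1) by blast
qed

text \<open>The same representing function, cut down to the coordinates in \<open>A\<close>,
  provides the lift without any loss of norm.\<close>

lemma Zbd_lift:
  assumes "Zbd k x K" "k \<le> n" "supp_in A x"
  obtains y where "Zbd n y K" "proj n k y = x" "supp_in A y"
proof -
  obtain f where f: "cald_bd f K K" "x = jet k f"
    using assms unfolding Zbd_def by blast
  define y where "y = jet n (\<lambda>z i. if i \<in> A then f z i else 0)"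
  have "Zbd n y K"
    unfolding Zbd_def y_def using cald_bd_restrict[OF f(1)] by blast
  moreover have "proj n k y j i = x j i" for j i
    using assms(2,3) f(2)
    by (cases "i \<in> A") (auto simp: y_def proj_def jet_def tcoef_const supp_in_def)
  moreover have "supp_in A y"
    by (auto simp: supp_in_def y_def jet_def tcoef_const)
  ultimately show thesis
    using that by blast
qed

lemma supp_in_UNIV: "supp_in UNIV x"
  by (simp add: supp_in_def)

text \<open>Whatever preimage \<open>y\<close> of \<open>x\<close> is taken, the embedding is
  multiplication of its jet by the power \<open>n - k\<close> of \<open>z - 1/2\<close>, because the
  shifts discard the coefficients of \<open>y\<close> from index \<open>k\<close> on.\<close>

lemma emb_eq_shift_power:
  assumes "Zbd n y K" "k \<le> n" "proj n k y = x"
  shows "emb k n x = (shift n ^^ (n - k)) y"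
proof -
  have "(shift n ^^ (n - k)) y = (\<lambda>j i. if n - k \<le> j \<and> j < n then y (j - (n - k)) i else 0)"
    using Zbd_high[OF assms(1)] by (rule shift_power)
  moreover have "x j i = y j i" if "j < k" for j i
    using that assms(3) by (auto simp: proj_def)
  moreover have "j - (n - k) < k" if "n - k \<le> j" "j < n" for j
    using that assms(2) by linarith
  ultimately show ?thesis
    by (intro ext) (simp add: emb_def)
qed

lemma Zbd_emb:
  assumes "Zbd k x K" "k \<le> n"
  shows "Zbd n (emb k n x) (shift_const n ^ (n - k) * K)"
proof -
  obtain y where "Zbd n y K" "proj n k y = x"
    using Zbd_lift[OF assms supp_in_UNIV] by blast
  then show ?thesis
    using emb_eq_shift_power[of n y K k x] assms(2) Zbd_shift_power by simp
qed

text \<open>The representing function vanishes at 1/2 and can be divided by \<open>z - 1/2\<close>.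
  This inverts the shift at the cost of a factor 2 and, iterated, shows that the embeddings are
  isomorphic.\<close>

lemma Zbd_divide1:
  assumes "Zbd (Suc n) x K" "\<And>i. x 0 i = 0"
  shows "Zbd n (\<lambda>j. x (Suc j)) (2 * K)"
proof -
  obtain f where f: "cald_bd f K K" "x = jet (Suc n) f"
    using assms unfolding Zbd_def by blast
  have "f (1/2) i = 0" for i
    using assms(2)[of i] by (simp add: f(2) jet_def tcoef_0)
  then obtain g where g: "cald_bd g (2 * K) (2 * K)" "\<And>z i. f z i = (z - 1/2) * g z i"
    using cald_bd_divide[OF f(1)] by blast
  have "(\<lambda>j. x (Suc j)) = jet n g"
    using tcoef_shift[OF cald_bdD(2)[OF g(1)]]
    by (auto simp: f(2) g(2) jet_def fun_eq_iff)
  then show ?thesis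
    unfolding Zbd_def using g(1) by blast
qed

lemma Zbd_divide:
  assumes "Zbd (n + p) x K" "ord_ge p x"
  shows "Zbd n (\<lambda>j. x (j + p)) (2 ^ p * K)"
  using assms
proof (induction p arbitrary: x K)
  case (Suc p)
  have "Zbd (n + p) (\<lambda>j. x (Suc j)) (2 * K)"
    using Suc.prems by (intro Zbd_divide1) (auto simp: ord_ge_def)
  moreover have "ord_ge p (\<lambda>j. x (Suc j))"
    using Suc.prems(2) by (auto simp: ord_ge_def)
  ultimately have "Zbd n (\<lambda>j. x (Suc (j + p))) (2 ^ p * (2 * K))"
    by (rule Suc.IH)
  then show ?case by (simp add: mult_ac)
qed simp

lemma Zbd_l2:
  assumes "Zbd n x K" "0 < n"
  shows "l2_le (x 0) K"
proof -
  obtain f where f: "cald_bd f K K" "x = jet n f"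
    using assms unfolding Zbd_def by blast
  then show ?thesis
    using cald_bd_imp_l2[OF f(1) order_refl order_refl] assms(2) Zbd_nonneg[OF assms(1)]
    by (simp add: l2_le_def jet_def tcoef_0)
qed

text \<open>After \<open>p\<close> divisions by \<open>z - 1/2\<close> the coefficient of index
  \<open>p\<close> has become the value at 1/2, to which the l2 estimate applies.\<close>

lemma Zbd_lead:
  assumes "Zbd n x K" "ord_ge p x" "p < n"
  shows "l2_le (x p) (2 ^ p * K)"
proof -
  have "Zbd (n - p + p) x K" using assms(1,3) by simp
  then have "Zbd (n - p) (\<lambda>j. x (j + p)) (2 ^ p * K)"
    using assms(2) by (rule Zbd_divide)
  from Zbd_l2[OF this] show ?thesis
    using assms(3) by simp
qed

text \<open>Cauchy's inequality on the disc of radius 1/4, with the power \<open>4 ^ n\<close> to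
  serve all indices at once.\<close>

lemma Zbd_coord:
  assumes "Zbd n x K"
  shows "cmod (x j i) \<le> 4 ^ n * K"
proof (cases "j < n")
  case True
  obtain f where f: "cald_bd f K K" "x = jet n f"
    using assms unfolding Zbd_def by blast
  have fi: "(\<lambda>z. f z i) holomorphic_on open_strip"
    by (rule cald_bdD(2)[OF f(1)])
  have K: "0 \<le> K" using Zbd_nonneg[OF assms] .
  have "cmod ((deriv ^^ j) (\<lambda>z. f z i) (1/2)) \<le> fact j * K / (1/4) ^ j"
  proof (rule Cauchy_inequality)
    show "(\<lambda>z. f z i) holomorphic_on ball (1/2) (1/4)"
      using cball_half_subset ball_subset_cball by (intro holomorphic_on_subset[OF fi]) blast
    show "continuous_on (cball (1/2) (1/4)) (\<lambda>z. f z i)"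
      using cball_half_subset by (intro holomorphic_on_imp_continuous_on holomorphic_on_subset[OF fi])
    show "cmod (f y i) \<le> K" if "cmod (1/2 - y) = 1/4" for y
    proof -
      have "y \<in> cball (1/2) (1/4)"
        using that by (simp add: dist_norm)
      then show ?thesis
        using cald_bd_strip_bound[OF f(1) order_refl order_refl] cball_half_subset open_strip_subset by blast
    qed
  qed simp
  then have "cmod (x j i) \<le> K / (1/4) ^ j"
    using True by (simp add: f(2) jet_def tcoef_def norm_divide field_simps)
  also have "\<dots> = 4 ^ j * K"
    by (simp add: power_divide)
  also have "\<dots> \<le> 4 ^ n * K"
    using True K by (intro mult_right_mono power_increasing) auto
  finally show ?thesis .
next
  case False
  then show ?thesis
    using Zbd_high[OF assms] Zbd_nonneg[OF assms] by simp
qed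

lemma Zbd_all_imp_zero:
  assumes "\<And>K. 0 < K \<Longrightarrow> Zbd n x K"
  shows "x = 0"
proof -
  have "x j i = 0" for j i
  proof (rule ccontr)
    assume "x j i \<noteq> 0"
    then have "Zbd n x (cmod (x j i) / (2 * 4 ^ n))"
      by (intro assms) simp
    then have "cmod (x j i) \<le> 4 ^ n * (cmod (x j i) / (2 * 4 ^ n))"
      by (rule Zbd_coord)
    then show False using \<open>x j i \<noteq> 0\<close> by simp
  qed
  then show ?thesis by (simp add: fun_eq_iff)
qed

text \<open>A converse of \<open>Zbd_lead\<close>: the jet of the representative of \<open>u\<close>
  is shifted \<open>p\<close> times. Its further Taylor coefficients supply the entries of
  \<open>w\<close> above index \<open>p\<close>, and they vanish wherever \<open>u\<close>
  does.\<close>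

lemma Zbd_build:
  assumes "l2_le u K" "p < n"
  obtains w where "Zbd n w (2 * shift_const n ^ p * K)" "ord_ge p w" "w p = u" "\<And>A. (\<And>i. i \<notin> A \<Longrightarrow> u i = 0) \<Longrightarrow> supp_in A w"
proof -
  from l2_representative[OF assms(1)]
  obtain g r where "\<forall>M. cald_bd (\<lambda>z i. if i \<in> {M..} then g z i else 0) (r M) (2 * r M)"
    "r \<longlonglongrightarrow> 0" "r 0 \<le> K" "\<forall>i. g (1/2) i = u i" "\<forall>z i. u i = 0 \<longrightarrow> g z i = 0"
    by (elim exE conjE)
  note g = this[rule_format]
  define x where "x = jet n g"
  have x: "Zbd n x (2 * K)"
    unfolding x_def using g(1)[of 0] g(3) assms(1) by (intro ZbdI[where a = "r 0" and b = "2 * r 0"]) (auto simp: l2_le_def)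
  define w where "w = (shift n ^^ p) x"
  have w_eq: "w = (\<lambda>j i. if p \<le> j \<and> j < n then x (j - p) i else 0)"
    unfolding w_def using Zbd_high[OF x] by (rule shift_power)
  have "Zbd n w (2 * shift_const n ^ p * K)"
    using Zbd_shift_power[OF x, of p] by (simp add: w_def mult_ac)
  moreover have "ord_ge p w"
    by (simp add: ord_ge_def w_eq)
  moreover have "w p = u"
    using assms(2) g(4) by (simp add: w_eq x_def jet_def tcoef_0 fun_eq_iff)
  moreover have "supp_in A w" if "\<And>i. i \<notin> A \<Longrightarrow> u i = 0" for A
    using that g(5) by (auto simp: supp_in_def w_eq x_def jet_def tcoef_const)
  ultimately show thesis
    using that by blast
qed

text \<open>Finitely supported arrays are dense. Induction on the length: the function
  \<open>g\<close> built from the coefficient of index 0 has small tails by construction, and after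
  subtracting its jet the rest is divisible by \<open>z - 1/2\<close> and hence comes from a shorter
  jet.\<close>

lemma Zbd_tail:
  assumes "Zbd n x K" "0 < d"
  shows "\<exists>M. \<forall>M'\<ge>M. Zbd n (res {M'..} x) d"
  using assms
proof (induction n arbitrary: x K d)
  case 0
  have eq: "res A x = 0" for A
    using Zbd_high[OF 0(1)] by (auto simp: fun_eq_iff res_def)
  have "Zbd 0 (res A x) d" for A
    unfolding eq using 0(2) by (intro Zbd_mono[OF Zbd_zero]) simp
  then show ?case by blast
next
  case (Suc n)
  from l2_representative[OF Zbd_l2[OF Suc.prems(1) zero_less_Suc]]
  obtain g r where "\<forall>M. cald_bd (\<lambda>z i. if i \<in> {M..} then g z i else 0) (r M) (2 * r M)"
    "r \<longlonglongrightarrow> 0" "r 0 \<le> K" "\<forall>i. g (1/2) i = x 0 i" "\<forall>z i. x 0 i = 0 \<longrightarrow> g z i = 0"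
    by (elim exE conjE)
  note g = this[rule_format]
  define y where "y = jet (Suc n) g"
  have r_nonneg: "0 \<le> r M" for M
    using cald_bd_nonneg(1)[OF g(1)] .
  have res_y: "Zbd (Suc n) (res {M..} y) (2 * r M)" for M
  proof -
    have "res {M..} y = jet (Suc n) (\<lambda>z i. if i \<in> {M..} then g z i else 0)"
      by (auto simp: y_def res_def jet_def fun_eq_iff tcoef_const)
    then show ?thesis
      using ZbdI[OF g(1)[of M], of "2 * r M" "Suc n"] r_nonneg[of M] by simp
  qed
  have "res {0..} y = y"
    by (auto simp: res_def)
  then have y: "Zbd (Suc n) y (2 * r 0)"
    using res_y[of 0] by simp
  have y0: "y 0 i = x 0 i" for i
    using g(4) by (simp add: y_def jet_def tcoef_0)
  define v where "v = x - y"
  have v: "Zbd (Suc n) v (K + 2 * r 0)"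
    unfolding v_def by (intro Zbd_diff Suc.prems(1) y)
  define v' where "v' = (\<lambda>j. v (Suc j))"
  have v': "Zbd n v' (2 * (K + 2 * r 0))"
    unfolding v'_def by (rule Zbd_divide1[OF v]) (simp add: v_def y0)
  have emb_v: "emb n (Suc n) (res A v') = res A v" for A
  proof -
    have "emb n (Suc n) (res A v') j i = res A v j i" for j i
      using Zbd_high[OF v, of j i] y0 by (cases j) (auto simp: emb_def res_def v'_def v_def)
    then show ?thesis by (simp add: fun_eq_iff)
  qed
  have C: "shift_const (Suc n) > 0"
    using shift_const_ge_1[of "Suc n"] by linarith
  obtain M1 where M1: "\<And>M. M \<ge> M1 \<Longrightarrow> Zbd n (res {M..} v') (d / 2 / shift_const (Suc n))"
    using Suc.IH[OF v', of "d / 2 / shift_const (Suc n)"] Suc.prems(2) C by auto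
  obtain M2 where M2: "\<And>M. M \<ge> M2 \<Longrightarrow> \<bar>r M\<bar> < d / 4"
    using g(2) Suc.prems(2) unfolding LIMSEQ_iff by (metis diff_zero real_norm_def zero_less_divide_iff zero_less_numeral)
  have "Zbd (Suc n) (res {M..} x) d" if "M \<ge> max M1 M2" for M
  proof -
    have "Zbd (Suc n) (res {M..} v) (d / 2)"
      using Zbd_emb[OF M1[of M], of "Suc n"] that C by (simp add: emb_v)
    moreover have "Zbd (Suc n) (res {M..} y) (d / 2)"
      using Zbd_mono[OF res_y[of M]] M2[of M] r_nonneg[of M] that by simp
    ultimately have "Zbd (Suc n) (res {M..} v + res {M..} y) (d / 2 + d / 2)"
      by (rule Zbd_add)
    moreover have "res {M..} v + res {M..} y = res {M..} x"
      by (auto simp: res_def v_def fun_eq_iff)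
    ultimately show ?thesis by simp
  qed
  then show ?case by blast
qed

text \<open>A crude triangle inequality over the \<open>n * M\<close> entries, adequate when
  \<open>d\<close> can be chosen after \<open>M\<close>.\<close>

lemma Zbd_small_coords:
  assumes "\<And>j i. n \<le> j \<Longrightarrow> x j i = 0" "\<And>j i. j < n \<Longrightarrow> i < M \<Longrightarrow> cmod (x j i) \<le> d" "0 \<le> d"
  shows "Zbd n (res {..<M} x) (real n * (real M * (shift_const n ^ n * d)))"
proof -
  \<comment> \<open>\<open>e j i\<close> is the array whose only entry is \<open>x j i\<close>,
    obtained from the jet of a constant function by \<open>j\<close> shifts.\<close>
  define e where "e = (\<lambda>j i. (shift n ^^ j) (jet n (\<lambda>z i'. if i' = i then x j i else 0)))"
  have "Zbd n (e j i) (shift_const n ^ n * d)" if "j < n" "i < M" for j i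
  proof -
    have "Zbd n (e j i) (shift_const n ^ j * cmod (x j i))"
      unfolding e_def by (intro Zbd_shift_power ZbdI[OF cald_bd_coordinate]) auto
    moreover have "shift_const n ^ j * cmod (x j i) \<le> shift_const n ^ n * d"
      using that assms(2,3) shift_const_ge_1[of n] by (intro mult_mono power_increasing) auto
    ultimately show ?thesis by (rule Zbd_mono)
  qed
  then have "Zbd n (\<Sum>j<n. \<Sum>i<M. e j i) (real n * (real M * (shift_const n ^ n * d)))"
    by (intro Zbd_sum)
  moreover have "(\<Sum>j<n. \<Sum>i<M. e j i) = res {..<M} x"
  proof (intro ext)
    fix j' i'
    show "(\<Sum>j<n. \<Sum>i<M. e j i) j' i' = res {..<M} x j' i'"
    proof -
      have e_eq: "e j i j' i' = (if j' = j \<and> i' = i \<and> j < n then x j i else 0)" for j i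
      proof -
        have "e j i = (\<lambda>j' i'. if j \<le> j' \<and> j' < n
            then jet n (\<lambda>z i'. if i' = i then x j i else 0) (j' - j) i' else 0)"
          unfolding e_def by (rule shift_power) (simp add: jet_def)
        then show ?thesis
          by (auto simp: jet_def tcoef_const)
      qed
      have "(\<Sum>j<n. \<Sum>i<M. e j i) j' i' = (\<Sum>j<n. \<Sum>i<M. if j' = j \<and> i' = i \<and> j < n then x j i else 0)"
        by (simp add: sum_arr_apply e_eq)
      also have "\<dots> = (\<Sum>j<n. if j' = j then (if i' < M then x j' i' else 0) else 0)"
        by (intro sum.cong refl) auto
      also have "\<dots> = (if j' < n \<and> i' < M then x j' i' else 0)"
        by auto
      finally show ?thesis
        using assms(1)[of j' i'] by (auto simp: res_def)
    qed
  qed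
  ultimately show ?thesis by metis
qed

section \<open>Disjointly supported elements\<close>

text \<open>The element is represented by \<open>N\<^bsup>-z\<^esup> (f\<^sub>0 + \<dots> + f\<^bsub>N-1\<^esub>)\<close>: disjointness gives the bound on \<open>Re z = 0\<close>,
  the factor \<open>N\<^bsup>-z\<^esup>\<close> the one on \<open>Re z = 1\<close>. Its expansion at \<open>1/2\<close> is where \<open>ln N\<close> comes from.\<close>
lemma Zbd_spread:
  fixes y :: "nat \<Rightarrow> arr"
  assumes N: "0 < N" and y: "\<And>l. l < N \<Longrightarrow> Zbd n (y l) K" and ord: "\<And>l. l < N \<Longrightarrow> ord_ge p (y l)"
    and supp: "\<And>l. l < N \<Longrightarrow> supp_in (A l) (y l)"
    and disj: "\<And>l l'. l < N \<Longrightarrow> l' < N \<Longrightarrow> l \<noteq> l' \<Longrightarrow> A l \<inter> A l' = {}"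
  shows "\<exists>H. Zbd n H K \<and> ord_ge (p + 2) (H - arr_scale (of_real (1 / sqrt N))
       ((\<Sum>l<N. y l) - arr_scale (of_real (ln N)) (shift n (\<Sum>l<N. y l))))"
proof -
  obtain f0 where f0: "\<And>l. l < N \<Longrightarrow> cald_bd (f0 l) K K" "\<And>l. l < N \<Longrightarrow> y l = jet n (f0 l)"
    using y unfolding Zbd_def by metis
  define f where "f = (\<lambda>l z i. if i \<in> A l then f0 l z i else 0)"
  have f: "cald_bd (f l) K K" if "l < N" for l
    unfolding f_def using cald_bd_restrict[OF f0(1)[OF that]] .
  have y_eq: "y l = jet n (f l)" if "l < N" for l
  proof -
    have "y l j i = jet n (f l) j i" for j i
      using f0(2)[OF that] supp[OF that]
      by (cases "i \<in> A l") (auto simp: f_def jet_def supp_in_def tcoef_const)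
    then show ?thesis by (simp add: fun_eq_iff)
  qed
  define F where "F = (\<lambda>z i. \<Sum>l<N. f l z i)"
  have F: "cald_bd F K (real N * K)"
    unfolding F_def by (rule cald_bd_disjoint_sum[where A = A]) (use f N disj in \<open>auto simp: f_def\<close>)
  define Y where "Y = (\<Sum>l<N. y l)"
  have Y: "Y = jet n F"
  proof -
    have "Y j i = jet n F j i" for j i
      using tcoef_sum[of N "\<lambda>l z. f l z i" j] cald_bdD(2)[OF f]
      by (simp add: Y_def sum_arr_apply y_eq jet_def F_def)
    then show ?thesis by (simp add: fun_eq_iff)
  qed
  have Y_ord: "Y q i = 0" if "q < p" for q i
    using ord that by (simp add: Y_def sum_arr_apply ord_ge_def)
  define L where "L = ln (real N)"
  have L: "0 \<le> L" using N by (simp add: L_def)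
  define h where "h = (\<lambda>z. exp (- complex_of_real L * z))"
  have h_norm: "cmod (h z) = exp (- L * Re z)" for z
    by (simp add: h_def)
  have h_hol: "h holomorphic_on X" for X
    unfolding h_def by (intro holomorphic_intros)
  have h_cont: "continuous_on X h" for X
    unfolding h_def by (intro continuous_intros)
  have "cald_bd (\<lambda>z i. h z * F z i) (1 * K) ((1 / N) * (real N * K))"
  proof (rule cald_bd_mult[OF F h_hol h_cont])
    show "cmod (h z) \<le> 1" if "z \<in> closed_strip" for z
      using that L by (simp add: h_norm closed_strip_def)
    show "cmod (h z) \<le> 1 / N" if "Re z = 1" for z
      using that N by (simp add: h_norm L_def exp_minus inverse_eq_divide)
  qed (simp add: h_norm)
  then have H: "Zbd n (jet n (\<lambda>z i. h z * F z i)) K"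
    using N by (intro ZbdI) auto
  have h0: "tcoef h 0 = of_real (1 / sqrt N)"
  proof -
    have "tcoef h 0 = of_real (exp (- (L / 2)))"
      by (simp add: tcoef_0 h_def exp_of_real[symmetric])
    also have "exp (- (L / 2)) = 1 / sqrt N"
    proof -
      have "exp (L / 2) = sqrt N"
        using N by (simp add: L_def ln_sqrt[symmetric])
      then show ?thesis by (simp add: exp_minus inverse_eq_divide)
    qed
    finally show ?thesis .
  qed
  have h1: "tcoef h 1 = - of_real L * tcoef h 0"
  proof -
    have "(h has_field_derivative (- of_real L * h (1/2))) (at (1/2))"
      unfolding h_def by (auto intro!: derivative_eq_intros)
    then show ?thesis
      by (simp add: tcoef_def DERIV_imp_deriv)
  qed
  \<comment> \<open>For \<open>q < p + 2\<close> the product formula retains only the terms with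
    \<open>tcoef h 0\<close> and \<open>tcoef h 1\<close>, since the others involve coefficients of
    \<open>F\<close> of index less than \<open>p\<close>. Up to sign, the logarithm is the ratio of
    these two.\<close>
  have main: "jet n (\<lambda>z i. h z * F z i) q i = of_real (1 / sqrt N) * (Y q i - of_real L * shift n Y q i)"
    if q: "q < p + 2" for q i
  proof (cases "q < n")
    case True
    have tF: "tcoef (\<lambda>z. F z i) r = Y r i" if "r \<le> q" for r
      using True that by (simp add: Y jet_def)
    have "tcoef (\<lambda>z. h z * F z i) q = (\<Sum>l\<le>q. tcoef h l * tcoef (\<lambda>z. F z i) (q - l))"
      by (rule tcoef_mult[OF h_hol cald_bdD(2)[OF F]])
    also have "\<dots> = (\<Sum>l\<in>{..q} \<inter> {0, 1}. tcoef h l * tcoef (\<lambda>z. F z i) (q - l))"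
    proof (rule sum.mono_neutral_right)
      show "\<forall>l\<in>{..q} - {..q} \<inter> {0, 1}. tcoef h l * tcoef (\<lambda>z. F z i) (q - l) = 0"
      proof
        fix l assume "l \<in> {..q} - {..q} \<inter> {0, 1}"
        then have "l \<noteq> 0" "l \<noteq> 1" "l \<le> q" by auto
        then have "q - l < p" using q by linarith
        then show "tcoef h l * tcoef (\<lambda>z. F z i) (q - l) = 0"
          using tF[of "q - l"] Y_ord by simp
      qed
    qed auto
    also have "\<dots> = tcoef h 0 * Y q i + (if q = 0 then 0 else tcoef h 1 * Y (q - 1) i)"
    proof (cases "q = 0")
      case True
      then show ?thesis using tF[of 0] by simp
    next
      case False
      then have "{..q} \<inter> {0, 1} = {0, 1}" by auto
      then show ?thesis using False tF[of q] tF[of "q - 1"] by simp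
    qed
    finally show ?thesis
      using True by (auto simp: jet_def shift_def h1[unfolded One_nat_def] h0 algebra_simps)
  next
    case False
    then show ?thesis by (simp add: jet_def shift_def Y)
  qed
  show ?thesis
  proof (intro exI conjI, rule H)
    show "ord_ge (p + 2) (jet n (\<lambda>z i. h z * F z i) - arr_scale (of_real (1 / sqrt N))
       ((\<Sum>l<N. y l) - arr_scale (of_real (ln N)) (shift n (\<Sum>l<N. y l))))"
      using main by (simp add: ord_ge_def arr_scale_def Y_def[symmetric] L_def[symmetric])
  qed
qed

text \<open>Disjointness turns the squared norm of the sum into the sum of the squared
  norms.\<close>

lemma disjoint_l2_lower:
  fixes a :: "nat \<Rightarrow> nat \<Rightarrow> complex"
  assumes supp: "\<And>l i. l < N \<Longrightarrow> i \<notin> A l \<Longrightarrow> a l i = 0" and fin: "\<And>l. l < N \<Longrightarrow> finite (A l)"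
    and disj: "\<And>l l'. l < N \<Longrightarrow> l' < N \<Longrightarrow> l \<noteq> l' \<Longrightarrow> A l \<inter> A l' = {}"
    and low: "\<And>l. l < N \<Longrightarrow> c \<le> (\<Sum>i\<in>A l. (cmod (a l i))\<^sup>2)"
  shows "real N * c \<le> (\<Sum>i\<in>(\<Union>l<N. A l). (cmod (\<Sum>l<N. a l i))\<^sup>2)"
proof -
  have "(\<Sum>i\<in>(\<Union>l<N. A l). (cmod (\<Sum>l<N. a l i))\<^sup>2) = (\<Sum>l<N. \<Sum>i\<in>A l. (cmod (\<Sum>l<N. a l i))\<^sup>2)"
    using fin disj by (intro sum.UNION_disjoint) auto
  also have "\<dots> = (\<Sum>l<N. \<Sum>i\<in>A l. (cmod (a l i))\<^sup>2)"
  proof (intro sum.cong refl)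
    fix l i assume l: "l \<in> {..<N}" "i \<in> A l"
    have "(\<Sum>l<N. a l i) = (\<Sum>l\<in>{l}. a l i)"
    proof (rule sum.mono_neutral_right)
      show "\<forall>j\<in>{..<N} - {l}. a j i = 0"
        using l supp disj by blast
    qed (use l in auto)
    then show "(cmod (\<Sum>l<N. a l i))\<^sup>2 = (cmod (a l i))\<^sup>2" by simp
  qed
  also have "\<dots> \<ge> (\<Sum>l<N. c)"
    using low by (intro sum_mono) auto
  finally show ?thesis by simp
qed

text \<open>Iterating a choice of \<open>M'\<close> makes each block start where the previous one
  ends.\<close>

lemma block_sequence:
  assumes "\<And>M::nat. \<exists>M' c. M < M' \<and> P M M' c"
  obtains m c where "\<And>l::nat. m l < m (Suc l)" "\<And>l. P (m l) (m (Suc l)) (c l)" "m 0 = M0"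
proof -
  obtain M' c' where *: "\<And>M. M < M' M \<and> P M (M' M) (c' M)"
    using assms by metis
  define m where "m = (\<lambda>l. (M' ^^ l) M0)"
  show thesis
    by (rule that[of m "\<lambda>l. c' (m l)"]) (use * in \<open>auto simp: m_def\<close>)
qed

lemma blocks_disjoint:
  assumes "\<And>l::nat. m l < (m (Suc l) :: nat)" "l \<noteq> l'"
  shows "{m l..<m (Suc l)} \<inter> {m l'..<m (Suc l')} = {}"
proof -
  have mono: "m a \<le> m b" if "a \<le> b" for a b
    by (rule lift_Suc_mono_le[OF _ that]) (use assms(1) less_imp_le in blast)
  have "m (Suc l) \<le> m l' \<or> m (Suc l') \<le> m l"
    using assms(2) by (cases "l < l'") (auto intro!: mono)
  then show ?thesis by auto
qed

section \<open>Infinite-dimensional subspaces\<close>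

definition inf_subspace :: "nat \<Rightarrow> arr set \<Rightarrow> bool" where
  "inf_subspace k Y \<longleftrightarrow> Y \<subseteq> Zsp k \<and> is_subspace Y \<and> \<not> finite_dim Y"

lemma arr_add_eq: "arr_add x y = x + y"
  by (simp add: arr_add_def fun_eq_iff)

lemma arr_zero_eq: "arr_zero = 0"
  by (simp add: arr_zero_def fun_eq_iff)

lemma subspace_closed:
  assumes "is_subspace Y"
  shows "0 \<in> Y" "x \<in> Y \<Longrightarrow> y \<in> Y \<Longrightarrow> x + y \<in> Y" "x \<in> Y \<Longrightarrow> arr_scale c x \<in> Y"
    "x \<in> Y \<Longrightarrow> y \<in> Y \<Longrightarrow> x - y \<in> Y"
proof -
  show *: "0 \<in> Y" "x \<in> Y \<Longrightarrow> y \<in> Y \<Longrightarrow> x + y \<in> Y" "x \<in> Y \<Longrightarrow> arr_scale c x \<in> Y" for x y c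
    using assms by (auto simp: is_subspace_def arr_add_eq arr_zero_eq)
  have eq: "x - y = x + arr_scale (-1) y"
    by (simp add: arr_scale_def fun_eq_iff)
  show "x \<in> Y \<Longrightarrow> y \<in> Y \<Longrightarrow> x - y \<in> Y"
    unfolding eq by (intro *)
qed

lemma subspace_sum:
  assumes "is_subspace Y" "\<And>l. l < N \<Longrightarrow> x l \<in> Y"
  shows "(\<Sum>l<(N::nat). x l) \<in> Y"
  using assms(2) by (induction N) (auto simp: subspace_closed[OF assms(1)])

text \<open>If a finite set spanned the kernel of the coordinate functional, one further vector off
  the kernel would complete it to a spanning set of \<open>Y\<close>.\<close>

lemma inf_subspace_hyperplane:
  assumes "inf_subspace k Y"
  shows "inf_subspace k {y \<in> Y. y j i = 0}"
proof -
  let ?Z = "{y \<in> Y. y j i = 0}"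
  have sub: "is_subspace Y" using assms by (simp add: inf_subspace_def)
  have "\<not> finite_dim ?Z"
  proof
    assume "finite_dim ?Z"
    then obtain B where B: "finite B" "B \<subseteq> ?Z"
      "\<And>y. y \<in> ?Z \<Longrightarrow> \<exists>c. y = (\<lambda>j i. \<Sum>b\<in>B. c b * b j i)"
      unfolding finite_dim_def by blast
    show False
    proof (cases "?Z = Y")
      case True
      then show False
        using \<open>finite_dim ?Z\<close> assms by (simp add: inf_subspace_def)
    next
      case False
      then obtain y0 where y0: "y0 \<in> Y" "y0 j i \<noteq> 0" by blast
      have "\<exists>c. y = (\<lambda>j i. \<Sum>b\<in>insert y0 B. c b * b j i)" if y: "y \<in> Y" for y
      proof -
        define t where "t = y j i / y0 j i"
        have "y - arr_scale t y0 \<in> Y"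
          using y y0(1) by (intro subspace_closed[OF sub])
        moreover have "(y - arr_scale t y0) j i = 0"
          using y0(2) by (simp add: arr_scale_def t_def)
        ultimately have "y - arr_scale t y0 \<in> ?Z" by blast
        then obtain c where c: "y - arr_scale t y0 = (\<lambda>j i. \<Sum>b\<in>B. c b * b j i)"
          using B(3) by blast
        have y0B: "y0 \<notin> B" using B(2) y0(2) by blast
        have "y j' i' = (\<Sum>b\<in>insert y0 B. (c(y0 := t)) b * b j' i')" for j' i'
        proof -
          have "(\<Sum>b\<in>B. (c(y0 := t)) b * b j' i') = (\<Sum>b\<in>B. c b * b j' i')"
            using y0B by (intro sum.cong) auto
          moreover have "y j' i' - t * y0 j' i' = (\<Sum>b\<in>B. c b * b j' i')"
            using fun_cong[OF fun_cong[OF c, of j'], of i'] by (simp add: arr_scale_def)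
          ultimately show ?thesis
            using B(1) y0B by (simp add: algebra_simps)
        qed
        then show ?thesis by blast
      qed
      then have "finite_dim Y"
        unfolding finite_dim_def using B(1,2) y0(1) by (intro exI[of _ "insert y0 B"]) auto
      then show False using assms by (simp add: inf_subspace_def)
    qed
  qed
  moreover have "is_subspace ?Z"
    using sub by (auto simp: is_subspace_def arr_add_def arr_scale_def arr_zero_def)
  ultimately show ?thesis
    using assms by (auto simp: inf_subspace_def)
qed

lemma inf_subspace_coordinates:
  assumes "inf_subspace k Y" "finite I"
  shows "inf_subspace k {y \<in> Y. \<forall>(j, i)\<in>I. y j i = 0}"
  using assms(2)
proof induction
  case empty
  then show ?case using assms(1) by simp
next
  case (insert q I)
  obtain j i where q: "q = (j, i)" by fastforce
  have "{y \<in> Y. \<forall>(j, i)\<in>insert q I. y j i = 0} = {y \<in> {y \<in> Y. \<forall>(j, i)\<in>I. y j i = 0}. y j i = 0}"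
    by (auto simp: q)
  then show ?case
    using inf_subspace_hyperplane[OF insert.IH] by simp
qed

text \<open>The scaled element has norm 2/3, strictly between 1/2 and 1, so neither bound depends on
  whether the infimum is attained.\<close>

lemma Zbd_normalize:
  assumes "x \<in> Zsp k" "Znorm k x = t" "0 < t"
  defines "y \<equiv> arr_scale (of_real (1 / (3 / 2 * t))) x"
  shows "Zbd k y 1" "\<not> Zbd k y (1/2)"
proof -
  have "Zbd k x (3 / 2 * t)"
    using assms by (intro Znorm_less_imp_Zbd) auto
  then have "Zbd k y (cmod (of_real (1 / (3 / 2 * t))) * (3 / 2 * t))"
    unfolding y_def by (rule Zbd_scale)
  then show "Zbd k y 1"
    using assms(3) by (simp add: norm_divide norm_mult)
  show "\<not> Zbd k y (1/2)"
  proof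
    assume "Zbd k y (1/2)"
    then have "Zbd k (arr_scale (of_real (3 / 2 * t)) y) (cmod (of_real (3 / 2 * t)) * (1/2))"
      by (rule Zbd_scale)
    moreover have "arr_scale (of_real (3 / 2 * t)) y = x"
      using assms(3) by (simp add: y_def arr_scale_def fun_eq_iff)
    ultimately have "Zbd k x (3 / 4 * t)"
      using assms(3) by (simp add: norm_mult)
    then show False using Znorm_le assms(2,3) by fastforce
  qed
qed

lemma inf_subspace_normalized:
  assumes "inf_subspace k Y"
  obtains y where "y \<in> Y" "Zbd k y 1" "\<not> Zbd k y (1/2)"
proof -
  have sub: "is_subspace Y" using assms by (simp add: inf_subspace_def)
  have "\<exists>x\<in>Y. x \<noteq> 0"
  proof (rule ccontr)
    assume "\<not> (\<exists>x\<in>Y. x \<noteq> 0)"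
    then have "finite_dim Y"
      unfolding finite_dim_def by (intro exI[of _ "{}"]) (auto simp: fun_eq_iff)
    then show False using assms by (simp add: inf_subspace_def)
  qed
  then obtain x where x: "x \<in> Y" "x \<noteq> 0" by blast
  then have Z: "x \<in> Zsp k" using assms by (auto simp: inf_subspace_def)
  have "Znorm k x \<noteq> 0"
    using x(2) Zbd_all_imp_zero[of k x] Znorm_less_imp_Zbd[OF Z] by auto
  then have "0 < Znorm k x"
    using Znorm_nonneg[OF Z] by simp
  then show thesis
    using Zbd_normalize[OF Z refl] that subspace_closed(3)[OF sub x(1)] by blast
qed

text \<open>This says that \<open>\<pi>\<^bsub>k,i\<^esub>\<close> is not bounded below on any infinite-dimensional subspace; the
  bounds \<open>1\<close> and \<open>1/2\<close> stand for a normalization of \<open>y\<close>.\<close>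
definition small_proj :: "nat \<Rightarrow> nat \<Rightarrow> bool" where
  "small_proj k i \<longleftrightarrow> (\<forall>Y. inf_subspace k Y \<longrightarrow> (\<forall>e>0. \<exists>y\<in>Y. Zbd k y 1 \<and> \<not> Zbd k y (1/2) \<and> Zbd i (proj k i y) e))"

lemma small_proj_0: "small_proj k 0"
proof -
  have "Zbd 0 (proj k 0 y) e" if "e > 0" for y e
  proof -
    have "proj k 0 y = 0" by (simp add: proj_def fun_eq_iff)
    then show ?thesis using Zbd_mono[OF Zbd_zero, of e 0] that by simp
  qed
  then show ?thesis
    unfolding small_proj_def using inf_subspace_normalized by metis
qed

text \<open>Gliding hump. A vector with small projection is found in the subspace of finite
  codimension vanishing on the coordinates below \<open>M\<close>. Cutting off its tail and
  subtracting a lift of its projection costs at most \<open>d\<close>.\<close>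

lemma small_proj_block:
  assumes sp: "small_proj k i" and ik: "i \<le> k" and Y: "inf_subspace k Y" and d: "0 < d"
  shows "\<exists>M' y y'. M < M' \<and> y \<in> Y \<and> Zbd k y 1 \<and> \<not> Zbd k y (1/2) \<and> ord_ge i y' \<and>
    supp_in {M..<M'} y' \<and> Zbd k (y - y') d \<and> Zbd k y' (1 + d)"
proof -
  define Y' where "Y' = {y \<in> Y. \<forall>(j, i)\<in>{..<k} \<times> {..<M}. y j i = 0}"
  have "inf_subspace k Y'"
    unfolding Y'_def by (rule inf_subspace_coordinates[OF Y]) simp
  moreover have "d / 4 > 0" using d by simp
  ultimately obtain y where y: "y \<in> Y'" "Zbd k y 1" "\<not> Zbd k y (1/2)" "Zbd i (proj k i y) (d / 4)"
    using sp unfolding small_proj_def by blast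
  have y_low: "y j i = 0" if "i < M" for j i
    using y(1) Zbd_high[OF y(2), of j i] that by (cases "j < k") (auto simp: Y'_def)
  obtain M1 where M1: "\<And>M'. M' \<ge> M1 \<Longrightarrow> Zbd k (res {M'..} y) (d / 2)"
    using Zbd_tail[OF y(2), of "d / 2"] d by auto
  define M' where "M' = max M1 (Suc M)"
  define A where "A = {M..<M'}"
  have "Zbd i (res A (proj k i y)) (d / 4)"
    by (rule Zbd_res[OF y(4)])
  moreover have "supp_in A (res A (proj k i y))"
    by (simp add: supp_in_def res_def)
  \<comment> \<open>The lift keeps its support in \<open>A\<close>, so subtracting it removes the
    coefficients below \<open>i\<close> without spoiling disjointness.\<close>
  ultimately obtain g where g: "Zbd k g (d / 4)" "proj k i g = res A (proj k i y)" "supp_in A g"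
    using Zbd_lift[OF _ ik] by blast
  define y' where "y' = res A y - g"
  have "ord_ge i y'"
    unfolding ord_ge_def
  proof (intro allI impI)
    fix q l assume "q < i"
    then have "g q l = res A y q l"
      using fun_cong[OF fun_cong[OF g(2), of q], of l] by (simp add: proj_def res_def)
    then show "y' q l = 0" by (simp add: y'_def)
  qed
  moreover have "supp_in A y'"
    using g(3) by (simp add: supp_in_def y'_def res_def)
  moreover have yy: "Zbd k (y - y') d"
  proof -
    have "y - y' = res {M'..} y + g"
      using y_low by (auto simp: fun_eq_iff y'_def res_def A_def not_le)
    moreover have "Zbd k (res {M'..} y + g) (d / 2 + d / 4)"
      by (intro Zbd_add g(1) M1) (simp add: M'_def)
    ultimately show ?thesis
      using Zbd_mono[of k _ "d / 2 + d / 4" d] d by simp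
  qed
  moreover have "Zbd k y' (1 + d)"
    using Zbd_diff[OF y(2) yy] by simp
  moreover have "y \<in> Y" using y(1) by (simp add: Y'_def)
  ultimately show ?thesis
    using y(2,3) unfolding A_def by (intro exI[of _ M'] exI[of _ y] exI[of _ y']) (simp add: M'_def)
qed

text \<open>Projecting to length \<open>Suc i\<close> leaves only the coefficient of index
  \<open>i\<close>; jets with only this top coefficient form a copy of l2.\<close>

lemma Zbd_proj_lead:
  assumes "ord_ge i x" "l2_le (x i) K"
  shows "Zbd (Suc i) (proj k (Suc i) x) (2 * shift_const (Suc i) ^ i * K)"
proof -
  obtain w where w: "Zbd (Suc i) w (2 * shift_const (Suc i) ^ i * K)" "ord_ge i w" "w i = x i"
    using Zbd_build[OF assms(2) lessI] by blast
  have "w j l = proj k (Suc i) x j l" for j l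
    using w(2,3) assms(1) Zbd_high[OF w(1), of j l]
    by (cases j i rule: linorder_cases) (auto simp: proj_def ord_ge_def)
  then have "w = proj k (Suc i) x" by (simp add: fun_eq_iff)
  then show ?thesis using w(1) by simp
qed

lemma proj_add: "proj k i (x + y) = proj k i x + proj k i y"
  by (simp add: proj_def fun_eq_iff)

lemma proj_scale: "proj k i (arr_scale c x) = arr_scale c (proj k i x)"
  by (simp add: proj_def arr_scale_def fun_eq_iff)

text \<open>For error terms no disjointness is available; the triangle inequality suffices once
  \<open>real N * d\<close> is small.\<close>

lemma sqrt_scale_sum_Zbd:
  assumes "0 < N" "\<And>l. l < N \<Longrightarrow> Zbd n (x l) d" "0 \<le> d" "real N * d \<le> e"
  shows "Zbd n (arr_scale (of_real (1 / sqrt N)) (\<Sum>l<N. x l)) e"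
proof -
  have "Zbd n (arr_scale (of_real (1 / sqrt N)) (\<Sum>l<N. x l)) (cmod (of_real (1 / sqrt N)) * (real N * d))"
    by (intro Zbd_scale Zbd_sum assms(2))
  moreover have "cmod (of_real (1 / sqrt N)) * (real N * d) \<le> 1 * (real N * d)"
    using assms(1,3) by (intro mult_right_mono) (auto simp: norm_divide divide_le_eq)
  ultimately show ?thesis
    using assms(4) Zbd_mono[of n _ _ e] by simp
qed

section \<open>The quotient maps are strictly singular\<close>

text \<open>Extends the normalized implication \<open>low\<close> to all scales: if the norm
  exceeded \<open>K / e\<close>, the normalized vector would contradict \<open>low\<close>. The
  factor 2 gives the strict inequality needed for a representing function.\<close>

lemma bounded_below_proj:
  assumes sub: "is_subspace Y" "Y \<subseteq> Zsp k" and e: "0 < e"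
    and low: "\<And>y. y \<in> Y \<Longrightarrow> Zbd k y 1 \<Longrightarrow> Zbd i (proj k i y) e \<Longrightarrow> Zbd k y (1/2)"
    and y: "y \<in> Y" and K: "0 < K" "Zbd i (proj k i y) K"
  shows "Zbd k y (2 * K / e)"
proof -
  define t where "t = Znorm k y"
  have Z: "y \<in> Zsp k" using y sub(2) by blast
  have "t \<le> K / e"
  proof (rule ccontr)
    assume "\<not> t \<le> K / e"
    then have t: "K < e * t" using e by (simp add: field_simps)
    moreover have "0 < e * t" using t K by linarith
    ultimately have tpos: "0 < t" using e by (simp add: zero_less_mult_iff)
    define y1 where "y1 = arr_scale (of_real (1 / (3 / 2 * t))) y"
    have "Zbd k y1 1" "\<not> Zbd k y1 (1/2)"
      using Zbd_normalize[OF Z _ tpos] by (auto simp: t_def y1_def)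
    moreover have "y1 \<in> Y"
      unfolding y1_def by (rule subspace_closed(3)[OF sub(1) y])
    moreover have "Zbd i (proj k i y1) e"
      unfolding y1_def proj_scale
    proof (rule Zbd_weaken_scale[OF K(2)])
      have "K \<le> e * (3 / 2 * t)"
        using t \<open>0 < e * t\<close> by linarith
      then show "cmod (of_real (1 / (3 / 2 * t))) * K \<le> e"
        using tpos by (simp add: norm_divide norm_mult field_simps)
    qed
    ultimately show False using low by blast
  qed
  moreover have "0 < K / e" using K e by simp
  ultimately have "t < 2 * K / e" by simp
  then show ?thesis
    using Z unfolding t_def by (rule Znorm_less_imp_Zbd[rotated])
qed

text \<open>If the projection to length \<open>Suc i\<close> were bounded below on \<open>Y\<close>,
  then \<open>arr_scale a S\<close> would have a bound independent of \<open>N\<close>, because its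
  projection does. Subtracting the bounded element \<open>H\<close> from
  \<open>arr_scale a S'\<close> cancels the coefficient of index \<open>i\<close> and exposes
  \<open>ln N\<close> times it at index \<open>Suc i\<close>.\<close>

lemma small_proj_Suc:
  assumes sp: "small_proj k i" and ik: "Suc i < k"
  shows "small_proj k (Suc i)"
  unfolding small_proj_def
proof (intro allI impI, rule ccontr)
  fix Y and e :: real
  assume Y: "inf_subspace k Y" and e: "0 < e"
    and "\<not> (\<exists>y\<in>Y. Zbd k y 1 \<and> \<not> Zbd k y (1 / 2) \<and> Zbd (Suc i) (proj k (Suc i) y) e)"
  then have low: "\<And>y. y \<in> Y \<Longrightarrow> Zbd k y 1 \<Longrightarrow> Zbd (Suc i) (proj k (Suc i) y) e \<Longrightarrow> Zbd k y (1/2)"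
    by blast
  have sub: "is_subspace Y" "Y \<subseteq> Zsp k"
    using Y by (auto simp: inf_subspace_def)
  have below: "Zbd k y (2 * K / e)" if "y \<in> Y" "0 < K" "Zbd (Suc i) (proj k (Suc i) y) K" for y K
    using bounded_below_proj[OF sub e low that] .
  define C where "C = 2 * shift_const (Suc i) ^ i"
  have C: "C \<ge> 1"
    using one_le_power[OF shift_const_ge_1[of "Suc i"], of i] by (simp add: C_def)
  \<comment> \<open>Then \<open>C * \<kappa> = e / 8\<close>, and with \<open>d \<le> e / 8\<close>
    the estimate \<open>below\<close> yields the bound 1/2 that the chosen vectors violate.\<close>
  define \<kappa> where "\<kappa> = e / (8 * C)"
  have \<kappa>: "\<kappa> > 0" using e C by (simp add: \<kappa>_def)
  \<comment> \<open>The bound that \<open>below\<close> gives for \<open>arr_scale a S\<close>: the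
    projection of the main part contributes \<open>C * 2 ^ Suc i\<close>, the error terms 1.\<close>
  define K1 where "K1 = 2 * (C * 2 ^ Suc i + 1) / e"
  have K1: "0 < K1" using C e by (simp add: K1_def add_pos_pos)
  obtain N :: nat where N: "N > 0" "2 ^ Suc i * (K1 + 3) < ln N * \<kappa>"
  proof -
    define c where "c = 2 ^ Suc i * (K1 + 3) / \<kappa>"
    obtain N :: nat where N: "exp c < real N" using reals_Archimedean2 by blast
    then have "0 < real N" using exp_gt_zero[of c] by linarith
    then have "c < ln N" using N by (metis exp_less_cancel_iff exp_ln)
    then show thesis
      using that[of N] \<open>0 < real N\<close> \<kappa> by (simp add: c_def field_simps)
  qed
  \<comment> \<open>The first choice keeps the sum of the \<open>N\<close> errors bounded by 1; the
    second serves the lower bound \<open>\<kappa>\<close>.\<close>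
  define d where "d = min (1 / N) (e / 8)"
  have d: "0 < d" "real N * d \<le> 1" "d \<le> e / 8" "d \<le> 1"
  proof -
    have "real N * d \<le> real N * (1 / N)"
      unfolding d_def by (intro mult_left_mono) auto
    then show "real N * d \<le> 1" using N(1) by simp
    have "1 / real N \<le> 1" using N(1) by simp
    then show "d \<le> 1" unfolding d_def by linarith
  qed (use N e in \<open>auto simp: d_def\<close>)
  define P where "P = (\<lambda>M M' (y, y'). y \<in> Y \<and> Zbd k y 1 \<and> \<not> Zbd k y (1/2) \<and> ord_ge i y' \<and>
    supp_in {M..<M'} y' \<and> Zbd k (y - y') d \<and> Zbd k y' (1 + d))"
  have "\<exists>M' c. M < M' \<and> P M M' c" for M
    using small_proj_block[OF sp _ Y d(1), of M] ik unfolding P_def by auto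
  then obtain m c where m: "\<And>l::nat. m l < m (Suc l)" and P: "\<And>l. P (m l) (m (Suc l)) (c l)"
    using block_sequence[of P] by metis
  define A where "A = (\<lambda>l. {m l..<m (Suc l)})"
  define y where "y = (\<lambda>l. fst (c l))"
  define y' where "y' = (\<lambda>l. snd (c l))"
  have y: "y l \<in> Y" "Zbd k (y l) 1" "\<not> Zbd k (y l) (1/2)" "ord_ge i (y' l)" "supp_in (A l) (y' l)"
    "Zbd k (y l - y' l) d" "Zbd k (y' l) (1 + d)" for l
    using P[of l] by (auto simp: P_def y_def y'_def A_def split: prod.splits)
  have disj: "A l \<inter> A l' = {}" if "l \<noteq> l'" for l l'
    unfolding A_def using m that by (rule blocks_disjoint)
  have big: "\<kappa>\<^sup>2 \<le> (\<Sum>j\<in>A l. (cmod (y' l i j))\<^sup>2)" for l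
  proof (rule ccontr)
    assume small: "\<not> \<kappa>\<^sup>2 \<le> (\<Sum>j\<in>A l. (cmod (y' l i j))\<^sup>2)"
    have "l2_le (y' l i) \<kappa>"
      using \<kappa> small y(5)[of l]
      by (intro l2_le_finite_support[of "A l"]) (auto simp: A_def supp_in_def)
    then have "Zbd (Suc i) (proj k (Suc i) (y' l)) (C * \<kappa>)"
      unfolding C_def using y(4) by (intro Zbd_proj_lead)
    moreover have "Zbd (Suc i) (proj k (Suc i) (y l - y' l)) d"
      using ik by (intro Zbd_proj[OF y(6)]) simp
    ultimately have "Zbd (Suc i) (proj k (Suc i) (y' l) + proj k (Suc i) (y l - y' l)) (C * \<kappa> + d)"
      by (rule Zbd_add)
    moreover have "y' l + (y l - y' l) = y l"
      by (simp add: fun_eq_iff)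
    ultimately have "Zbd (Suc i) (proj k (Suc i) (y l)) (C * \<kappa> + d)"
      by (metis proj_add)
    then have "Zbd k (y l) (2 * (C * \<kappa> + d) / e)"
      using d \<kappa> C by (intro below y) (auto intro!: add_nonneg_pos)
    moreover have "2 * (C * \<kappa> + d) / e \<le> 1/2"
      using d(3) e C by (simp add: \<kappa>_def field_simps)
    ultimately show False
      using y(3) Zbd_mono by blast
  qed
  define a where "a = complex_of_real (1 / sqrt N)"
  have a2: "(cmod a)\<^sup>2 = 1 / N"
    using N by (simp add: a_def norm_divide power_divide)
  define S where "S = (\<Sum>l<N. y l)"
  define S' where "S' = (\<Sum>l<N. y' l)"
  have "\<exists>H. Zbd k H (1 + d) \<and>
      ord_ge (i + 2) (H - arr_scale a (S' - arr_scale (of_real (ln N)) (shift k S')))"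
    unfolding a_def S'_def by (rule Zbd_spread[where A = A]) (use N(1) y disj in auto)
  then obtain H where H: "Zbd k H (1 + d)"
    "ord_ge (i + 2) (H - arr_scale a (S' - arr_scale (of_real (ln N)) (shift k S')))"
    by blast
  have S'_ord: "S' q j = 0" if "q < i" for q j
    using y(4) that by (simp add: S'_def sum_arr_apply ord_ge_def)
  have H_low: "H q j = a * (S' q j - of_real (ln N) * shift k S' q j)" if "q < i + 2" for q j
    using H(2) that by (simp add: ord_ge_def arr_scale_def)
  have H_i: "H i j = a * S' i j" for j
    using H_low[of i j] S'_ord ik by (auto simp: shift_def)
  have H_ord: "ord_ge i H"
    using H_low S'_ord by (auto simp: ord_ge_def shift_def)
  \<comment> \<open>\<open>H i\<close> is also the coefficient of index \<open>i\<close> of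
    \<open>arr_scale a S'\<close>, so the spread bounds the latter in l2 independently of
    \<open>N\<close>.\<close>
  have "l2_le (H i) (2 ^ i * (1 + d))"
    using Zbd_lead[OF H(1) H_ord] ik by simp
  moreover have "2 ^ i * (1 + d) \<le> 2 ^ Suc i"
    using d(4) by simp
  ultimately have "l2_le (H i) (2 ^ Suc i)"
    by (rule l2_le_mono)
  moreover have "H i = arr_scale a S' i"
    by (simp add: fun_eq_iff arr_scale_def H_i)
  ultimately have "l2_le (arr_scale a S' i) (2 ^ Suc i)"
    by (simp only:)
  moreover have "ord_ge i (arr_scale a S')"
    using S'_ord by (simp add: ord_ge_def arr_scale_def)
  ultimately have lead: "Zbd (Suc i) (proj k (Suc i) (arr_scale a S')) (C * 2 ^ Suc i)"
    unfolding C_def by (intro Zbd_proj_lead)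
  have diff: "Zbd k (arr_scale a (\<Sum>l<N. y l - y' l)) 1"
    unfolding a_def using d(1,2) by (intro sqrt_scale_sum_Zbd[OF N(1) y(6)]) auto
  have split: "arr_scale a S = arr_scale a S' + arr_scale a (\<Sum>l<N. y l - y' l)"
    by (simp add: fun_eq_iff arr_scale_def S_def S'_def sum_arr_apply sum_subtractf algebra_simps)
  have "Zbd (Suc i) (proj k (Suc i) (arr_scale a S)) (C * 2 ^ Suc i + 1)"
    unfolding split proj_add using ik by (intro Zbd_add lead Zbd_proj[OF diff]) simp
  moreover have "arr_scale a S \<in> Y"
    unfolding S_def by (intro subspace_closed(3)[OF sub(1)] subspace_sum[OF sub(1)] y)
  ultimately have "Zbd k (arr_scale a S) K1"
    unfolding K1_def using C by (intro below) (auto intro!: add_nonneg_pos)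
  then have "Zbd k (arr_scale a S - arr_scale a (\<Sum>l<N. y l - y' l)) (K1 + 1)"
    using diff by (rule Zbd_diff)
  moreover have "arr_scale a S - arr_scale a (\<Sum>l<N. y l - y' l) = arr_scale a S'"
    by (simp add: split)
  ultimately have "Zbd k (arr_scale a S') (K1 + 1)" by simp
  then have E: "Zbd k (arr_scale a S' - H) (K1 + 1 + (1 + d))"
    using H(1) by (rule Zbd_diff)
  have E_ord: "ord_ge (Suc i) (arr_scale a S' - H)"
    unfolding ord_ge_def
  proof (intro allI impI)
    fix q j assume "q < Suc i"
    then consider "q < i" | "q = i" by linarith
    then show "(arr_scale a S' - H) q j = 0"
      using H_ord S'_ord[of q j] H_i[of j] by cases (auto simp: ord_ge_def arr_scale_def)
  qed
  have E_lead: "(arr_scale a S' - H) (Suc i) j = of_real (ln N) * (a * S' i j)" for j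
    using H_low[of "Suc i" j] ik by (simp add: arr_scale_def shift_def algebra_simps)
  define U where "U = (\<Union>l<N. A l)"
  have U: "finite U" by (simp add: U_def A_def)
  have "l2_le ((arr_scale a S' - H) (Suc i)) (2 ^ Suc i * (K1 + 1 + (1 + d)))"
    using Zbd_lead[OF E E_ord ik] .
  then have "(\<Sum>j\<in>U. (cmod (of_real (ln N) * (a * S' i j)))\<^sup>2) \<le> (2 ^ Suc i * (K1 + 1 + (1 + d)))\<^sup>2"
    using U unfolding l2_le_def E_lead by blast
  also have "\<dots> \<le> (2 ^ Suc i * (K1 + 3))\<^sup>2"
    using K1 d by (intro power_mono mult_left_mono mult_nonneg_nonneg) auto
  finally have upper: "(\<Sum>j\<in>U. (cmod (of_real (ln N) * (a * S' i j)))\<^sup>2) \<le> (2 ^ Suc i * (K1 + 3))\<^sup>2" .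
  have "real N * \<kappa>\<^sup>2 \<le> (\<Sum>j\<in>U. (cmod (\<Sum>l<N. y' l i j))\<^sup>2)"
    unfolding U_def using y(5) big disj
    by (intro disjoint_l2_lower) (auto simp: supp_in_def A_def)
  then have "\<kappa>\<^sup>2 \<le> (cmod a)\<^sup>2 * (\<Sum>j\<in>U. (cmod (S' i j))\<^sup>2)"
    using N(1) by (simp add: a2 S'_def sum_arr_apply field_simps)
  then have "(ln N)\<^sup>2 * \<kappa>\<^sup>2 \<le> (ln N)\<^sup>2 * ((cmod a)\<^sup>2 * (\<Sum>j\<in>U. (cmod (S' i j))\<^sup>2))"
    by (rule mult_left_mono) simp
  also have "\<dots> = (\<Sum>j\<in>U. (cmod (of_real (ln N) * (a * S' i j)))\<^sup>2)"
    by (simp add: norm_mult power_mult_distrib sum_distrib_left)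
  finally have "(ln N * \<kappa>)\<^sup>2 \<le> (2 ^ Suc i * (K1 + 3))\<^sup>2"
    using upper by (simp add: power_mult_distrib)
  then have "ln N * \<kappa> \<le> 2 ^ Suc i * (K1 + 3)"
    by (rule power2_le_imp_le) (use K1 in simp)
  then show False using N(2) by linarith
qed

lemma small_proj_less: "i < k \<Longrightarrow> small_proj k i"
  by (induction i) (auto intro: small_proj_0 small_proj_Suc)

section \<open>Upper triangular operators\<close>

lemma Zsp_closed:
  "x \<in> Zsp n \<Longrightarrow> y \<in> Zsp n \<Longrightarrow> x + y \<in> Zsp n"
  "x \<in> Zsp n \<Longrightarrow> y \<in> Zsp n \<Longrightarrow> x - y \<in> Zsp n"
  "x \<in> Zsp n \<Longrightarrow> arr_scale c x \<in> Zsp n"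
  "x \<in> Zsp n \<Longrightarrow> shift n x \<in> Zsp n"
  "x \<in> Zsp n \<Longrightarrow> (shift n ^^ b) x \<in> Zsp n"
  "x \<in> Zsp n \<Longrightarrow> res A x \<in> Zsp n"
  "0 \<in> Zsp n"
  unfolding Zsp_iff_Zbd
  by (elim exE, rule exI, erule (1) Zbd_add)
    (elim exE, rule exI, erule (1) Zbd_diff, elim exE, rule exI, erule Zbd_scale,
      elim exE, rule exI, erule Zbd_shift, elim exE, rule exI, erule Zbd_shift_power,
      elim exE, rule exI, erule Zbd_res, rule exI, rule Zbd_zero)

lemma Zsp_sum: "(\<And>l. l < N \<Longrightarrow> x l \<in> Zsp n) \<Longrightarrow> (\<Sum>l<(N::nat). x l) \<in> Zsp n"
proof (induction N)
  case 0
  show ?case by (simp only: lessThan_0 sum.empty Zsp_closed)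
next
  case (Suc N)
  then have "(\<Sum>l<N. x l) + x N \<in> Zsp n"
    by (intro Zsp_closed) auto
  then show ?case by (simp only: sum.lessThan_Suc)
qed

lemma shift_add: "shift n (x + y) = shift n x + shift n y"
  by (simp add: shift_def fun_eq_iff)

lemma shift_diff: "shift n (x - y) = shift n x - shift n y"
  by (simp add: shift_def fun_eq_iff)

lemma shift_scale: "shift n (arr_scale c x) = arr_scale c (shift n x)"
  by (simp add: shift_def arr_scale_def fun_eq_iff)

lemma shift_sum: "shift n (\<Sum>l<(N::nat). x l) = (\<Sum>l<N. shift n (x l))"
  by (simp add: shift_def fun_eq_iff sum_arr_apply)

lemma shift_power_linear:
  "(shift n ^^ b) (x + y) = (shift n ^^ b) x + (shift n ^^ b) y"
  "(shift n ^^ b) (x - y) = (shift n ^^ b) x - (shift n ^^ b) y"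
  "(shift n ^^ b) (arr_scale c x) = arr_scale c ((shift n ^^ b) x)"
  "(shift n ^^ b) (\<Sum>l<(N::nat). v l) = (\<Sum>l<N. (shift n ^^ b) (v l))"
  by (induction b) (simp_all only: funpow.simps comp_def id_def shift_add shift_diff shift_scale shift_sum)

lemma ord_ge_shift: "ord_ge p x \<Longrightarrow> ord_ge (Suc p) (shift n x)"
  by (auto simp: ord_ge_def shift_def)

lemma ord_ge_shift_power: "ord_ge p x \<Longrightarrow> ord_ge (p + b) ((shift n ^^ b) x)"
  by (induction b) (auto intro: ord_ge_shift)

lemma supp_in_shift_power: "supp_in A x \<Longrightarrow> supp_in A ((shift n ^^ b) x)"
  by (induction b) (auto simp: supp_in_def shift_def)

lemma ord_ge_sum: "(\<And>l. l < N \<Longrightarrow> ord_ge p (x l)) \<Longrightarrow> ord_ge p (\<Sum>l<(N::nat). x l)"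
  by (simp add: ord_ge_def sum_arr_apply)

locale upper_tri =
  fixes n :: nat and R :: "arr \<Rightarrow> arr"
  assumes ut: "upper_triangular n R"
begin

lemma R_Zsp: "x \<in> Zsp n \<Longrightarrow> R x \<in> Zsp n"
  using ut unfolding upper_triangular_def bounded_op_def by blast

lemma R_add: "x \<in> Zsp n \<Longrightarrow> y \<in> Zsp n \<Longrightarrow> R (x + y) = R x + R y"
  using ut unfolding upper_triangular_def bounded_op_def arr_add_eq by blast

lemma R_scale: "x \<in> Zsp n \<Longrightarrow> R (arr_scale c x) = arr_scale c (R x)"
  using ut unfolding upper_triangular_def bounded_op_def by blast

lemma R_diff:
  assumes "x \<in> Zsp n" "y \<in> Zsp n"
  shows "R (x - y) = R x - R y"
proof -
  have eq: "u - v = u + arr_scale (-1) v" for u v :: arr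
    by (simp add: fun_eq_iff arr_scale_def)
  show ?thesis
    unfolding eq using assms by (simp only: R_add R_scale Zsp_closed)
qed

lemma R_zero: "R 0 = 0"
proof -
  have "arr_scale 0 (0 :: arr) = 0" "arr_scale 0 (R 0) = 0"
    by (simp_all add: arr_scale_def fun_eq_iff)
  then show ?thesis
    using R_scale[of 0 0] Zsp_closed(7) by metis
qed

lemma R_sum:
  assumes "\<And>l. l < N \<Longrightarrow> x l \<in> Zsp n"
  shows "R (\<Sum>l<(N::nat). x l) = (\<Sum>l<N. R (x l))"
  using assms
proof (induction N)
  case 0
  show ?case by (simp only: lessThan_0 sum.empty R_zero)
next
  case (Suc N)
  have "R ((\<Sum>l<N. x l) + x N) = R (\<Sum>l<N. x l) + R (x N)"
    using Suc.prems by (intro R_add Zsp_sum) auto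
  moreover have "R (\<Sum>l<N. x l) = (\<Sum>l<N. R (x l))"
    using Suc by simp
  ultimately show ?case
    by (simp only: sum.lessThan_Suc)
qed

text \<open>The strict inequality needed to pass from \<open>Znorm\<close> to \<open>Zbd\<close> is
  bought by the constant \<open>\<bar>C\<bar> + 1\<close> together with
  \<open>0 < K\<close>.\<close>

lemma R_bound:
  obtains C where "1 \<le> C" "\<And>x K. 0 < K \<Longrightarrow> Zbd n x K \<Longrightarrow> Zbd n (R x) (C * K)"
proof -
  obtain C where C: "\<And>x. x \<in> Zsp n \<Longrightarrow> Znorm n (R x) \<le> C * Znorm n x"
    using ut unfolding upper_triangular_def bounded_op_def by blast
  have "Zbd n (R x) ((\<bar>C\<bar> + 1) * K)" if K: "0 < K" and x: "Zbd n x K" for x K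
  proof -
    have Z: "x \<in> Zsp n" using x Zsp_iff_Zbd by blast
    have "Znorm n (R x) \<le> C * Znorm n x" by (rule C[OF Z])
    also have "\<dots> \<le> \<bar>C\<bar> * K"
      using Znorm_le[OF x] Znorm_nonneg[OF Z] by (intro mult_mono) auto
    also have "\<dots> < (\<bar>C\<bar> + 1) * K" using K by (simp add: distrib_right)
    finally show ?thesis
      using R_Zsp[OF Z] Znorm_less_imp_Zbd by blast
  qed
  then show thesis by (intro that[of "\<bar>C\<bar> + 1"]) auto
qed

text \<open>For \<open>1 \<le> p\<close> and \<open>p < n\<close> the arrays in question are the
  range of the embedding of length \<open>n - p\<close>, so this is upper triangularity itself; for
  \<open>p \<ge> n\<close> only the zero array qualifies.\<close>

lemma R_ord:
  assumes x: "x \<in> Zsp n" and ord: "ord_ge p x"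
  shows "ord_ge p (R x)"
proof (cases "1 \<le> p \<and> p < n")
  case True
  obtain K where K: "Zbd n x K" using x Zsp_iff_Zbd by blast
  then have "Zbd (n - p + p) x K" using True by simp
  then have "(\<lambda>j. x (j + p)) \<in> Zsp (n - p)"
    unfolding Zsp_iff_Zbd using Zbd_divide ord by blast
  moreover have "x j i = emb (n - p) n (\<lambda>j. x (j + p)) j i" for j i
  proof -
    have "n - (n - p) = p" using True by simp
    then show ?thesis
      using ord Zbd_high[OF K, of j i] by (auto simp: emb_def ord_ge_def not_le not_less)
  qed
  then have "x = emb (n - p) n (\<lambda>j. x (j + p))" by blast
  moreover have "1 \<le> n - p \<and> n - p < n" using True by auto
  ultimately have "R x \<in> emb (n - p) n ` Zsp (n - p)"
    using ut unfolding upper_triangular_def by metis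
  then show ?thesis
    using True by (auto simp: ord_ge_def emb_def)
next
  case False
  show ?thesis
  proof (cases "p = 0")
    case True
    then show ?thesis by (simp add: ord_ge_def)
  next
    case p: False
    obtain K where K: "Zbd n x K" using x Zsp_iff_Zbd by blast
    have "x j i = 0" for j i
      using Zbd_high[OF K, of j i] ord p False by (cases "j < n") (auto simp: ord_ge_def)
    then have "x = 0" by (simp add: fun_eq_iff)
    then have "R x = 0" using R_zero by (simp only:)
    then show ?thesis by (simp add: ord_ge_def)
  qed
qed

definition comm :: "arr \<Rightarrow> arr" where
  "comm x = R (shift n x) - shift n (R x)"

lemma comm_ord:
  assumes "x \<in> Zsp n" "ord_ge p x"
  shows "ord_ge (Suc p) (comm x)"
proof -
  have "ord_ge (Suc p) (R (shift n x))"
    using assms by (intro R_ord Zsp_closed ord_ge_shift)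
  moreover have "ord_ge (Suc p) (shift n (R x))"
    using assms by (intro R_ord ord_ge_shift)
  ultimately show ?thesis
    by (simp add: ord_ge_def comm_def)
qed

text \<open>If the \<open>w\<^sub>l\<close> and the \<open>R w\<^sub>l\<close> are (almost) disjointly supported, then both \<open>R\<close> applied to the spread of
  the \<open>w\<^sub>l\<close> and the spread of the \<open>R w\<^sub>l\<close> are bounded; the difference is \<open>ln N\<close> times the commutator, up to
  terms of higher order.\<close>
lemma comm_lead:
  assumes C: "1 \<le> C" "\<And>x K. 0 < K \<Longrightarrow> Zbd n x K \<Longrightarrow> Zbd n (R x) (C * K)"
    and N: "0 < N" and w: "\<And>l. l < N \<Longrightarrow> Zbd n (w l) K" and ord: "\<And>l. l < N \<Longrightarrow> ord_ge p (w l)"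
    and supp: "\<And>l. l < N \<Longrightarrow> supp_in (A l) (w l)"
    and disj: "\<And>l l'. l < N \<Longrightarrow> l' < N \<Longrightarrow> l \<noteq> l' \<Longrightarrow> A l \<inter> A l' = {}"
    and R_supp: "\<And>l. l < N \<Longrightarrow> Zbd n (R (w l) - res (A l) (R (w l))) d"
    and d: "0 \<le> d" "real N * d * (1 + shift_const n * ln N) \<le> 1" and K: "0 < K" and p: "Suc p < n"
  shows "l2_le (\<lambda>i. of_real (ln N) * (of_real (1 / sqrt N) * comm (\<Sum>l<N. w l) (Suc p) i))
    (2 ^ Suc p * (2 * C * K + 1))"
proof -
  define a where "a = complex_of_real (1 / sqrt N)"
  define L where "L = complex_of_real (ln N)"
  have lnN: "0 \<le> ln (real N)" using N by simp
  have wZ: "w l \<in> Zsp n" if "l < N" for l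
    using w[OF that] Zsp_iff_Zbd by blast
  define x' where "x' = (\<lambda>l. res (A l) (R (w l)))"
  define W where "W = (\<Sum>l<N. w l)"
  define X' where "X' = (\<Sum>l<N. x' l)"
  define Df where "Df = (\<Sum>l<N. R (w l) - x' l)"
  have WZ: "W \<in> Zsp n" unfolding W_def by (intro Zsp_sum wZ)
  have RW: "R W = X' + Df"
    unfolding W_def using R_sum[of N w] wZ
    by (simp add: X'_def Df_def fun_eq_iff sum_arr_apply sum_subtractf)
  have "\<exists>G. Zbd n G K \<and> ord_ge (p + 2) (G - arr_scale a (W - arr_scale L (shift n W)))"
    unfolding a_def L_def W_def by (rule Zbd_spread[where A = A]) (use N w ord supp disj in auto)
  then obtain G where G: "Zbd n G K" "ord_ge (p + 2) (G - arr_scale a (W - arr_scale L (shift n W)))"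
    by blast
  have "\<exists>H. Zbd n H (C * K) \<and> ord_ge (p + 2) (H - arr_scale a (X' - arr_scale L (shift n X')))"
    unfolding a_def L_def X'_def
  proof (rule Zbd_spread[where A = A, OF N])
    fix l assume l: "l < N"
    show "Zbd n (x' l) (C * K)"
      unfolding x'_def by (intro Zbd_res C K w l)
    have "ord_ge p (R (w l))" by (intro R_ord wZ ord l)
    then show "ord_ge p (x' l)" by (simp add: ord_ge_def x'_def res_def)
    show "supp_in (A l) (x' l)" by (simp add: supp_in_def x'_def res_def)
  qed (use disj in auto)
  then obtain H where H: "Zbd n H (C * K)" "ord_ge (p + 2) (H - arr_scale a (X' - arr_scale L (shift n X')))"
    by blast
  \<comment> \<open>Both remainders start at index \<open>p + 2\<close> or later and stay invisible
    at index \<open>Suc p\<close>, \<open>O1\<close> even after applying \<open>R\<close>.\<close>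
  define O1 where "O1 = G - arr_scale a (W - arr_scale L (shift n W))"
  define O2 where "O2 = H - arr_scale a (X' - arr_scale L (shift n X'))"
  have GZ: "G \<in> Zsp n" using G(1) Zsp_iff_Zbd by blast
  have O1Z: "O1 \<in> Zsp n" unfolding O1_def by (intro Zsp_closed GZ WZ)
  have RO1: "ord_ge (p + 2) (R O1)"
    using G(2) O1Z by (intro R_ord) (simp_all add: O1_def)
  have RG: "R G = arr_scale a (R W - arr_scale L (R (shift n W))) + R O1"
  proof -
    have "G = arr_scale a (W - arr_scale L (shift n W)) + O1"
      by (simp add: O1_def)
    then have "R G = R (arr_scale a (W - arr_scale L (shift n W)) + O1)" by simp
    also have "\<dots> = R (arr_scale a (W - arr_scale L (shift n W))) + R O1"
      by (intro R_add Zsp_closed WZ O1Z)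
    also have "R (arr_scale a (W - arr_scale L (shift n W))) = arr_scale a (R (W - arr_scale L (shift n W)))"
      by (intro R_scale Zsp_closed WZ)
    also have "R (W - arr_scale L (shift n W)) = R W - R (arr_scale L (shift n W))"
      by (intro R_diff Zsp_closed WZ)
    also have "R (arr_scale L (shift n W)) = arr_scale L (R (shift n W))"
      by (intro R_scale Zsp_closed WZ)
    finally show ?thesis .
  qed
  \<comment> \<open>The last two terms undo the contribution of the part of the
    \<open>R (w l)\<close> lying outside the blocks, leaving the commutator and the
    remainders.\<close>
  define E where "E = R G - H - arr_scale a Df + arr_scale L (shift n (arr_scale a Df))"
  have E_eq: "E q i = R O1 q i - O2 q i - L * (a * comm W q i)" for q i
  proof -
    have "shift n (R W) q i = shift n X' q i + shift n Df q i"
      unfolding RW shift_add by simp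
    moreover have "R W q i = X' q i + Df q i"
      unfolding RW by simp
    ultimately show ?thesis
      by (simp add: E_def RG O2_def comm_def arr_scale_def shift_scale[unfolded arr_scale_def] algebra_simps)
  qed
  have aDf: "Zbd n (arr_scale a Df) (real N * d)"
    unfolding a_def Df_def using R_supp d(1) by (intro sqrt_scale_sum_Zbd[OF N]) (auto simp: x'_def)
  have shift_aDf: "Zbd n (arr_scale L (shift n (arr_scale a Df))) (ln N * (shift_const n * (real N * d)))"
  proof -
    have "Zbd n (shift n (arr_scale a Df)) (shift_const n * (real N * d))"
      using Zbd_shift_power[OF aDf, of 1] by simp
    then show ?thesis
      by (rule Zbd_weaken_scale) (use lnN in \<open>simp add: L_def\<close>)
  qed
  have "Zbd n E (C * K + C * K + real N * d + ln N * (shift_const n * (real N * d)))"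
    unfolding E_def by (intro Zbd_add Zbd_diff C K G(1) H(1) aDf shift_aDf)
  moreover have "C * K + C * K + real N * d + ln N * (shift_const n * (real N * d)) \<le> 2 * C * K + 1"
    using d(2) by (simp add: algebra_simps)
  ultimately have E: "Zbd n E (2 * C * K + 1)"
    by (rule Zbd_mono)
  have comm_W: "ord_ge (Suc p) (comm W)"
    using ord by (intro comm_ord WZ) (simp add: W_def ord_ge_sum)
  have O_low: "R O1 q i = 0" "O2 q i = 0" if "q < p + 2" for q i
    using RO1 H(2) that by (simp_all add: ord_ge_def O2_def)
  have "ord_ge (Suc p) E"
    using comm_W O_low by (simp add: ord_ge_def E_eq)
  then have "l2_le (E (Suc p)) (2 ^ Suc p * (2 * C * K + 1))"
    using Zbd_lead[OF E _ p] by blast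
  moreover have "E (Suc p) i = - (L * (a * comm W (Suc p) i))" for i
    using O_low[of "Suc p" i] by (simp add: E_eq)
  ultimately show ?thesis
    by (simp add: l2_le_def a_def L_def W_def)
qed

end

section \<open>Blocks whose images under the operator are almost disjoint as well\<close>

lemma finite_convergent_subsequence:
  fixes a :: "nat \<Rightarrow> 'i \<Rightarrow> complex"
  assumes "finite I" "\<And>t. t \<in> I \<Longrightarrow> bounded (range (\<lambda>l. a l t))"
  shows "\<exists>r. strict_mono r \<and> (\<forall>t\<in>I. convergent (\<lambda>l. a (r l) t))"
  using assms
proof (induction I)
  case empty
  then show ?case using strict_mono_id by auto
next
  case (insert t I)
  then obtain r where r: "strict_mono r" "\<And>t. t \<in> I \<Longrightarrow> convergent (\<lambda>l. a (r l) t)"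
    by blast
  have "bounded (range (\<lambda>l. a (r l) t))"
    by (rule bounded_subset[of "range (\<lambda>l. a l t)"]) (use insert.prems in auto)
  then obtain L s where s: "strict_mono s" "((\<lambda>l. a (r l) t) \<circ> s) \<longlonglongrightarrow> L"
    using bounded_imp_convergent_subsequence by blast
  have "convergent (\<lambda>l. a ((r \<circ> s) l) t')" if "t' \<in> insert t I" for t'
  proof (cases "t' = t")
    case True
    then show ?thesis using s(2) by (auto simp: convergent_def comp_def)
  next
    case False
    then have "convergent ((\<lambda>l. a (r l) t') \<circ> s)"
      using that r(2) s(1) convergent_subseq_convergent by blast
    then show ?thesis by (simp add: comp_def)
  qed
  then show ?case
    using strict_mono_o[OF r(1) s(1)] by blast
qed

text \<open>Bolzano-Weierstrass for finitely many coordinates at once: two late members of a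
  convergent subsequence are both close to the limit.\<close>

lemma pigeonhole_coordinates:
  fixes a :: "nat \<Rightarrow> 'i \<Rightarrow> complex"
  assumes "finite I" "\<And>l t. t \<in> I \<Longrightarrow> cmod (a l t) \<le> B" "0 < e"
  obtains l l' where "l < l'" "\<And>t. t \<in> I \<Longrightarrow> cmod (a l t - a l' t) \<le> e"
proof -
  have "bounded (range (\<lambda>l. a l t))" if "t \<in> I" for t
    using assms(2)[OF that] by (auto simp: bounded_iff)
  then obtain r where r: "strict_mono r" "\<And>t. t \<in> I \<Longrightarrow> convergent (\<lambda>l. a (r l) t)"
    using finite_convergent_subsequence[OF assms(1), of a] by blast
  define L where "L = (\<lambda>t. lim (\<lambda>l. a (r l) t))"
  have "\<forall>\<^sub>F l in sequentially. \<forall>t\<in>I. dist (a (r l) t) (L t) < e / 2"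
  proof (intro eventually_ball_finite assms(1) ballI)
    fix t assume "t \<in> I"
    then have "(\<lambda>l. a (r l) t) \<longlonglongrightarrow> L t"
      using r(2) by (simp add: L_def convergent_LIMSEQ_iff)
    then show "\<forall>\<^sub>F l in sequentially. dist (a (r l) t) (L t) < e / 2"
      by (rule tendstoD) (use assms(3) in simp)
  qed
  then obtain l0 where l0: "\<And>l t. l \<ge> l0 \<Longrightarrow> t \<in> I \<Longrightarrow> dist (a (r l) t) (L t) < e / 2"
    unfolding eventually_sequentially by blast
  show thesis
  proof (rule that[of "r l0" "r (Suc l0)"])
    show "r l0 < r (Suc l0)" using r(1) by (simp add: strict_mono_def)
    fix t assume t: "t \<in> I"
    have "dist (a (r l0) t) (a (r (Suc l0)) t) < e"
      by (rule dist_triangle_half_l[OF l0[OF order_refl t] l0[OF le_SucI[OF order_refl] t]])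
    then show "cmod (a (r l0) t - a (r (Suc l0)) t) \<le> e"
      by (simp add: dist_norm)
  qed
qed

context upper_tri
begin

text \<open>The images of a gliding hump need not move off to infinity, but by compactness two of
  them nearly agree on the coordinates below \<open>M\<close>, for all the finitely many powers
  \<open>b\<close>. The difference of the two humps has images that are small there, and their tails
  are cut off by enlarging \<open>M'\<close>.\<close>

lemma almost_disjoint_block:
  assumes k: "1 \<le> k" "k < n" and Y: "inf_subspace k Y" and d: "0 < d"
  shows "\<exists>M' y w. M < M' \<and> y \<in> Y \<and> ord_ge (k - 1) w \<and> supp_in {M..<M'} w \<and> Zbd n w 4 \<and>
    Zbd k (y - proj n k w) d \<and> \<not> Zbd k (proj n k w) (1/4) \<and>
    (\<forall>b<n - k. Zbd n (R ((shift n ^^ b) w) - res {M..<M'} (R ((shift n ^^ b) w))) d)"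
proof -
  have sub: "is_subspace Y" using Y by (simp add: inf_subspace_def)
  obtain C where C: "1 \<le> C" "\<And>x K. 0 < K \<Longrightarrow> Zbd n x K \<Longrightarrow> Zbd n (R x) (C * K)"
    by (rule R_bound) blast
  \<comment> \<open>The bound 1/4 keeps the approximants outside the quarter ball, since
    \<open>1/4 + d' \<le> 1/2\<close>; the bound \<open>d / 2\<close> allows for a difference of two
    humps.\<close>
  define d' where "d' = min (1/4) (d / 2)"
  have d': "0 < d'" "d' \<le> 1/4" "d' + d' \<le> d"
    using d by (auto simp: d'_def)
  have sp: "small_proj k (k - 1)"
    using k by (intro small_proj_less) simp
  define P where "P = (\<lambda>M M' (y, y', w). y \<in> Y \<and> \<not> Zbd k y' (1/4) \<and> ord_ge (k - 1) w \<and>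
    supp_in {M..<M'} w \<and> Zbd k (y - y') d' \<and> Zbd n w 2 \<and> proj n k w = y')"
  have "\<exists>M' c. M < M' \<and> P M M' c" for M
  proof -
    obtain M' y y' where y: "M < M'" "y \<in> Y" "\<not> Zbd k y (1/2)" "ord_ge (k - 1) y'"
      "supp_in {M..<M'} y'" "Zbd k (y - y') d'" "Zbd k y' (1 + d')"
      using small_proj_block[OF sp _ Y d'(1), of M] by auto
    obtain w where w: "Zbd n w (1 + d')" "proj n k w = y'" "supp_in {M..<M'} w"
      using Zbd_lift[OF y(7) _ y(5), of n] k by auto
    have "Zbd n w 2" using Zbd_mono[OF w(1)] d'(2) by simp
    moreover have "w q i = y' q i" if "q < k" for q i
      using w(2) that by (auto simp: proj_def)
    then have "ord_ge (k - 1) w"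
      using y(4) by (simp add: ord_ge_def)
    moreover have "\<not> Zbd k y' (1/4)"
    proof
      assume "Zbd k y' (1/4)"
      then have "Zbd k (y' + (y - y')) (1/4 + d')"
        using y(6) by (rule Zbd_add)
      moreover have "y' + (y - y') = y" by (simp add: fun_eq_iff)
      ultimately have "Zbd k y (1/4 + d')" by (simp only:)
      then show False
        using y(3) Zbd_mono[of k y "1/4 + d'" "1/2"] d'(2) by simp
    qed
    ultimately have "P M M' (y, y', w)"
      using y(2,6) w(2,3) by (simp add: P_def)
    then show ?thesis using y(1) by blast
  qed
  then obtain m c where m: "\<And>l::nat. m l < m (Suc l)" and c: "\<And>l. P (m l) (m (Suc l)) (c l)"
    and m0: "m 0 = M"
    using block_sequence[of P M] by blast
  define A where "A = (\<lambda>l. {m l..<m (Suc l)})"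
  define y where "y = (\<lambda>l. fst (c l))"
  define w where "w = (\<lambda>l. snd (snd (c l)))"
  have y: "y l \<in> Y" "\<not> Zbd k (proj n k (w l)) (1/4)" "ord_ge (k - 1) (w l)" "supp_in (A l) (w l)"
    "Zbd k (y l - proj n k (w l)) d'" "Zbd n (w l) 2" for l
    using c[of l] by (auto simp: P_def y_def w_def A_def split: prod.splits)
  have wZ: "w l \<in> Zsp n" for l
    using y(6) Zsp_iff_Zbd by blast
  have mono: "m a \<le> m b" if "a \<le> b" for a b
    by (rule lift_Suc_mono_le[OF _ that]) (use m less_imp_le in blast)
  \<comment> \<open>Chosen so that the crude estimate \<open>Zbd_small_coords\<close> on the
    coordinates below \<open>M\<close> costs at most \<open>d / 2\<close>; the summand 1 avoids
    division by zero.\<close>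
  define e where "e = d / 2 / (real n * (real M * shift_const n ^ n) + 1)"
  have "0 \<le> real n * (real M * shift_const n ^ n)"
    using shift_const_ge_1[of n] by (intro mult_nonneg_nonneg zero_le_power) auto
  then have e: "0 < e" "real n * (real M * (shift_const n ^ n * e)) \<le> d / 2"
    using d by (auto simp: e_def field_simps add_nonneg_pos)
  define f where "f = (\<lambda>l (b, q, i). R ((shift n ^^ b) (w l)) q i)"
  have f_bd: "cmod (f l t) \<le> 4 ^ n * (C * (shift_const n ^ n * 2))" if t: "t \<in> {..<n - k} \<times> {..<n} \<times> {..<M}" for l t
  proof -
    obtain b q i where t': "t = (b, q, i)" "b < n" using t by auto
    have "Zbd n ((shift n ^^ b) (w l)) (shift_const n ^ b * 2)"
      by (rule Zbd_shift_power[OF y(6)])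
    then have "Zbd n ((shift n ^^ b) (w l)) (shift_const n ^ n * 2)"
      by (rule Zbd_mono) (use t' shift_const_ge_1[of n] in \<open>simp add: power_increasing\<close>)
    moreover have "0 < shift_const n ^ n * 2"
      using shift_const_ge_1[of n] by simp
    ultimately show ?thesis
      unfolding t'(1) f_def prod.case by (intro Zbd_coord C)
  qed
  obtain l l' where ll: "l < l'"
    and close: "\<And>t. t \<in> {..<n - k} \<times> {..<n} \<times> {..<M} \<Longrightarrow> cmod (f l t - f l' t) \<le> e"
    by (rule pigeonhole_coordinates[of "{..<n - k} \<times> {..<n} \<times> {..<M}" f _ e, OF _ f_bd e(1)]) auto
  define v where "v = w l - w l'"
  have v: "Zbd n v 4"
    unfolding v_def using Zbd_diff[OF y(6)[of l] y(6)[of l']] by simp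
  have vZ: "(shift n ^^ b) v \<in> Zsp n" for b
    using v Zsp_iff_Zbd Zsp_closed(5) by blast
  define Rv where "Rv = (\<lambda>b. R ((shift n ^^ b) v))"
  have Rv_diff: "Rv b = R ((shift n ^^ b) (w l)) - R ((shift n ^^ b) (w l'))" for b
    unfolding Rv_def v_def shift_power_linear by (intro R_diff Zsp_closed wZ)
  have RvZ: "\<exists>K. Zbd n (Rv b) K" for b
    unfolding Rv_def using R_Zsp[OF vZ] Zsp_iff_Zbd by blast
  have "\<exists>M1. \<forall>M'\<ge>M1. Zbd n (res {M'..} (Rv b)) (d / 2)" for b
    using RvZ[of b] Zbd_tail[of n "Rv b" _ "d / 2"] d by auto
  then obtain T where T: "\<And>b M'. M' \<ge> T b \<Longrightarrow> Zbd n (res {M'..} (Rv b)) (d / 2)"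
    by metis
  \<comment> \<open>One right end beyond both supports and beyond the cut-off points of all the
    images.\<close>
  define M' where "M' = Suc M + m (Suc l') + (\<Sum>b<n - k. T b)"
  have M': "M < M'" "m (Suc l') \<le> M'" by (auto simp: M'_def)
  have TM': "T b \<le> M'" if "b < n - k" for b
    using member_le_sum[of b "{..<n - k}" T] that by (simp add: M'_def)
  have "Zbd n (Rv b - res {M..<M'} (Rv b)) d" if b: "b < n - k" for b
  proof -
    have eq: "Rv b - res {M..<M'} (Rv b) = res {..<M} (Rv b) + res {M'..} (Rv b)"
      using M'(1) by (auto simp: fun_eq_iff res_def)
    have "Zbd n (res {..<M} (Rv b)) (real n * (real M * (shift_const n ^ n * e)))"
    proof (rule Zbd_small_coords)
      show "Rv b j i = 0" if "n \<le> j" for j i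
        using RvZ[of b] Zbd_high that by blast
      show "cmod (Rv b j i) \<le> e" if "j < n" "i < M" for j i
        using close[of "(b, j, i)"] b that by (simp add: f_def Rv_diff)
    qed (use e in simp)
    then have "Zbd n (res {..<M} (Rv b)) (d / 2)"
      using e(2) by (rule Zbd_mono)
    then have "Zbd n (res {..<M} (Rv b) + res {M'..} (Rv b)) (d / 2 + d / 2)"
      by (intro Zbd_add T TM' b)
    then show ?thesis unfolding eq by simp
  qed
  moreover have "y l - y l' \<in> Y"
    by (intro subspace_closed[OF sub] y)
  moreover have "ord_ge (k - 1) v"
    using y(3)[of l] y(3)[of l'] by (simp add: ord_ge_def v_def)
  moreover have "supp_in {M..<M'} v"
    unfolding supp_in_def
  proof (intro allI impI)
    fix j i assume i: "i \<notin> {M..<M'}"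
    have "A l \<subseteq> {M..<M'}" "A l' \<subseteq> {M..<M'}"
      using mono[of 0 l] mono[of 0 l'] mono[of "Suc l" "Suc l'"] ll M'(2) m0 by (auto simp: A_def)
    then have "i \<notin> A l" "i \<notin> A l'" using i by blast+
    then have "w l j i = 0" "w l' j i = 0"
      using y(4) unfolding supp_in_def by blast+
    then show "v j i = 0" by (simp add: v_def)
  qed
  moreover have "Zbd k (y l - y l' - proj n k v) d"
  proof -
    have eq: "y l - y l' - proj n k v = (y l - proj n k (w l)) - (y l' - proj n k (w l'))"
      by (auto simp: fun_eq_iff v_def proj_def)
    show ?thesis
      unfolding eq using Zbd_mono[OF Zbd_diff[OF y(5)[of l] y(5)[of l']] d'(3)] .
  qed
  \<comment> \<open>The lower bound survives the difference, since restricting to the block of the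
    first hump recovers that hump.\<close>
  moreover have "\<not> Zbd k (proj n k v) (1/4)"
  proof
    assume "Zbd k (proj n k v) (1/4)"
    then have "Zbd k (res (A l) (proj n k v)) (1/4)"
      by (rule Zbd_res)
    moreover have "res (A l) (proj n k v) = proj n k (w l)"
    proof (intro ext)
      fix j i
      have "A l \<inter> A l' = {}"
        unfolding A_def using ll by (intro blocks_disjoint m) simp
      then have "i \<in> A l \<Longrightarrow> w l' j i = 0" "i \<notin> A l \<Longrightarrow> w l j i = 0"
        using y(4) unfolding supp_in_def by blast+
      then show "res (A l) (proj n k v) j i = proj n k (w l) j i"
        by (auto simp: res_def proj_def v_def)
    qed
    ultimately show False using y(2)[of l] by simp
  qed
  ultimately show ?thesis
    using M'(1) v unfolding Rv_def by blast
qed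

text \<open>Two preimages agree below index \<open>k\<close>, and \<open>R\<close> maps their
  difference to an array that again vanishes there; so the arbitrary choice in
  \<open>quot_op\<close> does not matter.\<close>

lemma quot_op_eq:
  assumes k: "1 \<le> k" "k < n" and x: "x \<in> Zsp n"
  shows "quot_op n k R (proj n k x) = proj n k (R x)"
proof -
  define x1 where "x1 = (SOME y. y \<in> Zsp n \<and> proj n k y = proj n k x)"
  have "x1 \<in> Zsp n \<and> proj n k x1 = proj n k x"
    unfolding x1_def by (rule someI[where x = x]) (use x in blast)
  then have x1: "x1 \<in> Zsp n" "proj n k x1 = proj n k x" by auto
  have "ord_ge k (x1 - x)"
    unfolding ord_ge_def
  proof (intro allI impI)
    fix q i assume "q < k"
    then show "(x1 - x) q i = 0"
      using fun_cong[OF fun_cong[OF x1(2), of q], of i] by (simp add: proj_def)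
  qed
  then have "ord_ge k (R (x1 - x))"
    using x x1(1) by (intro R_ord Zsp_closed)
  then have "ord_ge k (R x1 - R x)"
    using R_diff[OF x1(1) x] by simp
  then have "proj n k (R x1) = proj n k (R x)"
    by (intro ext) (auto simp: proj_def ord_ge_def)
  then show ?thesis
    unfolding quot_op_def x1_def .
qed

text \<open>\<open>(R\<^sub>k - R\<^sup>k) \<circ> \<pi>\<^bsub>n,k\<^esub>\<close>, i.e. the commutator of \<open>R\<close> with the \<open>n - k\<close>-th power of the shift, divided
  by that power.\<close>
definition corner :: "nat \<Rightarrow> arr \<Rightarrow> arr" where
  "corner k x = (\<lambda>j i. if j < k then R ((shift n ^^ (n - k)) x) (j + (n - k)) i - R x j i else 0)"

lemma corner_eq:
  assumes k: "1 \<le> k" "k < n" and x: "x \<in> Zsp n"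
  shows "arr_diff (restr_op n k R (proj n k x)) (quot_op n k R (proj n k x)) = corner k x"
proof -
  obtain K where "Zbd n x K" using x Zsp_iff_Zbd by blast
  then have eq: "emb k n (proj n k x) = (shift n ^^ (n - k)) x"
    using k by (intro emb_eq_shift_power) auto
  show ?thesis
    unfolding quot_op_eq[OF k x] restr_op_def eq
    by (auto simp: arr_diff_def emb_inv_def proj_def corner_def fun_eq_iff)
qed

lemma corner_linear:
  assumes "x \<in> Zsp n" "y \<in> Zsp n"
  shows "corner k (x + y) = corner k x + corner k y"
    "corner k (arr_scale c x) = arr_scale c (corner k x)"
proof -
  have "R ((shift n ^^ (n - k)) (x + y)) = R ((shift n ^^ (n - k)) x) + R ((shift n ^^ (n - k)) y)"
    unfolding shift_power_linear by (intro R_add Zsp_closed assms)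
  then show "corner k (x + y) = corner k x + corner k y"
    using R_add[OF assms] by (simp add: corner_def fun_eq_iff)
  have "R ((shift n ^^ (n - k)) (arr_scale c x)) = arr_scale c (R ((shift n ^^ (n - k)) x))"
    unfolding shift_power_linear by (intro R_scale Zsp_closed assms)
  then show "corner k (arr_scale c x) = arr_scale c (corner k x)"
    using R_scale[OF assms(1)] by (simp add: corner_def arr_scale_def fun_eq_iff algebra_simps)
qed

text \<open>By upper triangularity the image of the \<open>(n - k)\<close>-fold shift vanishes below
  index \<open>n - k\<close>, so it can be divided back by that power of \<open>z - 1/2\<close> at
  the cost of \<open>2 ^ (n - k)\<close>.\<close>

lemma corner_bound:
  assumes C: "\<And>x K. 0 < K \<Longrightarrow> Zbd n x K \<Longrightarrow> Zbd n (R x) (C * K)"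
    and k: "1 \<le> k" "k < n" and x: "Zbd n x K" and K: "0 < K"
  shows "Zbd k (corner k x) ((2 ^ (n - k) * (C * shift_const n ^ (n - k)) + C) * K)"
proof -
  let ?m = "n - k"
  have xZ: "x \<in> Zsp n" using x Zsp_iff_Zbd by blast
  have pos: "0 < shift_const n ^ ?m * K"
    using K shift_const_ge_1[of n] by simp
  have "Zbd n (R ((shift n ^^ ?m) x)) (C * (shift_const n ^ ?m * K))"
    by (intro C pos Zbd_shift_power x)
  then have "Zbd (k + ?m) (R ((shift n ^^ ?m) x)) (C * (shift_const n ^ ?m * K))"
    using k by simp
  moreover have "ord_ge ?m (R ((shift n ^^ ?m) x))"
    using ord_ge_shift_power[of 0 x ?m n] by (intro R_ord Zsp_closed xZ) (simp add: ord_ge_def)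
  ultimately have "Zbd k (\<lambda>j. R ((shift n ^^ ?m) x) (j + ?m)) (2 ^ ?m * (C * (shift_const n ^ ?m * K)))"
    by (rule Zbd_divide)
  moreover have "Zbd k (proj n k (R x)) (C * K)"
    using k by (intro Zbd_proj C K x) simp
  ultimately have "Zbd k ((\<lambda>j. R ((shift n ^^ ?m) x) (j + ?m)) - proj n k (R x))
      (2 ^ ?m * (C * (shift_const n ^ ?m * K)) + C * K)"
    by (rule Zbd_diff)
  moreover have "(\<lambda>j. R ((shift n ^^ ?m) x) (j + ?m)) - proj n k (R x) = corner k x"
  proof (intro ext)
    fix j i
    have "R ((shift n ^^ ?m) x) (j + ?m) i = 0" if "\<not> j < k"
    proof -
      have "R ((shift n ^^ ?m) x) \<in> Zsp n"
        by (intro R_Zsp Zsp_closed xZ)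
      then show ?thesis
        using Zbd_high that k unfolding Zsp_iff_Zbd by (metis add.commute le_add_diff_inverse less_imp_le_nat add_le_mono1 not_le)
    qed
    then show "((\<lambda>j. R ((shift n ^^ ?m) x) (j + ?m)) - proj n k (R x)) j i = corner k x j i"
      by (auto simp: corner_def proj_def)
  qed
  ultimately show ?thesis
    by (simp add: algebra_simps)
qed

text \<open>With \<open>S\<close> the shift and \<open>m = n - k\<close>, this is the telescoping of
  \<open>R S^m - S^m R\<close> into the terms \<open>S^(m-1-b) [R, S] S^b\<close>, read off at a
  single index.\<close>

lemma corner_lead:
  assumes k: "1 \<le> k" "k < n" and x: "x \<in> Zsp n" and ord: "ord_ge (k - 1) x"
  shows "ord_ge (k - 1) (corner k x)"
    "corner k x (k - 1) i = (\<Sum>b<n - k. comm ((shift n ^^ b) x) (k + b) i)"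
proof -
  have "ord_ge (k - 1 + (n - k)) (R ((shift n ^^ (n - k)) x))"
    by (intro R_ord Zsp_closed x ord_ge_shift_power ord)
  moreover have "ord_ge (k - 1) (R x)"
    by (intro R_ord x ord)
  ultimately show "ord_ge (k - 1) (corner k x)"
    by (auto simp: ord_ge_def corner_def)
  \<comment> \<open>The shift inside the commutator lowers the index \<open>k + b\<close> to
    \<open>k - 1 + b\<close>, so consecutive values of \<open>t\<close> differ by a commutator
    coefficient.\<close>
  define t where "t = (\<lambda>b. R ((shift n ^^ b) x) (k - 1 + b) i)"
  have "comm ((shift n ^^ b) x) (k + b) i = t (Suc b) - t b" if "b < n - k" for b
  proof -
    have "k + b < n" "k - 1 + Suc b = k + b" "k + b - 1 = k - 1 + b"
      using that k by auto
    then show ?thesis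
      using k by (simp add: comm_def t_def shift_def)
  qed
  then have "(\<Sum>b<n - k. comm ((shift n ^^ b) x) (k + b) i) = (\<Sum>b<n - k. t (Suc b) - t b)"
    by simp
  also have "\<dots> = t (n - k) - t 0"
    by (rule sum_lessThan_telescope)
  finally show "corner k x (k - 1) i = (\<Sum>b<n - k. comm ((shift n ^^ b) x) (k + b) i)"
    using k by (simp add: t_def corner_def)
qed

text \<open>On normalized sums of almost disjoint blocks \<open>corner\<close> has norm of order
  \<open>1 / L\<close>, by the commutator estimates, while the coefficient of index
  \<open>k - 1\<close> has l2 norm at least \<open>\<kappa>\<close>. The lower bound
  \<open>c\<close> would force this coefficient to be of order \<open>1 / L\<close> too.\<close>

lemma corner_not_bounded_below:
  assumes k: "1 \<le> k" "k < n" and Y: "inf_subspace k Y" and c: "0 < c"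
    and low: "\<And>x. x \<in> Zsp n \<Longrightarrow> proj n k x \<in> Y \<Longrightarrow> c * Znorm k (proj n k x) \<le> Znorm k (corner k x)"
  shows False
proof -
  have sub: "is_subspace Y" using Y by (simp add: inf_subspace_def)
  have Suck: "Suc (k - 1) = k" using k by simp
  obtain C where C: "1 \<le> C" "\<And>x K. 0 < K \<Longrightarrow> Zbd n x K \<Longrightarrow> Zbd n (R x) (C * K)"
    by (rule R_bound) blast
  define C' where "C' = 2 * shift_const k ^ (k - 1)"
  have C': "1 \<le> C'"
    using one_le_power[OF shift_const_ge_1[of k], of "k - 1"] by (simp add: C'_def)
  have lead: "Zbd k (proj n k x) (C' * K)" if "ord_ge (k - 1) x" "l2_le (x (k - 1)) K" for x K
    using Zbd_proj_lead[OF that, of n] by (simp only: Suck C'_def)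
  \<comment> \<open>A block whose coefficient of index \<open>k - 1\<close> had norm at most
    \<open>\<kappa>\<close> would project into the ball of radius 1/4, against the choice of the
    blocks.\<close>
  define \<kappa> where "\<kappa> = 1 / (4 * C')"
  have \<kappa>: "0 < \<kappa>" "C' * \<kappa> = 1/4" using C' by (auto simp: \<kappa>_def)
  define K0 where "K0 = 4 * shift_const n ^ n"
  have K0: "0 < K0" using shift_const_ge_1[of n] by (simp add: K0_def)
  define K2 where "K2 = 2 * C * K0 + 1"
  have K2: "0 < K2" using C(1) K0 by (simp add: K2_def add_nonneg_pos)
  \<comment> \<open>\<open>B / L\<close> will bound the main part of the image, one summand for each
    of the \<open>n - k\<close> commutators; \<open>CT\<close> below bounds \<open>corner\<close>
    and handles the errors.\<close>
  define B where "B = real (n - k) * (C' * (2 ^ n * K2))"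
  have B: "0 \<le> B" using C' K2 by (simp add: B_def)
  define CT where "CT = 2 ^ (n - k) * (C * shift_const n ^ (n - k)) + C"
  have CT: "0 < CT" using C(1) shift_const_ge_1[of n] by (simp add: CT_def add_nonneg_pos)
  \<comment> \<open>Makes \<open>Q / L\<close> a bound for the projected main part: the first term
    comes from the lower bound \<open>c\<close>, the 1 from the errors.\<close>
  define Q where "Q = 2 * (B + CT) / c + 1"
  have Q: "0 < Q" using B CT c by (simp add: Q_def add_nonneg_pos)
  obtain N :: nat where N: "0 < N" "2 ^ (k - 1) * Q < \<kappa> * ln N"
  proof -
    obtain N :: nat where N: "exp (2 ^ (k - 1) * Q / \<kappa>) < real N"
      using reals_Archimedean2 by blast
    then have "0 < real N" using exp_gt_zero less_trans by blast
    then have "2 ^ (k - 1) * Q / \<kappa> < ln N"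
      using N by (metis exp_less_cancel_iff exp_ln)
    then show thesis
      using that[of N] \<open>0 < real N\<close> \<kappa>(1) by (simp add: field_simps)
  qed
  define L where "L = ln (real N)"
  have "0 < 2 ^ (k - 1) * Q" using Q by simp
  then have L: "0 < L" using N(2) \<kappa>(1) unfolding L_def by (metis less_trans zero_less_mult_pos)
  define h where "h = 1 + shift_const n * L"
  have h: "0 < h" "L \<le> h"
  proof -
    have "1 * L \<le> shift_const n * L"
      using L by (intro mult_right_mono shift_const_ge_1) simp
    then show "0 < h" "L \<le> h"
      using L unfolding h_def by linarith+
  qed
  \<comment> \<open>\<open>real N * d * h = 1\<close> is the smallness that \<open>comm_lead\<close>
    asks for, and \<open>L \<le> h\<close> makes the summed errors at most
    \<open>1 / L\<close>.\<close>
  define d where "d = 1 / (real N * h)"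
  have d: "0 < d" "real N * d * h \<le> 1" "real N * d \<le> 1 / L" "0 < real N * d"
    using N(1) h L by (auto simp: d_def frac_le)
  define P where "P = (\<lambda>M M' (y, w). y \<in> Y \<and> ord_ge (k - 1) w \<and> supp_in {M..<M'} w \<and> Zbd n w 4 \<and>
    Zbd k (y - proj n k w) d \<and> \<not> Zbd k (proj n k w) (1/4) \<and>
    (\<forall>b<n - k. Zbd n (R ((shift n ^^ b) w) - res {M..<M'} (R ((shift n ^^ b) w))) d))"
  have "\<exists>M' p. M < M' \<and> P M M' p" for M
  proof -
    obtain M' y w where "M < M'" "P M M' (y, w)"
      using almost_disjoint_block[OF k Y d(1), of M] unfolding P_def prod.case by blast
    then show ?thesis by blast
  qed
  then obtain m p where m: "\<And>l::nat. m l < m (Suc l)" and P: "\<And>l. P (m l) (m (Suc l)) (p l)"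
    and "m 0 = 0"
    using block_sequence[of P 0] by blast
  define A where "A = (\<lambda>l. {m l..<m (Suc l)})"
  define y where "y = (\<lambda>l. fst (p l))"
  define w where "w = (\<lambda>l. snd (p l))"
  have "P (m l) (m (Suc l)) (y l, w l)" for l
    using P[of l] by (simp add: y_def w_def)
  then have yw: "y l \<in> Y" "ord_ge (k - 1) (w l)" "supp_in (A l) (w l)" "Zbd n (w l) 4"
    "Zbd k (y l - proj n k (w l)) d" "\<not> Zbd k (proj n k (w l)) (1/4)"
    "\<And>b. b < n - k \<Longrightarrow> Zbd n (R ((shift n ^^ b) (w l)) - res (A l) (R ((shift n ^^ b) (w l)))) d" for l
    unfolding P_def A_def prod.case by blast+
  have disj: "A l \<inter> A l' = {}" if "l \<noteq> l'" for l l'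
    unfolding A_def using m that by (rule blocks_disjoint)
  have wZ: "w l \<in> Zsp n" for l
    using yw(4) Zsp_iff_Zbd by blast
  have big: "\<kappa>\<^sup>2 \<le> (\<Sum>j\<in>A l. (cmod (w l (k - 1) j))\<^sup>2)" for l
  proof (rule ccontr)
    assume "\<not> \<kappa>\<^sup>2 \<le> (\<Sum>j\<in>A l. (cmod (w l (k - 1) j))\<^sup>2)"
    then have "l2_le (w l (k - 1)) \<kappa>"
      using \<kappa>(1) yw(3)[of l]
      by (intro l2_le_finite_support[of "A l"]) (auto simp: A_def supp_in_def)
    then have "Zbd k (proj n k (w l)) (1/4)"
      using lead[OF yw(2)[of l]] \<kappa>(2) by metis
    then show False using yw(6) by blast
  qed
  define a where "a = complex_of_real (1 / sqrt N)"
  have a2: "(cmod a)\<^sup>2 = 1 / N"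
    using N(1) by (simp add: a_def norm_divide power_divide)
  define V where "V = (\<Sum>l<N. w l)"
  have VZ: "V \<in> Zsp n" unfolding V_def by (intro Zsp_sum wZ)
  have V_ord: "ord_ge (k - 1) V" unfolding V_def by (intro ord_ge_sum yw)
  define u where "u = (\<lambda>b i. of_real L * (a * comm ((shift n ^^ b) V) (k + b) i))"
  have u: "l2_le (u b) (2 ^ n * K2)" if b: "b < n - k" for b
  proof -
    have "l2_le (\<lambda>i. of_real (ln N) * (of_real (1 / sqrt N) *
        comm (\<Sum>l<N. (shift n ^^ b) (w l)) (Suc (k - 1 + b)) i)) (2 ^ Suc (k - 1 + b) * (2 * C * K0 + 1))"
    proof (rule comm_lead[where A = A and d = d])
      fix l
      show "Zbd n ((shift n ^^ b) (w l)) K0"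
      proof (rule Zbd_mono[OF Zbd_shift_power[OF yw(4)]])
        have "shift_const n ^ b \<le> shift_const n ^ n"
          using b shift_const_ge_1[of n] by (intro power_increasing) auto
        then show "shift_const n ^ b * 4 \<le> K0" by (simp add: K0_def)
      qed
      show "ord_ge (k - 1 + b) ((shift n ^^ b) (w l))"
        by (intro ord_ge_shift_power yw)
      show "supp_in (A l) ((shift n ^^ b) (w l))"
        by (intro supp_in_shift_power yw)
    next
      show "Suc (k - 1 + b) < n" using b k by simp
    qed (use C N(1) disj yw(7)[OF b] d K0 in \<open>auto simp: h_def L_def\<close>)
    moreover have "Suc (k - 1 + b) = k + b" using k by simp
    ultimately have "l2_le (u b) (2 ^ (k + b) * K2)"
      by (simp only: u_def a_def L_def K2_def V_def shift_power_linear)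
    moreover have "2 ^ (k + b) * K2 \<le> 2 ^ n * K2"
      using b K2 by (intro mult_right_mono power_increasing) auto
    ultimately show ?thesis by (rule l2_le_mono)
  qed
  \<comment> \<open>Each commutator coefficient is placed alone at the top index
    \<open>k - 1\<close>. Since \<open>corner k V\<close> has no other nonzero coefficient, the sum
    of the \<open>x b\<close> is \<open>L\<close> times its scaled copy.\<close>
  define x where "x = (\<lambda>b j i. if j = k - 1 then u b i else 0)"
  have x: "Zbd k (x b) (C' * (2 ^ n * K2))" if "b < n - k" for b
  proof -
    have "ord_ge (k - 1) (x b)" by (simp add: ord_ge_def x_def)
    moreover have "x b (k - 1) = u b" by (simp add: x_def)
    ultimately have "Zbd k (proj n k (x b)) (C' * (2 ^ n * K2))"
      using lead u[OF that] by simp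
    moreover have "proj n k (x b) = x b"
      using k by (auto simp: proj_def x_def fun_eq_iff)
    ultimately show ?thesis by simp
  qed
  have corner_V: "Zbd k (arr_scale a (corner k V)) (B / L)"
  proof -
    have "Zbd k (\<Sum>b<n - k. x b) B"
      unfolding B_def by (intro Zbd_sum x)
    then have "Zbd k (arr_scale (of_real (1 / L)) (\<Sum>b<n - k. x b)) (B / L)"
      by (rule Zbd_weaken_scale) (use L in \<open>simp add: norm_divide\<close>)
    moreover have "arr_scale (of_real (1 / L)) (\<Sum>b<n - k. x b) = arr_scale a (corner k V)"
    proof (intro ext)
      fix j i
      have "(\<Sum>b<n - k. x b j i) = of_real L * (a * corner k V j i)"
      proof (cases j "k - 1" rule: linorder_cases)
        case less
        then show ?thesis
          using corner_lead(1)[OF k VZ V_ord] by (simp add: x_def ord_ge_def)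
      next
        case equal
        then show ?thesis
          using corner_lead(2)[OF k VZ V_ord] by (simp add: x_def u_def sum_distrib_left)
      next
        case greater
        then have "\<not> j < k" by simp
        then show ?thesis
          using greater by (simp add: x_def corner_def)
      qed
      then show "arr_scale (of_real (1 / L)) (\<Sum>b<n - k. x b) j i = arr_scale a (corner k V) j i"
        using L by (simp add: arr_scale_def sum_arr_apply)
    qed
    ultimately show ?thesis by (simp only:)
  qed
  \<comment> \<open>Lifting the errors to length \<open>n\<close> gives an array \<open>X\<close>
    whose projection is a normalized sum of the \<open>y l\<close> and so lies in \<open>Y\<close>,
    where \<open>low\<close> applies.\<close>
  have "\<exists>e. Zbd n e d \<and> proj n k e = y l - proj n k (w l)" for l
    using Zbd_lift[OF yw(5) _ supp_in_UNIV, of n] k by (metis less_imp_le_nat)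
  then obtain E where E: "\<And>l. Zbd n (E l) d" "\<And>l. proj n k (E l) = y l - proj n k (w l)"
    by metis
  define F where "F = arr_scale a (\<Sum>l<N. E l)"
  have F: "Zbd n F (real N * d)"
    unfolding F_def a_def using d by (intro sqrt_scale_sum_Zbd[OF N(1) E(1)]) auto
  have FZ: "F \<in> Zsp n" using F Zsp_iff_Zbd by blast
  have aVZ: "arr_scale a V \<in> Zsp n" by (intro Zsp_closed VZ)
  define X where "X = arr_scale a V + F"
  have XZ: "X \<in> Zsp n" unfolding X_def by (intro Zsp_closed aVZ FZ)
  have proj_F: "proj n k F = arr_scale a (\<Sum>l<N. y l - proj n k (w l))"
    unfolding E(2)[symmetric] by (auto simp: F_def fun_eq_iff proj_def arr_scale_def sum_arr_apply)
  have "proj n k X = arr_scale a (\<Sum>l<N. y l)"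
    unfolding X_def proj_add proj_F
    by (auto simp: V_def fun_eq_iff proj_def arr_scale_def sum_arr_apply sum_subtractf algebra_simps)
  then have XY: "proj n k X \<in> Y"
    using subspace_closed(3)[OF sub subspace_sum[OF sub]] yw(1) by simp
  have "corner k X = arr_scale a (corner k V) + corner k F"
    unfolding X_def by (simp only: corner_linear(1)[OF aVZ FZ] corner_linear(2)[OF VZ VZ])
  moreover have "Zbd k (corner k F) (CT * (real N * d))"
    unfolding CT_def by (rule corner_bound[OF C(2) k F d(4)])
  ultimately have "Zbd k (corner k X) (B / L + CT * (real N * d))"
    using Zbd_add[OF corner_V] by simp
  then have "Znorm k (corner k X) \<le> B / L + CT * (real N * d)"
    by (rule Znorm_le)
  also have "\<dots> \<le> B / L + CT * (1 / L)"
    using d(3) CT by (intro add_left_mono mult_left_mono) auto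
  finally have "c * Znorm k (proj n k X) \<le> (B + CT) / L"
    using low[OF XZ XY] by (simp add: add_divide_distrib)
  moreover have "0 < (B + CT) / L" using B CT L by simp
  ultimately have "c * Znorm k (proj n k X) < 2 * ((B + CT) / L)" by linarith
  then have "Znorm k (proj n k X) < 2 * (B + CT) / c / L"
    using c L by (simp add: field_simps)
  then have "Zbd k (proj n k X) (2 * (B + CT) / c / L)"
    using XY Y by (intro Znorm_less_imp_Zbd) (auto simp: inf_subspace_def)
  moreover have "Zbd k (proj n k F) (1 / L)"
    using Zbd_mono[OF Zbd_proj[OF F] d(3)] k by simp
  ultimately have "Zbd k (proj n k X - proj n k F) (2 * (B + CT) / c / L + 1 / L)"
    by (rule Zbd_diff)
  moreover have "proj n k X - proj n k F = proj n k (arr_scale a V)"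
    unfolding X_def proj_add by (simp add: fun_eq_iff)
  moreover have "2 * (B + CT) / c / L + 1 / L = Q / L"
    by (simp add: Q_def add_divide_distrib)
  ultimately have small: "Zbd k (proj n k (arr_scale a V)) (Q / L)"
    by (simp only:)
  have "ord_ge (k - 1) (proj n k (arr_scale a V))"
    using V_ord by (simp add: ord_ge_def proj_def arr_scale_def)
  then have "l2_le (proj n k (arr_scale a V) (k - 1)) (2 ^ (k - 1) * (Q / L))"
    using k by (intro Zbd_lead[OF small]) auto
  moreover have "proj n k (arr_scale a V) (k - 1) = (\<lambda>j. a * V (k - 1) j)"
    using k by (simp add: proj_def arr_scale_def)
  ultimately have l2: "l2_le (\<lambda>j. a * V (k - 1) j) (2 ^ (k - 1) * (Q / L))"
    by (simp only:)
  define U where "U = (\<Union>l<N. A l)"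
  have U: "finite U" by (simp add: U_def A_def)
  have "real N * \<kappa>\<^sup>2 \<le> (\<Sum>j\<in>U. (cmod (\<Sum>l<N. w l (k - 1) j))\<^sup>2)"
    unfolding U_def using yw(3) big disj
    by (intro disjoint_l2_lower) (auto simp: supp_in_def A_def)
  then have "\<kappa>\<^sup>2 \<le> (cmod a)\<^sup>2 * (\<Sum>j\<in>U. (cmod (V (k - 1) j))\<^sup>2)"
    using N(1) by (simp add: a2 V_def sum_arr_apply field_simps)
  also have "\<dots> = (\<Sum>j\<in>U. (cmod (a * V (k - 1) j))\<^sup>2)"
    by (simp add: norm_mult power_mult_distrib sum_distrib_left)
  also have "\<dots> \<le> (2 ^ (k - 1) * (Q / L))\<^sup>2"
    using l2 U unfolding l2_le_def by blast
  finally have "\<kappa>\<^sup>2 \<le> (2 ^ (k - 1) * (Q / L))\<^sup>2" .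
  then have "\<kappa> \<le> 2 ^ (k - 1) * (Q / L)"
    by (rule power2_le_imp_le) (use Q L in simp)
  then have "\<kappa> * L \<le> 2 ^ (k - 1) * Q"
    using L by (simp add: field_simps)
  then show False
    using N(2) by (simp add: L_def)
qed

end

theorem theorem7p1:
  fixes n k :: nat and R :: "arr \<Rightarrow> arr"
  assumes "2 \<le> n" and "upper_triangular n R" and "1 \<le> k" and "k < n"
  shows "strictly_singular k (\<lambda>x. arr_diff (restr_op n k R x) (quot_op n k R x))"
proof -
  interpret upper_tri n R
    by unfold_locales (rule assms(2))
  show ?thesis
    unfolding strictly_singular_def
  proof (rule notI, elim exE conjE)
    fix Y c
    assume Y: "Y \<subseteq> Zsp k" "is_subspace Y" "\<not> finite_dim Y" and c: "c > 0"
      and low: "\<forall>y\<in>Y. c * Znorm k y \<le> Znorm k (arr_diff (restr_op n k R y) (quot_op n k R y))"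
    have "inf_subspace k Y" using Y by (simp add: inf_subspace_def)
    moreover have "c * Znorm k (proj n k x) \<le> Znorm k (corner k x)"
      if "x \<in> Zsp n" "proj n k x \<in> Y" for x
      using low that corner_eq[OF assms(3,4) that(1)] by metis
    ultimately show False
      using corner_not_bounded_below[OF assms(3,4)] c by blast
  qed
qed

end
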